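(* Let $\mathcal H$ and $\mathcal K$ be complex separable Hilbert spaces, let $H_0$ be a self-adjoint operator on $\mathcal H$, and let $F\colon \mathcal H\to\mathcal K$ be a closed $|H_0|^{1/2}$-compact operator with zero kernel and zero co-kernel. Suppose that $H_0$ obeys the limiting absorption principle in the norm topology, i.e. for Lebesgue-a.e. $\lambda\in\mathbb R$ the operators $T_{\lambda+iy}(H_0)=F(H_0-\lambda-iy)^{-1}F^*$ converge in the operator norm as $y\to0^+$. Then for every bounded self-adjoint operator $J$ on $\mathcal K$ the operator $H_1=H_0+F^*JF$ obeys the limiting absorption principle in the norm topology, i.e. for Lebesgue-a.e. $\lambda\in\mathbb R$ the operators $T_{\lambda+iy}(H_1)=F(H_0+F^*JF-\lambda-iy)^{-1}F^*$ converge in the operator norm as $y\to0^+$.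
   Context: "$F$ is $|H_0|^{1/2}$-compact" means that $\operatorname{dom}(|H_0|^{1/2})\subset\operatorname{dom}(F)$ and $F(1+|H_0|)^{-1/2}$ is a compact operator from $\mathcal H$ to $\mathcal K$; in particular $F$ is densely defined and, being closed, has a densely defined adjoint $F^*$. Zero kernel and zero co-kernel means $\ker F=\{0\}$ and $\ker F^*=\{0\}$. The operator $H_1=H_0+F^*JF$ is understood in the form sense: with $Q=\operatorname{dom}(|H_0|^{1/2})$, it is the self-adjoint operator whose domain consists of those $f\in Q$ for which there is $h\in\mathcal H$ with $$\langle |H_0|^{1/2}g,\ \operatorname{sgn}(H_0)|H_0|^{1/2}f\rangle+\langle Fg,JFf\rangle=\langle g,h\rangle\quad\text{for all } g\in Q,$$ and $H_1f=h$. For $H\in\{H_0,H_1\}$ and non-real $z$, the resolvent is $R_z(H)=(H-z)^{-1}$, and $T_z(H)=FR_z(H)F^*$ denotes the sandwiched resolvent, i.e. the bounded operator on $\mathcal K$ which is the continuous extension of the densely defined operator $FR_z(H)F^*$ with domain $\operatorname{dom}(F^* )$. *)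

theory Defs
  imports "HOL-Analysis.Analysis"
begin

section \<open>Complex Hilbert spaces\<close>

class scaleC =
  fixes scaleC :: "complex \<Rightarrow> 'a \<Rightarrow> 'a"  (infixr "*\<^sub>C" 75)

text \<open>The complex inner product is linear in its second argument.  Its real part is the library's
  real inner product, so that the norm, the metric and the topology are the library ones.\<close>

class chilbert_space = scaleC + real_inner + complete_space +
  fixes cinner :: "'a \<Rightarrow> 'a \<Rightarrow> complex"
  assumes scaleC_of_real: "complex_of_real r *\<^sub>C x = r *\<^sub>R x"
    and scaleC_add_right: "a *\<^sub>C (x + y) = a *\<^sub>C x + a *\<^sub>C y"
    and scaleC_add_left: "(a + b) *\<^sub>C x = a *\<^sub>C x + b *\<^sub>C x"
    and scaleC_scaleC: "a *\<^sub>C b *\<^sub>C x = (a * b) *\<^sub>C x"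
    and cinner_commute: "cinner x y = cnj (cinner y x)"
    and cinner_add_right: "cinner x (y + z) = cinner x y + cinner x z"
    and cinner_scaleC_right: "cinner x (a *\<^sub>C y) = a * cinner x y"
    and Re_cinner: "Re (cinner x y) = inner x y"

instantiation complex :: chilbert_space
begin

definition scaleC_complex :: "complex \<Rightarrow> complex \<Rightarrow> complex"
  where "scaleC_complex a x = a * x"

definition cinner_complex :: "complex \<Rightarrow> complex \<Rightarrow> complex"
  where "cinner_complex x y = cnj x * y"

instance
  by standard
    (auto simp: scaleC_complex_def cinner_complex_def algebra_simps inner_complex_def scaleR_conv_of_real)

end

definition bounded_clinear :: "('a::chilbert_space \<Rightarrow> 'b::chilbert_space) \<Rightarrow> bool"
  where "bounded_clinear f \<longleftrightarrow> bounded_linear f \<and> (\<forall>a x. f (a *\<^sub>C x) = a *\<^sub>C f x)"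

definition bounded_self_adjoint :: "('a::chilbert_space \<Rightarrow> 'a) \<Rightarrow> bool"
  where "bounded_self_adjoint J \<longleftrightarrow>
    bounded_clinear J \<and> (\<forall>x y. cinner (J x) y = cinner x (J y))"

section \<open>Unbounded operators\<close>

text \<open>An operator with its domain is represented by its graph, so that the domain is
  \<^term>\<open>Domain A\<close>, the inverse is \<^term>\<open>converse A\<close>, the operator product \<open>B A\<close> is
  \<^term>\<open>A O B\<close> (natural domain; the factor that acts first stands on the left), equality of graphs
  is equality of operators including their domains, and \<^term>\<open>A\<close> is a closed operator iff
  the set \<^term>\<open>A\<close> is closed in the product topology.\<close>

type_synonym ('a, 'b) op_graph = "('a \<times> 'b) set"

definition linear_operator :: "('a::chilbert_space, 'b::chilbert_space) op_graph \<Rightarrow> bool"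
  where "linear_operator A \<longleftrightarrow>
    single_valued A \<and> (0, 0) \<in> A \<and>
    (\<forall>x y x' y'. (x, y) \<in> A \<longrightarrow> (x', y') \<in> A \<longrightarrow> (x + x', y + y') \<in> A) \<and>
    (\<forall>a x y. (x, y) \<in> A \<longrightarrow> (a *\<^sub>C x, a *\<^sub>C y) \<in> A)"

definition app :: "('a, 'b) op_graph \<Rightarrow> 'a \<Rightarrow> 'b"
  where "app A x = (THE y. (x, y) \<in> A)"

definition ker :: "('a, 'b::zero) op_graph \<Rightarrow> 'a set"
  where "ker A = {x. (x, 0) \<in> A}"

definition densely_defined :: "('a::chilbert_space, 'b::chilbert_space) op_graph \<Rightarrow> bool"
  where "densely_defined A \<longleftrightarrow> closure (Domain A) = UNIV"

definition adjoint_op ::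
    "('a::chilbert_space, 'b::chilbert_space) op_graph \<Rightarrow> ('b, 'a) op_graph"
  where "adjoint_op A = {(k, h). \<forall>(f, g)\<in>A. cinner g k = cinner f h}"

definition self_adjoint :: "('a::chilbert_space, 'a) op_graph \<Rightarrow> bool"
  where "self_adjoint A \<longleftrightarrow> linear_operator A \<and> densely_defined A \<and> adjoint_op A = A"

definition nonneg_op :: "('a::chilbert_space, 'a) op_graph \<Rightarrow> bool"
  where "nonneg_op A \<longleftrightarrow> (\<forall>(x, y)\<in>A. cinner x y \<in> \<real>\<^sub>\<ge>\<^sub>0)"

definition one_plus :: "('a::chilbert_space, 'a) op_graph \<Rightarrow> ('a, 'a) op_graph"
  where "one_plus A = {(x, x + y) | x y. (x, y) \<in> A}"

text \<open>Meaningful for a nonnegative self-adjoint \<^term>\<open>A\<close>, which has exactly one nonnegative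
  self-adjoint square root.\<close>

definition sqrt_op :: "('a::chilbert_space, 'a) op_graph \<Rightarrow> ('a, 'a) op_graph"
  where "sqrt_op A = (THE B. self_adjoint B \<and> nonneg_op B \<and> B O B = A)"

text \<open>\<open>|A| = (A\<^sup>* A)\<^sup>1\<^sup>/\<^sup>2\<close>\<close>

definition abs_op :: "('a::chilbert_space, 'a) op_graph \<Rightarrow> ('a, 'a) op_graph"
  where "abs_op A = sqrt_op (A O adjoint_op A)"

text \<open>The sign of a self-adjoint \<^term>\<open>A\<close> is the partial isometry \<open>U\<close> of its polar decomposition
  \<open>A = U |A|\<close>: it vanishes on the kernel of \<^term>\<open>A\<close> (the convention \<open>sgn 0 = 0\<close>) and is isometric
  on the orthogonal complement of that kernel.\<close>

definition sgn_op :: "('a::chilbert_space, 'a) op_graph \<Rightarrow> 'a \<Rightarrow> 'a"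
  where "sgn_op A = (THE U. bounded_clinear U \<and>
    (\<forall>x\<in>ker A. U x = 0) \<and>
    (\<forall>x. (\<forall>y\<in>ker A. cinner y x = 0) \<longrightarrow> norm (U x) = norm x) \<and>
    A = {(x, U y) | x y. (x, y) \<in> abs_op A})"

definition compact_operator :: "('a::chilbert_space, 'b::chilbert_space) op_graph \<Rightarrow> bool"
  where "compact_operator A \<longleftrightarrow>
    linear_operator A \<and> Domain A = UNIV \<and> compact (closure (A `` cball 0 1))"

section \<open>Perturbations and sandwiched resolvents\<close>

text \<open>\<^term>\<open>F\<close> is \<open>|H|\<^sup>1\<^sup>/\<^sup>2\<close>-compact; the last relation product is \<open>F (1 + |H|)\<^sup>-\<^sup>1\<^sup>/\<^sup>2\<close>.\<close>

definition sqrt_abs_compact ::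
    "('h::chilbert_space, 'h) op_graph \<Rightarrow> ('h, 'k::chilbert_space) op_graph \<Rightarrow> bool"
  where "sqrt_abs_compact H F \<longleftrightarrow>
    Domain (sqrt_op (abs_op H)) \<subseteq> Domain F \<and>
    compact_operator (converse (sqrt_op (one_plus (abs_op H))) O F)"

text \<open>The form sum \<open>H + F\<^sup>* J F\<close>.\<close>

definition form_perturbation ::
    "('h::chilbert_space, 'h) op_graph \<Rightarrow> ('h, 'k::chilbert_space) op_graph \<Rightarrow> ('k \<Rightarrow> 'k) \<Rightarrow>
      ('h, 'h) op_graph"
  where "form_perturbation H F J =
    (let S = sqrt_op (abs_op H); Q = Domain S in
      {(f, h). f \<in> Q \<and>
        (\<forall>g\<in>Q. cinner (app S g) (sgn_op H (app S f)) + cinner (app F g) (J (app F f))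
          = cinner g h)})"

text \<open>\<open>(H - z)\<^sup>-\<^sup>1\<close>\<close>

definition resolvent_op :: "('h::chilbert_space, 'h) op_graph \<Rightarrow> complex \<Rightarrow> ('h, 'h) op_graph"
  where "resolvent_op H z = {(h - z *\<^sub>C f, f) | f h. (f, h) \<in> H}"

text \<open>\<open>T\<close> is the bounded operator extending \<open>F (H - z)\<^sup>-\<^sup>1 F\<^sup>*\<close>, the latter being defined on all
  of \<open>dom F\<^sup>*\<close>.  When \<open>F\<^sup>*\<close> is densely defined there is at most one such \<open>T\<close>.\<close>

definition is_sandwiched_resolvent ::
    "('h::chilbert_space, 'h) op_graph \<Rightarrow> ('h, 'k::chilbert_space) op_graph \<Rightarrow> complex \<Rightarrow>
      ('k \<Rightarrow>\<^sub>L 'k) \<Rightarrow> bool"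
  where "is_sandwiched_resolvent H F z T \<longleftrightarrow>
    Domain (adjoint_op F O resolvent_op H z O F) = Domain (adjoint_op F) \<and>
    (\<forall>(k, l)\<in>adjoint_op F O resolvent_op H z O F. blinfun_apply T k = l)"

text \<open>Convergence in \<^typ>\<open>'k \<Rightarrow>\<^sub>L 'k\<close> is convergence in the operator norm.\<close>

definition limiting_absorption ::
    "('h::chilbert_space, 'h) op_graph \<Rightarrow> ('h, 'k::chilbert_space) op_graph \<Rightarrow> bool"
  where "limiting_absorption H F \<longleftrightarrow>
    (AE t in lebesgue. \<exists>(T :: real \<Rightarrow> 'k \<Rightarrow>\<^sub>L 'k) L.
      (\<forall>y>0. is_sandwiched_resolvent H F (Complex t y) (T y)) \<and>
      (T \<longlongrightarrow> L) (at_right 0))"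

end

theory Submission
  imports Defs "HOL-Complex_Analysis.Complex_Analysis"
begin

text \<open>
  With \<open>B = (1 + \<bar>H\<^sub>0\<bar>)\<^sup>-\<^sup>1\<^sup>/\<^sup>2\<close>, the compact \<open>G = F B\<close> and the bounded operator \<open>A\<close> of the form of \<open>H\<^sub>0\<close> pulled
  back along \<open>B\<close>, one has \<open>T\<^sub>z(H\<^sub>0) = G (A - z B\<^sup>2)\<^sup>-\<^sup>1 G\<^sup>*\<close>, and \<open>H\<^sub>1\<close> corresponds in the same way to
  \<open>A + G\<^sup>* J G\<close>.  Hence \<open>T\<^sub>z(H\<^sub>1) = (1 + T\<^sub>z(H\<^sub>0) J)\<^sup>-\<^sup>1 T\<^sub>z(H\<^sub>0)\<close>, and it remains to bound \<open>(1 + T\<^sub>z(H\<^sub>0) J)\<^sup>-\<^sup>1\<close> as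
  \<open>y \<rightarrow> 0\<close>.  Since \<open>G\<close> is compact, \<open>(1 - P) T\<^sub>z(H\<^sub>0) J\<close> is small for a suitable finite-rank projection \<open>P\<close>
  from a countable family, and the Schur complement on the range of \<open>P\<close> has the inverse
  \<open>P (1 - T\<^sub>z(H\<^sub>1) J) P\<close>.  Its matrix elements are combinations of the Herglotz functions
  \<open>z \<mapsto> \<langle>\<phi>, T\<^sub>z(H\<^sub>1) \<phi>\<rangle>\<close>, which stay bounded along a subsequence of any given \<open>y\<^sub>k \<rightarrow> 0\<close> for a.e. \<open>\<lambda>\<close>.

  In place of the spectral theorem, a self-adjoint \<open>H\<close> is described by the orthogonal projection
  onto its graph, and all functions of \<open>H\<close> that occur are built from bounded square roots.
\<close>


section \<open>Bounded operators on real Hilbert spaces\<close>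

text \<open>Pulling back along \<open>B\<close> turns the form sum into a bounded perturbation on
  one space, so the resolvent of \<open>H\<^sub>1\<close> is found by solving a bounded equation;
  Ehrling's inequality for the compact \<open>G\<close> keeps the perturbed pencil elliptic. The
  obstacle is that the limit of \<open>T\<^sub>z(H\<^sub>0)\<close> alone gives no invertibility of
  \<open>1 + T\<^sub>z(H\<^sub>0) J\<close> at the boundary. Harmonicity and Fatou's lemma yield
  only boundedness at infinitely many heights, with a constant depending on \<lambda>. One
  sufficiently small such height is enough: near its norm limit \<open>T\<^sub>z(H\<^sub>0)\<close>
  varies so little that a lower bound for \<open>1 + T\<^sub>z(H\<^sub>0) J\<close> at one point
  persists at all small heights. The projection depends on \<lambda>, but the null set has to be
  fixed beforehand. Hence the projections are chosen to approximate \<open>G\<close>, which depends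
  on neither \<lambda> nor the height, and form a countable family. Most arguments use the
  underlying real Hilbert space; complex linearity is commutation with multiplication by
  \<open>\<i>\<close>.\<close>

lemma closed_subspace_orthogonal_projection:
  fixes S :: "'a::{real_inner,complete_space} set"
  assumes S: "subspace S" "closed S"
  obtains p where "p \<in> S" "\<And>s. s \<in> S \<Longrightarrow> inner (x - p) s = 0"
proof -
  define D where "D = (INF s\<in>S. (norm (x - s))\<^sup>2)"
  have S0: "0 \<in> S" using S(1) by (rule subspace_0)
  have bdd: "bdd_below ((\<lambda>s. (norm (x - s))\<^sup>2) ` S)"
    by (rule bdd_belowI[of _ 0]) auto
  have D: "D \<le> (norm (x - s))\<^sup>2" if "s \<in> S" for s
    unfolding D_def by (rule cINF_lower[OF bdd that])
  have "\<exists>s\<in>S. (norm (x - s))\<^sup>2 < D + 1 / real (Suc n)" for n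
    using cINF_less_iff[of S "\<lambda>s. (norm (x - s))\<^sup>2" "D + 1 / real (Suc n)"] S0 bdd
    unfolding D_def[symmetric] by auto
  then obtain s where s: "\<And>n. s n \<in> S" "\<And>n. (norm (x - s n))\<^sup>2 < D + 1 / real (Suc n)"
    by metis
  \<comment> \<open>Parallelogram identity: the midpoint of two near-minimizers lies in
    \<open>S\<close>, so its squared distance to \<open>x\<close> is at least \<open>D\<close>,
    which forces the two points together.\<close>
  have par: "(norm (s m - s n))\<^sup>2 \<le> 2 / real (Suc m) + 2 / real (Suc n)" for m n
  proof -
    have "(1/2) *\<^sub>R (s m + s n) \<in> S"
      using S(1) s(1) by (simp add: subspace_add subspace_scale)
    then have "D \<le> (norm (x - (1/2) *\<^sub>R (s m + s n)))\<^sup>2" by (rule D)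
    moreover have "(norm (s m - s n))\<^sup>2 = 2 * (norm (x - s m))\<^sup>2 + 2 * (norm (x - s n))\<^sup>2
        - 4 * (norm (x - (1/2) *\<^sub>R (s m + s n)))\<^sup>2"
      unfolding power2_norm_eq_inner
      by (simp add: inner_diff_left inner_diff_right inner_add_left inner_add_right inner_commute algebra_simps)
    ultimately show ?thesis using s(2)[of m] s(2)[of n] by simp
  qed
  have "Cauchy s"
    unfolding Cauchy_def
  proof (intro allI impI)
    fix e :: real assume e: "e > 0"
    obtain M where M: "4 / e\<^sup>2 < real M" using reals_Archimedean2 by blast
    show "\<exists>M. \<forall>m\<ge>M. \<forall>n\<ge>M. dist (s m) (s n) < e"
    proof (intro exI allI impI)
      fix m n assume mn: "m \<ge> M" "n \<ge> M"
      have "4 < e\<^sup>2 * real M" using M e by (simp add: field_simps)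
      also have "\<dots> \<le> e\<^sup>2 * real (Suc M)" by (intro mult_left_mono) auto
      finally have M': "4 < e\<^sup>2 * real (Suc M)" .
      have "2 / real (Suc m) \<le> 2 / real (Suc M)" "2 / real (Suc n) \<le> 2 / real (Suc M)"
        using mn by (auto intro!: divide_left_mono)
      then have "(norm (s m - s n))\<^sup>2 \<le> 4 / real (Suc M)" using par[of m n] by simp
      also have "\<dots> < e\<^sup>2" using M' by (simp add: field_simps)
      finally show "dist (s m) (s n) < e"
        using e by (simp add: dist_norm power2_less_imp_less)
    qed
  qed
  then obtain p where p: "s \<longlonglongrightarrow> p" using Cauchy_convergent convergent_def by blast
  have pS: "p \<in> S" using closed_sequentially[OF S(2)] s(1) p by blast
  have "(\<lambda>n. (norm (x - s n))\<^sup>2) \<longlonglongrightarrow> (norm (x - p))\<^sup>2" by (intro tendsto_intros p)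
  moreover have "(\<lambda>n. D + 1 / real (Suc n)) \<longlonglongrightarrow> D + 0"
    by (intro tendsto_intros LIMSEQ_inverse_real_of_nat[unfolded inverse_eq_divide])
  ultimately have pD: "(norm (x - p))\<^sup>2 \<le> D"
    using LIMSEQ_le[of "\<lambda>n. (norm (x - s n))\<^sup>2" "(norm (x - p))\<^sup>2" "\<lambda>n. D + 1 / real (Suc n)" "D + 0"]
      less_imp_le[OF s(2)] by auto
  have "inner (x - p) s = 0" if sS: "s \<in> S" for s
  proof (cases "s = 0")
    case False
    \<comment> \<open>The value that minimizes the squared norm of
      \<open>(x - p) - t *\<^sub>R s\<close>.\<close>
    define t where "t = inner (x - p) s / inner s s"
    have ss: "inner s s > 0" using False by simp
    have "p + t *\<^sub>R s \<in> S" using S(1) pS sS by (simp add: subspace_add subspace_scale)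
    then have "(norm (x - p))\<^sup>2 \<le> (norm (x - (p + t *\<^sub>R s)))\<^sup>2" using D[of "p + t *\<^sub>R s"] pD by (meson order_trans)
    also have "x - (p + t *\<^sub>R s) = (x - p) - t *\<^sub>R s" by simp
    also have "(norm ((x - p) - t *\<^sub>R s))\<^sup>2 = (norm (x - p))\<^sup>2 - 2 * t * inner (x - p) s + t * t * inner s s"
      unfolding power2_norm_eq_inner by (simp only: inner_diff_left[of "x - p"] inner_diff_right[of _ "x - p"] inner_scaleR_left inner_scaleR_right inner_commute[of s "x - p"]) algebra
    finally have "2 * t * inner (x - p) s \<le> t * t * inner s s" by simp
    then have "(inner (x - p) s)\<^sup>2 \<le> 0" using ss unfolding t_def by (simp add: field_simps power2_eq_square)
    then show ?thesis by simp
  qed simp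
  with pS that show thesis by blast
qed

lemma subspace_closure:
  fixes S :: "'a::real_normed_vector set"
  assumes "subspace S"
  shows "subspace (closure S)"
  unfolding subspace_def
proof (intro conjI ballI allI)
  show "0 \<in> closure S" using assms closure_subset subspace_0 by blast
next
  fix x y assume "x \<in> closure S" "y \<in> closure S"
  then obtain u v where uv: "\<And>n. u n \<in> S" "u \<longlonglongrightarrow> x" "\<And>n. v n \<in> S" "v \<longlonglongrightarrow> y"
    unfolding closure_sequential by metis
  have "(\<lambda>n. u n + v n) \<longlonglongrightarrow> x + y" by (intro tendsto_add uv)
  moreover have "u n + v n \<in> S" for n using assms uv by (simp add: subspace_add)
  ultimately show "x + y \<in> closure S" unfolding closure_sequential by (metis (no_types, lifting))
next
  fix c :: real and x assume "x \<in> closure S"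
  then obtain u where u: "\<And>n. u n \<in> S" "u \<longlonglongrightarrow> x" unfolding closure_sequential by metis
  have "(\<lambda>n. c *\<^sub>R u n) \<longlonglongrightarrow> c *\<^sub>R x" by (intro tendsto_scaleR tendsto_const u)
  moreover have "c *\<^sub>R u n \<in> S" for n using assms u by (simp add: subspace_scale)
  ultimately show "c *\<^sub>R x \<in> closure S" unfolding closure_sequential by (metis (no_types, lifting))
qed

lemma subspace_orthogonal_zero_dense:
  fixes S :: "'a::{real_inner,complete_space} set"
  assumes "subspace S" and "\<And>y. (\<And>s. s \<in> S \<Longrightarrow> inner y s = 0) \<Longrightarrow> y = 0"
  shows "closure S = UNIV"
proof -
  have "x \<in> closure S" for x
  proof -
    obtain p where p: "p \<in> closure S" "\<And>s. s \<in> closure S \<Longrightarrow> inner (x - p) s = 0"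
      using closed_subspace_orthogonal_projection[of "closure S" x] assms(1) subspace_closure by blast
    have "x - p = 0" using assms(2) p(2) closure_subset by blast
    then show ?thesis using p(1) by simp
  qed
  then show ?thesis by auto
qed

lemma inner_eq_zero_dense:
  fixes y :: "'a::real_inner"
  assumes "closure S = UNIV" "\<And>s. s \<in> S \<Longrightarrow> inner y s = 0"
  shows "y = 0"
proof -
  have "inner y y = 0"
    using continuous_constant_on_closure[of S "\<lambda>s. inner y s" 0 y] assms
    by (simp add: continuous_on_inner continuous_on_const continuous_on_id)
  then show ?thesis by simp
qed

text \<open>The component of some \<open>v\<close> outside the closed kernel that is orthogonal to
  the kernel spans the complement, and a multiple of it represents \<open>f\<close>.\<close>

lemma riesz_representation:
  fixes f :: "'a::{real_inner,complete_space} \<Rightarrow> real"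
  assumes f: "bounded_linear f"
  obtains a where "\<And>x. f x = inner a x"
proof (cases "\<forall>x. f x = 0")
  case True
  then show ?thesis using that[of 0] by simp
next
  case False
  then obtain v where v: "f v \<noteq> 0" by blast
  interpret f: bounded_linear f by (rule f)
  define S where "S = {x. f x = 0}"
  have "subspace S" unfolding S_def subspace_def by (auto simp: f.add f.scaleR f.zero)
  moreover have "closed S" unfolding S_def
    by (intro closed_Collect_eq continuous_intros f.continuous_on continuous_on_id)
  ultimately obtain p where p: "p \<in> S" "\<And>s. s \<in> S \<Longrightarrow> inner (v - p) s = 0"
    using closed_subspace_orthogonal_projection[of S v] by blast
  define w where "w = v - p"
  have fw: "f w = f v" using p(1) by (simp add: w_def f.diff S_def)
  have w0: "inner w w \<noteq> 0" using fw v f.zero by auto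
  show ?thesis
  proof (rule that)
    fix x
    have "x - (f x / f w) *\<^sub>R w \<in> S" unfolding S_def using fw v by (simp add: f.diff f.scaleR)
    then have "inner w (x - (f x / f w) *\<^sub>R w) = 0" using p(2) w_def by blast
    then have "inner w x = (f x / f w) * inner w w" by (simp add: inner_diff_right)
    then show "f x = inner ((f w / inner w w) *\<^sub>R w) x" using fw v w0 by (simp add: field_simps)
  qed
qed

lemma adjoint_blinfun_exists:
  fixes G :: "'a::{real_inner,complete_space} \<Rightarrow>\<^sub>L 'b::real_inner"
  obtains Gs :: "'b \<Rightarrow>\<^sub>L 'a" where "\<And>x y. inner (Gs y) x = inner y (G x)"
proof -
  have "\<exists>a. \<forall>x. inner a x = inner y (G x)" for y
  proof -
    have "bounded_linear (\<lambda>x. inner y (G x))"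
      by (intro bounded_linear_compose[OF bounded_linear_inner_right] blinfun.bounded_linear_right)
    then show ?thesis using riesz_representation[of "\<lambda>x. inner y (G x)"] by metis
  qed
  then obtain g where g: "\<And>y x. inner (g y) x = inner y (G x)" by metis
  have "bounded_linear g"
  proof (rule bounded_linear_intro[where K = "norm G"])
    show "g (x + y) = g x + g y" for x y
      by (rule vector_eq_ldot[THEN iffD1])
        (metis (no_types, lifting) g inner_add_left inner_add_right inner_commute)
    show "g (r *\<^sub>R x) = r *\<^sub>R g x" for r x
      by (rule vector_eq_ldot[THEN iffD1])
        (metis (no_types, lifting) g inner_scaleR_left inner_scaleR_right inner_commute)
    show "norm (g y) \<le> norm y * norm G" for y
    proof (cases "g y = 0")
      case False
      have "norm (g y) * norm (g y) = inner y (G (g y))"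
        by (metis g power2_eq_square power2_norm_eq_inner)
      also have "\<dots> \<le> norm y * norm (G (g y))" by (rule norm_cauchy_schwarz)
      also have "\<dots> \<le> norm y * (norm G * norm (g y))" by (intro mult_left_mono norm_blinfun) simp
      finally show ?thesis using False by (simp add: mult.assoc[symmetric])
    qed simp
  qed
  then show ?thesis using that[of "Blinfun g"] g by (simp add: bounded_linear_Blinfun_apply)
qed

text \<open>The lower bound makes the range complete and hence closed, and \<open>orth\<close> makes
  it dense, so \<open>A\<close> is onto.\<close>

lemma bounded_below_blinfun_inverse:
  fixes A :: "'a::{real_inner,banach} \<Rightarrow>\<^sub>L 'a"
  assumes c: "\<And>x. norm x \<le> c * norm (A x)"
    and orth: "\<And>y. (\<And>x. inner y (A x) = 0) \<Longrightarrow> y = 0"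
  obtains M :: "'a \<Rightarrow>\<^sub>L 'a" where "\<And>x. A (M x) = x" "\<And>x. M (A x) = x" "\<And>x. norm (M x) \<le> c * norm x"
proof -
  \<comment> \<open>\<open>c\<close> may have any sign here; \<open>|c| + 1\<close> is a positive
    constant that also works.\<close>
  define e where "e = inverse (\<bar>c\<bar> + 1)"
  have e: "e > 0" by (simp add: e_def)
  have le: "e * norm x \<le> norm (A x)" for x
  proof -
    have "norm x \<le> (\<bar>c\<bar> + 1) * norm (A x)"
      using c[of x] mult_right_mono[OF order_trans[OF abs_ge_self[of c] less_imp_le[OF less_add_one]] norm_ge_zero[of "A x"]]
      by (rule order_trans)
    then show ?thesis by (simp add: e_def field_simps)
  qed
  have "complete (range A)"
    using complete_isometric_image[OF e subspace_UNIV blinfun.bounded_linear_right[of A] _ complete_UNIV] le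
    by simp
  then have "closed (range A)" by (rule complete_imp_closed)
  moreover have "closure (range A) = UNIV"
  proof (rule subspace_orthogonal_zero_dense)
    show "subspace (range A)"
      by (intro linear_subspace_image subspace_UNIV bounded_linear.linear blinfun.bounded_linear_right)
  qed (use orth in blast)
  ultimately have surj: "range A = UNIV" by (simp add: closure_closed)
  have inj: "x = y" if "A x = A y" for x y
  proof -
    have "A (x - y) = 0" using that by (simp add: blinfun.diff_right)
    then have "norm (x - y) \<le> 0" using c[of "x - y"] by simp
    then show ?thesis by simp
  qed
  define m where "m = inv (blinfun_apply A)"
  have Am: "A (m x) = x" for x unfolding m_def using surj by (simp add: surj_f_inv_f)
  have mA: "m (A x) = x" for x by (rule inj) (rule Am)
  have nm: "norm (m x) \<le> c * norm x" for x using c[of "m x"] by (simp add: Am)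
  have "bounded_linear m"
  proof (rule bounded_linear_intro[where K = c])
    show "m (x + y) = m x + m y" for x y by (rule inj) (simp add: Am blinfun.add_right)
    show "m (r *\<^sub>R x) = r *\<^sub>R m x" for r x by (rule inj) (simp add: Am blinfun.scaleR_right)
    show "norm (m x) \<le> norm x * c" for x using nm[of x] by (simp add: mult.commute)
  qed
  then show ?thesis using that[of "Blinfun m"] Am mA nm by (simp add: bounded_linear_Blinfun_apply)
qed

section \<open>Symmetric operators, commutation and positive square roots\<close>

definition symmetric_blinfun :: "('a::real_inner \<Rightarrow>\<^sub>L 'a) \<Rightarrow> bool"
  where "symmetric_blinfun A \<longleftrightarrow> (\<forall>x y. inner (A x) y = inner x (A y))"

definition commuting :: "('a::real_normed_vector \<Rightarrow>\<^sub>L 'a) \<Rightarrow> ('a \<Rightarrow>\<^sub>L 'a) \<Rightarrow> bool"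
  where "commuting A X \<longleftrightarrow> (\<forall>x. A (X x) = X (A x))"

lemma symmetric_blinfunD: "symmetric_blinfun A \<Longrightarrow> inner (A x) y = inner x (A y)"
  unfolding symmetric_blinfun_def by blast

lemma commutingD: "commuting A X \<Longrightarrow> A (X x) = X (A x)"
  unfolding commuting_def by blast

lemma commuting_sym: "commuting A X \<Longrightarrow> commuting X A"
  unfolding commuting_def by simp

lemma commuting_limit:
  assumes "\<And>n. commuting (Y n) X" "Y \<longlonglongrightarrow> S"
  shows "commuting S X"
  unfolding commuting_def
proof
  fix x
  have "(\<lambda>n. Y n (X x)) \<longlonglongrightarrow> S (X x)" "(\<lambda>n. X (Y n x)) \<longlonglongrightarrow> X (S x)"
    by (intro blinfun.tendsto assms(2) tendsto_const)+
  then show "S (X x) = X (S x)"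
    using assms(1) LIMSEQ_unique unfolding commuting_def by (metis (no_types, lifting) ext)
qed

lemma symmetric_limit:
  assumes "\<And>n. symmetric_blinfun (Y n)" "Y \<longlonglongrightarrow> S"
  shows "symmetric_blinfun S"
  unfolding symmetric_blinfun_def
proof (intro allI)
  fix x y
  have "(\<lambda>n. inner (Y n x) y) \<longlonglongrightarrow> inner (S x) y" "(\<lambda>n. inner x (Y n y)) \<longlonglongrightarrow> inner x (S y)"
    by (intro tendsto_inner blinfun.tendsto assms(2) tendsto_const)+
  then show "inner (S x) y = inner x (S y)"
    using assms(1) LIMSEQ_unique unfolding symmetric_blinfun_def by (metis (no_types, lifting) ext)
qed

text \<open>The recursion behind the binomial series of \<open>1 - (1 - X)\<^sup>1\<^sup>/\<^sup>2\<close>; the same recursion for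
  the scalar \<open>X = 1\<close> dominates the increments.\<close>

primrec sqrt_iter :: "('a::real_normed_vector \<Rightarrow>\<^sub>L 'a) \<Rightarrow> nat \<Rightarrow> ('a \<Rightarrow>\<^sub>L 'a)"
  where
    "sqrt_iter X 0 = 0"
  | "sqrt_iter X (Suc n) = (1/2) *\<^sub>R (X + (sqrt_iter X n o\<^sub>L sqrt_iter X n))"

primrec sqrt_iter_bound :: "nat \<Rightarrow> real"
  where
    "sqrt_iter_bound 0 = 0"
  | "sqrt_iter_bound (Suc n) = (1 + (sqrt_iter_bound n)\<^sup>2) / 2"

lemma sqrt_iter_bound_bounds: "0 \<le> sqrt_iter_bound n \<and> sqrt_iter_bound n \<le> 1"
proof (induction n)
  case (Suc n)
  then have "(sqrt_iter_bound n)\<^sup>2 \<le> 1" by (simp add: power_le_one)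
  then show ?case by simp
qed simp

lemma sqrt_iter_bound_incseq: "incseq sqrt_iter_bound"
proof (rule incseq_SucI)
  fix n
  have "0 \<le> (1 - sqrt_iter_bound n)\<^sup>2" by simp
  then show "sqrt_iter_bound n \<le> sqrt_iter_bound (Suc n)"
    by (simp add: power2_diff field_simps)
qed

lemma norm_sqrt_iter:
  assumes "norm X \<le> 1"
  shows "norm (sqrt_iter X n) \<le> sqrt_iter_bound n"
proof (induction n)
  case (Suc n)
  have "norm (sqrt_iter X n o\<^sub>L sqrt_iter X n) \<le> (sqrt_iter_bound n)\<^sup>2"
    using norm_blinfun_compose[of "sqrt_iter X n" "sqrt_iter X n"] Suc
    by (smt (verit, best) mult_mono norm_ge_zero power2_eq_square)
  then have "norm (X + (sqrt_iter X n o\<^sub>L sqrt_iter X n)) \<le> 1 + (sqrt_iter_bound n)\<^sup>2"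
    using assms norm_triangle_ineq by (smt (verit))
  then show ?case by simp
qed simp

lemma norm_sqrt_iter_step:
  assumes "norm X \<le> 1"
  shows "norm (sqrt_iter X (Suc n) - sqrt_iter X n) \<le> sqrt_iter_bound (Suc n) - sqrt_iter_bound n"
proof (induction n)
  case 0
  then show ?case using assms by simp
next
  case (Suc n)
  define a b where "a = sqrt_iter X (Suc n)" and "b = sqrt_iter X n"
  define p q where "p = sqrt_iter_bound (Suc n)" and "q = sqrt_iter_bound n"
  have ab: "norm a \<le> p" "norm b \<le> q" "norm (a - b) \<le> p - q"
    using Suc norm_sqrt_iter[OF assms] by (auto simp: a_def b_def p_def q_def simp del: sqrt_iter.simps sqrt_iter_bound.simps)
  have pq: "0 \<le> p" "0 \<le> q" using sqrt_iter_bound_bounds by (auto simp: p_def q_def simp del: sqrt_iter_bound.simps)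
  have "sqrt_iter X (Suc (Suc n)) = (1/2) *\<^sub>R (X + (a o\<^sub>L a))" "sqrt_iter X (Suc n) = (1/2) *\<^sub>R (X + (b o\<^sub>L b))"
    by (simp_all add: a_def b_def)
  \<comment> \<open>The factorization \<open>a a - b b = a (a - b) + (a - b) b\<close> holds without
    commutation; for scalars it makes the resulting bound exactly the next increment.\<close>
  then have "sqrt_iter X (Suc (Suc n)) - sqrt_iter X (Suc n) = (1/2) *\<^sub>R ((a o\<^sub>L (a - b)) + ((a - b) o\<^sub>L b))"
    by (simp only:) (rule blinfun_eqI, simp add: blinfun.bilinear_simps scaleR_right_diff_distrib scaleR_add_right)
  also have "norm \<dots> \<le> (1/2) * (norm a * norm (a - b) + norm (a - b) * norm b)"
    using norm_triangle_ineq[of "a o\<^sub>L (a - b)" "(a - b) o\<^sub>L b"] norm_blinfun_compose[of a "a - b"] norm_blinfun_compose[of "a - b" b]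
    by simp
  also have "\<dots> \<le> (1/2) * (p * (p - q) + (p - q) * q)"
    using ab pq norm_ge_zero[of "a - b"] by (intro mult_left_mono add_mono mult_mono) (linarith | simp)+
  also have "\<dots> = sqrt_iter_bound (Suc (Suc n)) - sqrt_iter_bound (Suc n)"
    unfolding sqrt_iter_bound.simps(2)[of "Suc n"] p_def[symmetric]
    by (simp add: p_def q_def[symmetric] field_simps power2_eq_square)
  finally show ?case .
qed

text \<open>For \<open>norm X = 1\<close> the increments need not decay geometrically. Telescoping
  compares them with those of the scalar sequence, which is monotone and bounded and therefore
  Cauchy.\<close>

lemma Cauchy_sqrt_iter:
  assumes "norm X \<le> 1"
  shows "Cauchy (sqrt_iter X)"
proof -
  have *: "norm (sqrt_iter X (m + k) - sqrt_iter X m) \<le> sqrt_iter_bound (m + k) - sqrt_iter_bound m" for m k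
  proof (induction k)
    case (Suc k)
    have "norm (sqrt_iter X (m + Suc k) - sqrt_iter X m) \<le>
        norm (sqrt_iter X (Suc (m + k)) - sqrt_iter X (m + k)) + norm (sqrt_iter X (m + k) - sqrt_iter X m)"
      using norm_triangle_ineq[of "sqrt_iter X (Suc (m + k)) - sqrt_iter X (m + k)" "sqrt_iter X (m + k) - sqrt_iter X m"]
      by (simp del: sqrt_iter.simps)
    then show ?case using Suc norm_sqrt_iter_step[OF assms, of "m + k"] by (simp del: sqrt_iter.simps sqrt_iter_bound.simps)
  qed simp
  have "convergent sqrt_iter_bound"
    using incseq_convergent[OF sqrt_iter_bound_incseq, of 1] sqrt_iter_bound_bounds
    by (metis convergent_def)
  then have C: "Cauchy sqrt_iter_bound" by (rule convergent_Cauchy)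
  show ?thesis
  proof (rule metric_CauchyI)
    fix e :: real assume "e > 0"
    then obtain M where M: "\<And>m n. m \<ge> M \<Longrightarrow> n \<ge> M \<Longrightarrow> dist (sqrt_iter_bound m) (sqrt_iter_bound n) < e"
      using C unfolding Cauchy_def by metis
    have **: "dist (sqrt_iter X m) (sqrt_iter X n) < e" if "M \<le> m" "m \<le> n" for m n
    proof -
      obtain k where k: "n = m + k" using \<open>m \<le> n\<close> le_Suc_ex by blast
      have "dist (sqrt_iter X m) (sqrt_iter X n) \<le> dist (sqrt_iter_bound m) (sqrt_iter_bound n)"
        using *[of m k] unfolding k by (simp add: dist_norm norm_minus_commute)
      also have "\<dots> < e" using M that by simp
      finally show ?thesis .
    qed
    have "dist (sqrt_iter X m) (sqrt_iter X n) < e" if "M \<le> m" "M \<le> n" for m n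
      using **[of m n] **[of n m] that by (cases "m \<le> n") (auto simp: dist_commute)
    then show "\<exists>M. \<forall>m\<ge>M. \<forall>n\<ge>M. dist (sqrt_iter X m) (sqrt_iter X n) < e" by blast
  qed
qed

lemma commuting_sqrt_iter: "commuting X Z \<Longrightarrow> commuting (sqrt_iter X n) Z"
  by (induction n) (simp_all add: commuting_def blinfun.bilinear_simps)

lemma symmetric_sqrt_iter: "symmetric_blinfun X \<Longrightarrow> symmetric_blinfun (sqrt_iter X n)"
proof (induction n)
  case (Suc n)
  have "inner (sqrt_iter X n (sqrt_iter X n x)) y = inner x (sqrt_iter X n (sqrt_iter X n y))" for x y
    using Suc by (simp add: symmetric_blinfunD)
  moreover have "inner (X x) y = inner x (X y)" for x y using Suc.prems by (rule symmetric_blinfunD)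
  ultimately show ?case
    by (auto simp: symmetric_blinfun_def blinfun.bilinear_simps inner_add_left inner_add_right)
qed (simp add: symmetric_blinfun_def blinfun.bilinear_simps)

text \<open>For a symmetric \<open>P\<close> the root is the positive one, because of \<open>\<parallel>1 - S\<parallel> \<le> 1\<close>.\<close>

lemma bounded_sqrt_exists:
  fixes P :: "'a::{real_inner,banach} \<Rightarrow>\<^sub>L 'a"
  assumes P: "norm (id_blinfun - P) \<le> 1"
  obtains S :: "'a \<Rightarrow>\<^sub>L 'a" where "\<And>x. S (S x) = P x" "norm (id_blinfun - S) \<le> 1"
    "\<And>Z. commuting P Z \<Longrightarrow> commuting S Z" "symmetric_blinfun P \<Longrightarrow> symmetric_blinfun S"
proof -
  define X where "X = id_blinfun - P"
  obtain Y where Y: "sqrt_iter X \<longlonglongrightarrow> Y"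
    using Cauchy_convergent[OF Cauchy_sqrt_iter, of X] P unfolding X_def convergent_def by blast
  have "(\<lambda>n. sqrt_iter X (Suc n)) \<longlonglongrightarrow> (1/2) *\<^sub>R (X + (Y o\<^sub>L Y))"
    unfolding sqrt_iter.simps
    by (intro tendsto_intros bounded_bilinear.tendsto[OF bounded_bilinear_blinfun_compose] Y)
  then have YY: "Y = (1/2) *\<^sub>R (X + (Y o\<^sub>L Y))"
    using LIMSEQ_unique Y LIMSEQ_Suc by blast
  \<comment> \<open>The limit of the recursion says \<open>2 Y = X + Y\<^sup>2\<close>, that is
    \<open>(1 - Y)\<^sup>2 = 1 - X = P\<close>.\<close>
  have YYx: "Y x + Y x = X x + Y (Y x)" for x
  proof -
    have "Y x = (1/2) *\<^sub>R (X x + Y (Y x))"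
      using arg_cong[OF YY, of "\<lambda>f. blinfun_apply f x"] by (simp add: blinfun.bilinear_simps)
    then have "2 *\<^sub>R Y x = X x + Y (Y x)"
      by (metis (no_types) divide_self_if scaleR_one scaleR_scaleR times_divide_eq_right mult.right_neutral zero_neq_numeral)
    then show ?thesis by (simp add: scaleR_2)
  qed
  have nY: "norm Y \<le> 1"
  proof (rule LIMSEQ_le_const2)
    show "(\<lambda>n. norm (sqrt_iter X n)) \<longlonglongrightarrow> norm Y" by (intro tendsto_intros Y)
    show "\<exists>N. \<forall>n\<ge>N. norm (sqrt_iter X n) \<le> 1"
      using norm_sqrt_iter[of X] P sqrt_iter_bound_bounds unfolding X_def by (meson order_trans)
  qed
  show ?thesis
  proof (rule that[of "id_blinfun - Y"])
    show "(id_blinfun - Y) ((id_blinfun - Y) x) = P x" for x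
    proof -
      have "(id_blinfun - Y) ((id_blinfun - Y) x) = x - (Y x + Y x) + Y (Y x)"
        by (simp add: blinfun.bilinear_simps)
      also have "\<dots> = P x" unfolding YYx by (simp add: X_def blinfun.bilinear_simps)
      finally show ?thesis .
    qed
    show "norm (id_blinfun - (id_blinfun - Y)) \<le> 1" using nY by simp
    show "commuting (id_blinfun - Y) Z" if "commuting P Z" for Z
    proof -
      have "commuting X Z" using that by (simp add: X_def commuting_def blinfun.bilinear_simps)
      then have "commuting Y Z" by (intro commuting_limit[OF commuting_sqrt_iter Y])
      then show ?thesis by (simp add: commuting_def blinfun.bilinear_simps)
    qed
    show "symmetric_blinfun (id_blinfun - Y)" if "symmetric_blinfun P"
    proof -
      have "symmetric_blinfun X"
        using that by (auto simp: X_def symmetric_blinfun_def blinfun.bilinear_simps inner_diff_left inner_diff_right)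
      then have "symmetric_blinfun Y" by (intro symmetric_limit[OF symmetric_sqrt_iter Y])
      then show ?thesis
        by (auto simp: symmetric_blinfun_def blinfun.bilinear_simps inner_diff_left inner_diff_right)
    qed
  qed
qed

lemma inner_nonneg_of_norm_id_minus:
  assumes "norm (id_blinfun - S) \<le> 1"
  shows "0 \<le> inner x (S x)"
proof -
  have "inner x ((id_blinfun - S) x) \<le> norm x * norm ((id_blinfun - S) x)" by (rule norm_cauchy_schwarz)
  also have "\<dots> \<le> norm x * (norm (id_blinfun - S) * norm x)" by (intro mult_left_mono norm_blinfun) simp
  also have "\<dots> \<le> norm x * norm x" using assms by (simp add: mult_left_le_one_le mult_left_mono)
  finally show ?thesis by (simp add: blinfun.bilinear_simps inner_diff_right power2_norm_eq_inner flip: power2_eq_square)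
qed

text \<open>Polarization: the form at \<open>Z x + x\<close> reduces to
  \<open>2 * inner (Z x) (Z x)\<close>, because the diagonal terms vanish.\<close>

lemma symmetric_zero_of_quadratic_form:
  assumes Z: "symmetric_blinfun Z" and 0: "\<And>x. inner x (Z x) = 0"
  shows "Z x = 0"
proof -
  have "inner (Z x) (Z x) = 0"
    using 0[of "Z x + x"] 0[of x] 0[of "Z x"] symmetric_blinfunD[OF Z, of "Z x" x]
    by (simp add: blinfun.bilinear_simps inner_add_left inner_add_right inner_commute)
  then show ?thesis by simp
qed

text \<open>The squared norm of \<open>X (Y x)\<close> equals
  \<open>inner x (X (X (Y (Y x))))\<close>. This serves to pass from \<open>U\<^sup>2 = 1\<close> on
  the range of \<open>D\<^sup>2\<close> to the same on the range of \<open>D\<close>.\<close>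

lemma symmetric_mult_square_zero:
  assumes X: "symmetric_blinfun X" and Y: "symmetric_blinfun Y" and XY: "commuting X Y"
    and 0: "\<And>x. X (Y (Y x)) = 0"
  shows "X (Y x) = 0"
proof -
  have "inner (X (Y x)) (X (Y x)) = inner x (X (X (Y (Y x))))"
    using symmetric_blinfunD[OF X] symmetric_blinfunD[OF Y] commutingD[OF XY] by metis
  also have "\<dots> = 0" by (simp add: 0 blinfun.zero_right)
  finally show ?thesis by simp
qed

text \<open>With \<open>Z = V - W\<close>, commutation gives \<open>(V + W) Z = 0\<close>.
  Positivity then annihilates both \<open>inner (Z x) (V (Z x))\<close> and
  \<open>inner (Z x) (W (Z x))\<close>, so \<open>Z\<^sup>3\<close> has zero quadratic form, and the
  symmetric \<open>Z\<close> vanishes.\<close>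

lemma positive_sqrt_unique:
  assumes V: "symmetric_blinfun V" "\<And>x. 0 \<le> inner x (V x)"
    and W: "symmetric_blinfun W" "\<And>x. 0 \<le> inner x (W x)"
    and VW: "commuting V W" and eq: "\<And>x. V (V x) = W (W x)"
  shows "V x = W x"
proof -
  define Z where "Z = V - W"
  have Zs: "symmetric_blinfun Z"
    using V(1) W(1) by (auto simp: Z_def symmetric_blinfun_def blinfun.bilinear_simps inner_diff_left inner_diff_right)
  have 1: "V (Z x) + W (Z x) = 0" for x
    using commutingD[OF VW] by (simp add: Z_def blinfun.bilinear_simps eq)
  have 2: "inner (Z x) (Z (Z x)) = 0" for x
  proof -
    have "inner (Z x) (V (Z x)) + inner (Z x) (W (Z x)) = 0"
      using 1[of x] by (simp flip: inner_add_right)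
    then have "inner (Z x) (V (Z x)) = 0" "inner (Z x) (W (Z x)) = 0"
      using V(2)[of "Z x"] W(2)[of "Z x"] by linarith+
    then show ?thesis by (simp add: Z_def blinfun.bilinear_simps inner_diff_right)
  qed
  have "(Z o\<^sub>L (Z o\<^sub>L Z)) x = 0" for x
  proof (rule symmetric_zero_of_quadratic_form)
    show "symmetric_blinfun (Z o\<^sub>L (Z o\<^sub>L Z))"
      using Zs by (simp add: symmetric_blinfun_def)
    show "inner x ((Z o\<^sub>L (Z o\<^sub>L Z)) x) = 0" for x using 2 Zs by (simp add: symmetric_blinfun_def)
  qed
  then have 3: "Z (Z (Z x)) = 0" for x by simp
  have "inner (Z (Z x)) (Z (Z x)) = inner (Z x) (Z (Z (Z x)))" for x using symmetric_blinfunD[OF Zs] by metis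
  then have "Z (Z x) = 0" for x using 3 by simp
  then have "inner (Z x) (Z x) = 0" using symmetric_blinfunD[OF Zs, of x "Z x"] by simp
  then show ?thesis by (simp add: Z_def blinfun.bilinear_simps)
qed

section \<open>Complex structure\<close>

instance chilbert_space \<subseteq> banach ..

lemma scaleC_zero_left [simp]: "0 *\<^sub>C x = (0::'a::chilbert_space)"
  using scaleC_of_real[of 0 x] by simp

lemma scaleC_zero_right [simp]: "a *\<^sub>C (0::'a::chilbert_space) = 0"
  using scaleC_add_right[of a 0 0] by simp

lemma scaleC_minus_right [simp]: "a *\<^sub>C (- x) = - (a *\<^sub>C (x::'a::chilbert_space))"
  using scaleC_add_right[of a x "- x"] by (simp add: eq_neg_iff_add_eq_0 add.commute)

lemma scaleC_minus_left [simp]: "(- a) *\<^sub>C x = - (a *\<^sub>C (x::'a::chilbert_space))"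
  using scaleC_add_left[of a "- a" x] by (simp add: eq_neg_iff_add_eq_0 add.commute)

lemma scaleC_diff_right: "a *\<^sub>C (x - y) = a *\<^sub>C x - a *\<^sub>C (y::'a::chilbert_space)"
  using scaleC_add_right[of a x "- y"] by simp

lemma scaleC_diff_left: "(a - b) *\<^sub>C x = a *\<^sub>C x - b *\<^sub>C (x::'a::chilbert_space)"
  using scaleC_add_left[of a "- b" x] by simp

lemma scaleC_scaleR: "a *\<^sub>C (r *\<^sub>R x) = r *\<^sub>R (a *\<^sub>C (x::'a::chilbert_space))"
  by (simp add: scaleC_of_real[symmetric] scaleC_scaleC mult.commute)

lemma cinner_add_left: "cinner (x + y) z = cinner x z + cinner y z"
  using cinner_commute cinner_add_right by (metis complex_cnj_add)

lemma cinner_scaleC_left: "cinner (a *\<^sub>C x) y = cnj a * cinner x y"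
  using cinner_commute cinner_scaleC_right by (metis complex_cnj_mult)

lemma cinner_zero_left [simp]: "cinner 0 y = 0"
  using cinner_add_left[of 0 0 y] by simp

lemma cinner_zero_right [simp]: "cinner y 0 = 0"
  using cinner_add_right[of y 0 0] by simp

lemma cinner_minus_left [simp]: "cinner (- x) y = - cinner x y"
  using cinner_add_left[of x "- x" y] by (simp add: eq_neg_iff_add_eq_0 add.commute)

lemma cinner_minus_right [simp]: "cinner x (- y) = - cinner x y"
  using cinner_add_right[of x y "- y"] by (simp add: eq_neg_iff_add_eq_0 add.commute)

lemma cinner_diff_left: "cinner (x - y) z = cinner x z - cinner y z"
  using cinner_add_left[of x "- y" z] by simp

lemma cinner_diff_right: "cinner z (x - y) = cinner z x - cinner z y"
  using cinner_add_right[of z x "- y"] by simp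

lemma Im_cinner: "Im (cinner x y) = inner (\<i> *\<^sub>C x) y"
  using cinner_scaleC_left[of \<i> x y] Re_cinner[of "\<i> *\<^sub>C x" y] by simp

lemma cinner_eqI: "inner x y = inner x' y' \<Longrightarrow> inner (\<i> *\<^sub>C x) y = inner (\<i> *\<^sub>C x') y' \<Longrightarrow> cinner x y = cinner x' y'"
  by (rule complex_eqI) (simp_all add: Re_cinner Im_cinner)

lemma cinner_self: "cinner x x = complex_of_real ((norm x)\<^sup>2)"
proof (rule complex_eqI)
  show "Im (cinner x x) = Im (complex_of_real ((norm x)\<^sup>2))"
    using arg_cong[OF cinner_commute[of x x], of Im] by simp
qed (simp add: Re_cinner power2_norm_eq_inner)

lemma norm_scaleC: "norm (a *\<^sub>C x) = cmod a * norm (x::'a::chilbert_space)"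
proof -
  have "complex_of_real ((norm (a *\<^sub>C x))\<^sup>2) = cnj a * (a * complex_of_real ((norm x)\<^sup>2))"
    unfolding cinner_self[symmetric] by (simp add: cinner_scaleC_left cinner_scaleC_right)
  also have "\<dots> = complex_of_real ((cmod a * norm x)\<^sup>2)"
    unfolding power_mult_distrib of_real_mult complex_norm_square[of a] by (simp add: mult_ac)
  finally have "(norm (a *\<^sub>C x))\<^sup>2 = (cmod a * norm x)\<^sup>2" using of_real_eq_iff by blast
  then show ?thesis by simp
qed

lemma norm_cinner_le: "cmod (cinner x y) \<le> norm x * norm y"
proof (cases "cinner x y = 0")
  case False
  \<comment> \<open>The phase that rotates \<open>cinner x y\<close> onto the positive axis, so that
    the real Cauchy-Schwarz inequality applies.\<close>
  define a where "a = cnj (sgn (cinner x y))"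
  have "cmod (cinner x y) = Re (cinner x (a *\<^sub>C y))"
    using False by (simp add: a_def cinner_scaleC_right sgn_eq complex_norm_square[symmetric] field_simps power2_eq_square)
  also have "\<dots> \<le> norm x * norm (a *\<^sub>C y)" unfolding Re_cinner by (rule norm_cauchy_schwarz)
  also have "\<dots> = norm x * norm y" using False by (simp add: norm_scaleC a_def norm_sgn)
  finally show ?thesis .
qed simp

lemma bounded_linear_scaleC: "bounded_linear (\<lambda>x. a *\<^sub>C (x::'a::chilbert_space))"
  by (rule bounded_linear_intro[where K = "cmod a"])
    (simp_all add: scaleC_add_right scaleC_scaleR norm_scaleC mult.commute)

text \<open>Complex linearity is commutation with this operator, so it is inherited by every
  construction that preserves commutation: graph projections, square roots and the partial
  isometry.\<close>

definition imag_blinfun :: "'a::chilbert_space \<Rightarrow>\<^sub>L 'a"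
  where "imag_blinfun = Blinfun (\<lambda>x. \<i> *\<^sub>C x)"

lemma imag_blinfun_apply [simp]: "imag_blinfun x = \<i> *\<^sub>C x"
  unfolding imag_blinfun_def by (simp add: bounded_linear_Blinfun_apply bounded_linear_scaleC)

definition clinear_blinfun :: "('a::chilbert_space \<Rightarrow>\<^sub>L 'b::chilbert_space) \<Rightarrow> bool"
  where "clinear_blinfun A \<longleftrightarrow> (\<forall>a x. A (a *\<^sub>C x) = a *\<^sub>C A x)"

lemma clinear_blinfunD: "clinear_blinfun A \<Longrightarrow> A (a *\<^sub>C x) = a *\<^sub>C A x"
  unfolding clinear_blinfun_def by blast

lemma clinear_blinfun_iff_imag: "clinear_blinfun A \<longleftrightarrow> (\<forall>x. A (\<i> *\<^sub>C x) = \<i> *\<^sub>C A x)"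
proof
  assume *: "\<forall>x. A (\<i> *\<^sub>C x) = \<i> *\<^sub>C A x"
  have dec: "a *\<^sub>C y = Re a *\<^sub>R y + \<i> *\<^sub>C (Im a *\<^sub>R y)" for a and y :: "'c::chilbert_space"
    unfolding scaleC_of_real[symmetric] scaleC_scaleC scaleC_add_left[symmetric]
    by (simp flip: complex_eq)
  show "clinear_blinfun A"
    unfolding clinear_blinfun_def
  proof (intro allI)
    fix a x
    show "A (a *\<^sub>C x) = a *\<^sub>C A x"
      unfolding dec[of a x] dec[of a "A x"] using * by (simp add: blinfun.bilinear_simps)
  qed
qed (simp add: clinear_blinfun_def)

lemma clinear_blinfun_iff_commuting: "clinear_blinfun A \<longleftrightarrow> commuting A imag_blinfun"
  by (simp add: clinear_blinfun_iff_imag commuting_def)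

lemma symmetric_cinner:
  assumes "clinear_blinfun A" "symmetric_blinfun A"
  shows "cinner (A x) y = cinner x (A y)"
proof (rule cinner_eqI)
  show "inner (\<i> *\<^sub>C A x) y = inner (\<i> *\<^sub>C x) (A y)"
    using assms by (metis clinear_blinfunD symmetric_blinfunD)
qed (use assms(2) symmetric_blinfunD in blast)

section \<open>Self-adjoint graphs\<close>

text \<open>For a complex linear graph, the real inner product \<^const>\<open>inner\<close> defines the same adjoint as
  \<^const>\<open>cinner\<close>.\<close>

definition real_self_adjoint :: "('a::real_inner \<times> 'a) set \<Rightarrow> bool"
  where "real_self_adjoint H \<longleftrightarrow> (\<forall>k h. (k, h) \<in> H \<longleftrightarrow> (\<forall>f g. (f, g) \<in> H \<longrightarrow> inner g k = inner f h))"

lemma adjoint_op_real: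
  assumes "linear_operator A"
  shows "(k, h) \<in> adjoint_op A \<longleftrightarrow> (\<forall>f g. (f, g) \<in> A \<longrightarrow> inner g k = inner f h)"
proof
  assume "(k, h) \<in> adjoint_op A"
  then show "\<forall>f g. (f, g) \<in> A \<longrightarrow> inner g k = inner f h"
    unfolding adjoint_op_def by (auto simp flip: Re_cinner)
next
  assume *: "\<forall>f g. (f, g) \<in> A \<longrightarrow> inner g k = inner f h"
  have "cinner g k = cinner f h" if "(f, g) \<in> A" for f g
  proof (rule cinner_eqI)
    have "(\<i> *\<^sub>C f, \<i> *\<^sub>C g) \<in> A" using that assms unfolding linear_operator_def by blast
    then show "inner (\<i> *\<^sub>C g) k = inner (\<i> *\<^sub>C f) h" using * by blast
  qed (use * that in blast)
  then show "(k, h) \<in> adjoint_op A" unfolding adjoint_op_def by blast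
qed

lemma self_adjoint_iff:
  "self_adjoint A \<longleftrightarrow> linear_operator A \<and> closure (Domain A) = UNIV \<and> real_self_adjoint A"
proof -
  have "adjoint_op A = A \<longleftrightarrow> real_self_adjoint A" if "linear_operator A"
    unfolding real_self_adjoint_def set_eq_iff split_paired_All adjoint_op_real[OF that] by (simp add: eq_commute)
  then show ?thesis unfolding self_adjoint_def densely_defined_def by blast
qed

lemma real_self_adjointI:
  assumes "\<And>k h f g. (k, h) \<in> H \<Longrightarrow> (f, g) \<in> H \<Longrightarrow> inner g k = inner f h"
    and "\<And>k h. (\<And>f g. (f, g) \<in> H \<Longrightarrow> inner g k = inner f h) \<Longrightarrow> (k, h) \<in> H"
  shows "real_self_adjoint H"
  using assms unfolding real_self_adjoint_def by blast

lemma real_self_adjoint_symmetric: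
  "real_self_adjoint H \<Longrightarrow> (k, h) \<in> H \<Longrightarrow> (f, g) \<in> H \<Longrightarrow> inner g k = inner f h"
  unfolding real_self_adjoint_def by blast

lemma real_self_adjoint_mem:
  "real_self_adjoint H \<Longrightarrow> (\<And>f g. (f, g) \<in> H \<Longrightarrow> inner g k = inner f h) \<Longrightarrow> (k, h) \<in> H"
  unfolding real_self_adjoint_def by blast

lemma real_self_adjoint_subspace:
  assumes "real_self_adjoint H"
  shows "subspace H"
  unfolding subspace_def
proof (intro conjI ballI allI)
  show "0 \<in> H" unfolding zero_prod_def by (rule real_self_adjoint_mem[OF assms]) simp
  show "x + y \<in> H" if "x \<in> H" "y \<in> H" for x y
  proof (cases x; cases y)
    fix a b c d assume xy: "x = (a, b)" "y = (c, d)"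
    have "(a + c, b + d) \<in> H"
    proof (rule real_self_adjoint_mem[OF assms])
      fix f g assume "(f, g) \<in> H"
      then show "inner g (a + c) = inner f (b + d)"
        using real_self_adjoint_symmetric[OF assms] that unfolding xy by (metis inner_add_right)
    qed
    then show ?thesis by (simp add: xy)
  qed
  show "r *\<^sub>R x \<in> H" if "x \<in> H" for r x
  proof (cases x)
    fix a b assume x: "x = (a, b)"
    have "(r *\<^sub>R a, r *\<^sub>R b) \<in> H"
    proof (rule real_self_adjoint_mem[OF assms])
      fix f g assume "(f, g) \<in> H"
      then show "inner g (r *\<^sub>R a) = inner f (r *\<^sub>R b)"
        using real_self_adjoint_symmetric[OF assms] that unfolding x by (metis inner_scaleR_right)
    qed
    then show ?thesis by (simp add: x)
  qed
qed

lemma real_self_adjoint_closed: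
  assumes "real_self_adjoint H"
  shows "closed H"
proof -
  have "H = (\<Inter>p\<in>H. {q. inner (snd p) (fst q) = inner (fst p) (snd q)})"
  proof (rule set_eqI)
    fix q show "q \<in> H \<longleftrightarrow> q \<in> (\<Inter>p\<in>H. {q. inner (snd p) (fst q) = inner (fst p) (snd q)})"
      using assms[unfolded real_self_adjoint_def, rule_format, of "fst q" "snd q"] by auto
  qed
  moreover have "closed \<dots>"
    by (intro closed_INT ballI closed_Collect_eq continuous_intros)
  ultimately show ?thesis by simp
qed

lemma real_self_adjoint_single_valued:
  assumes "real_self_adjoint H" "closure (Domain H) = UNIV" "(0, x) \<in> H"
  shows "x = 0"
proof (rule inner_eq_zero_dense[OF assms(2)])
  fix s assume "s \<in> Domain H"
  then obtain t where "(s, t) \<in> H" by blast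
  then show "inner x s = 0"
    using real_self_adjoint_symmetric[OF assms(1) assms(3)] by (metis inner_commute inner_zero_right)
qed

text \<open>With \<open>R = (1 + H\<^sup>2)\<^sup>-\<^sup>1\<close> and \<open>W = H R\<close>, the orthogonal projection onto the graph of \<open>H\<close> is the
  block matrix with rows \<open>(R, W)\<close> and \<open>(W, 1 - R)\<close>.\<close>

lemma graph_projection:
  fixes H :: "('a::{real_inner,banach} \<times> 'a) set"
  assumes H: "real_self_adjoint H" and dense: "closure (Domain H) = UNIV"
  obtains R W :: "'a \<Rightarrow>\<^sub>L 'a" where
    "symmetric_blinfun R" "symmetric_blinfun W" "norm R \<le> 1" "norm (id_blinfun - R) \<le> 1"
    "\<And>x. (R x, W x) \<in> H" "\<And>x. (W x, x - R x) \<in> H"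
    "\<And>f g x. (f, g) \<in> H \<Longrightarrow> (g, x - f) \<in> H \<Longrightarrow> f = R x \<and> g = W x"
    "\<And>f h. (f, h) \<in> H \<longleftrightarrow> W f = R h" "\<And>x. R x = 0 \<Longrightarrow> x = 0"
    "commuting R W" "\<And>x. W (W x) = R (x - R x)"
    "\<And>Z :: 'a \<Rightarrow>\<^sub>L 'a. (\<And>f h. (f, h) \<in> H \<Longrightarrow> (blinfun_apply Z f, blinfun_apply Z h) \<in> H) \<Longrightarrow> commuting R Z \<and> commuting W Z"
proof -
  note sub = real_self_adjoint_subspace[OF H]
  have add: "(a + c, b + d) \<in> H" if "(a, b) \<in> H" "(c, d) \<in> H" for a b c d
    using subspace_add[OF sub that] by simp
  have diff: "(a - c, b - d) \<in> H" if "(a, b) \<in> H" "(c, d) \<in> H" for a b c d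
    using subspace_diff[OF sub that] by simp
  have scale: "(r *\<^sub>R a, r *\<^sub>R b) \<in> H" if "(a, b) \<in> H" for a b r
    using subspace_scale[OF sub that, of r] by simp
  note sym = real_self_adjoint_symmetric[OF H]
  have sv: "b = d" if "(a, b) \<in> H" "(a, d) \<in> H" for a b d
    using real_self_adjoint_single_valued[OF H dense] diff[OF that] by force
  \<comment> \<open>The residual of projecting \<open>(x, 0)\<close> onto \<open>H\<close> is
    orthogonal to \<open>H\<close>, which says that \<open>(snd p, x - fst p)\<close> lies in the
    adjoint, that is in \<open>H\<close> itself.\<close>
  have "\<exists>p. p \<in> H \<and> (snd p, x - fst p) \<in> H" for x
  proof -
    obtain p where p: "p \<in> H" "\<And>s. s \<in> H \<Longrightarrow> inner ((x, 0) - p) s = 0"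
      using closed_subspace_orthogonal_projection[OF sub real_self_adjoint_closed[OF H], of "(x, 0)"] by blast
    have "(snd p, x - fst p) \<in> H"
    proof (rule real_self_adjoint_mem[OF H])
      fix f g assume "(f, g) \<in> H"
      from p(2)[OF this] show "inner g (snd p) = inner f (x - fst p)"
        by (simp add: inner_prod_def inner_commute)
    qed
    with p(1) show ?thesis by blast
  qed
  then obtain p where p: "\<And>x. p x \<in> H" "\<And>x. (snd (p x), x - fst (p x)) \<in> H" by metis
  define r w where "r = fst \<circ> p" and "w = snd \<circ> p"
  have rw: "(r x, w x) \<in> H" "(w x, x - r x) \<in> H" for x using p[of x] by (auto simp: r_def w_def)
  have uniq: "f = r x \<and> g = w x" if "(f, g) \<in> H" "(g, x - f) \<in> H" for f g x
  proof -
    have "(f - r x, g - w x) \<in> H" "(g - w x, - (f - r x)) \<in> H"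
      using diff[OF that(1) rw(1)[of x]] diff[OF that(2) rw(2)[of x]] by simp_all
    from sym[OF this(2,1)] have "inner (g - w x) (g - w x) + inner (f - r x) (f - r x) = 0"
      by (simp add: algebra_simps inner_diff_left inner_diff_right)
    then show ?thesis
      by (metis add_nonneg_eq_0_iff eq_iff_diff_eq_0 inner_eq_zero_iff inner_ge_zero)
  qed
  \<comment> \<open>Symmetry of \<open>H\<close> on the two pairs gives
    \<open>inner (r x) (x - r x) = (norm (w x))\<^sup>2\<close>, so the cross terms are
    nonnegative.\<close>
  have nrm: "(norm x)\<^sup>2 = (norm (r x))\<^sup>2 + 2 * (norm (w x))\<^sup>2 + (norm (x - r x))\<^sup>2" for x
    using sym[OF rw(2)[of x] rw(1)[of x]] unfolding power2_norm_eq_inner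
    by (simp add: inner_diff_left inner_diff_right inner_commute)
  have le: "norm (r x) \<le> norm x" "norm (w x) \<le> norm x" "norm (x - r x) \<le> norm x" for x
    by (rule power2_le_imp_le; use nrm[of x] in simp)+
  have radd: "r (x + y) = r x + r y \<and> w (x + y) = w x + w y" for x y
    using uniq[OF add[OF rw(1)[of x] rw(1)[of y]], of "x + y"] add[OF rw(2)[of x] rw(2)[of y]]
    by (simp add: algebra_simps)
  have rscale: "r (a *\<^sub>R x) = a *\<^sub>R r x \<and> w (a *\<^sub>R x) = a *\<^sub>R w x" for a x
    using uniq[OF scale[OF rw(1)[of x]], of a "a *\<^sub>R x"] scale[OF rw(2)[of x], of a]
    by (simp add: scaleR_right_diff_distrib)
  have bl: "bounded_linear r" "bounded_linear w"
    by (rule bounded_linear_intro[where K = 1]; use radd rscale le in simp)+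
  define R W where "R = Blinfun r" and "W = Blinfun w"
  have RW: "blinfun_apply R = r" "blinfun_apply W = w"
    using bl by (simp_all add: R_def W_def bounded_linear_Blinfun_apply)
  have Wsym: "symmetric_blinfun W"
    unfolding symmetric_blinfun_def RW
  proof (intro allI)
    fix x y
    have "inner (w x) y = inner (w x) (r y) + inner (w x) (y - r y)" by (simp add: inner_diff_right)
    also have "\<dots> = inner (r x) (w y) + inner (x - r x) (w y)"
      using sym[OF rw(1)[of y] rw(1)[of x]] sym[OF rw(2)[of x] rw(2)[of y]] by (simp add: inner_commute)
    also have "\<dots> = inner x (w y)" by (simp add: inner_diff_left)
    finally show "inner (w x) y = inner x (w y)" .
  qed
  have Rsym: "symmetric_blinfun R"
    unfolding symmetric_blinfun_def RW
  proof (intro allI)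
    have *: "inner (r x) y = inner (r x) (r y) + inner (w x) (w y)" for x y
      using sym[OF rw(2)[of y] rw(1)[of x]] by (simp add: inner_diff_right)
    show "inner (r x) y = inner x (r y)" for x y
      using *[of x y] *[of y x] by (simp add: inner_commute)
  qed
  have fwd: "w f = r h" if "(f, h) \<in> H" for f h
  proof -
    have "inner y (w f) = inner y (r h)" for y
      using sym[OF that rw(1)[of y]] Wsym Rsym unfolding symmetric_blinfun_def RW by (metis inner_commute)
    then show ?thesis by (metis vector_eq_ldot)
  qed
  have bwd: "(f, h) \<in> H" if "w f = r h" for f h
  proof -
    have "f - r f = w h" using sv[OF rw(2)[of f]] rw(1)[of h] that by simp
    then show ?thesis using add[OF rw(1)[of f] rw(2)[of h]] that by (simp add: algebra_simps)
  qed
  show ?thesis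
  proof (rule that[of R W, unfolded RW])
    show "norm R \<le> 1" by (rule norm_blinfun_bound) (use le in \<open>simp_all add: RW\<close>)
    show "norm (id_blinfun - R) \<le> 1"
      by (rule norm_blinfun_bound) (use le in \<open>simp_all add: RW blinfun.bilinear_simps\<close>)
    show "(f, h) \<in> H \<longleftrightarrow> w f = r h" for f h using fwd bwd by blast
    show "x = 0" if "r x = 0" for x
    proof -
      have "w x = 0" using sv[OF rw(1)[of x], of 0] subspace_0[OF sub] that by (simp add: zero_prod_def)
      then show ?thesis using sv[OF rw(2)[of x], of 0] subspace_0[OF sub] that by (simp add: zero_prod_def)
    qed
    show "commuting R W" unfolding commuting_def RW using fwd[OF rw(1)] by simp
    show "w (w x) = r (x - r x)" for x by (rule fwd[OF rw(2)])
    show "commuting R Z \<and> commuting W Z" if Z: "\<And>f h. (f, h) \<in> H \<Longrightarrow> (blinfun_apply Z f, blinfun_apply Z h) \<in> H" for Z :: "'a \<Rightarrow>\<^sub>L 'a"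
    proof -
      \<comment> \<open>An operator that preserves \<open>H\<close> maps the two pairs of
        \<open>x\<close> to pairs with the characterizing property for \<open>Z x\<close>.\<close>
      have "Z (r x) = r (Z x) \<and> Z (w x) = w (Z x)" for x
        by (rule uniq) (use Z[OF rw(1)[of x]] Z[OF rw(2)[of x]] in \<open>simp_all add: blinfun.diff_right\<close>)
      then show ?thesis unfolding commuting_def RW by simp
    qed
  qed (use Rsym Wsym rw uniq in auto)
qed

section \<open>Square roots and absolute values of self-adjoint graphs\<close>

text \<open>\<open>C\<close> and \<open>D\<close> are the positive roots of \<open>R\<close> and
  \<open>1 - R\<close>. They are used as the numerator and denominator of an unbounded operator:
  \<open>R = (1 + H\<^sup>2)\<^sup>-\<^sup>1\<close> leads to
  \<open>|H| = D C\<^sup>-\<^sup>1\<close>.\<close>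

lemma mult_sqrt_exists:
  fixes R :: "'a::{real_inner,banach} \<Rightarrow>\<^sub>L 'a"
  assumes R: "symmetric_blinfun R" "norm R \<le> 1" "norm (id_blinfun - R) \<le> 1"
  obtains C D :: "'a \<Rightarrow>\<^sub>L 'a" where
    "symmetric_blinfun C" "symmetric_blinfun D" "commuting C D"
    "\<And>x. C (C x) = R x" "\<And>x. C (C x) + D (D x) = x" "\<And>x. 0 \<le> inner (C x) (D x)"
    "\<And>Z. commuting R Z \<Longrightarrow> commuting C Z \<and> commuting D Z" "\<And>x. 0 \<le> inner x (C x)"
proof -
  obtain C :: "'a \<Rightarrow>\<^sub>L 'a" where C: "\<And>x. C (C x) = R x" "norm (id_blinfun - C) \<le> 1"
      "\<And>Z. commuting R Z \<Longrightarrow> commuting C Z" "symmetric_blinfun C"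
    using bounded_sqrt_exists[of R] R by (smt (verit, best))
  obtain D :: "'a \<Rightarrow>\<^sub>L 'a" where D: "\<And>x. D (D x) = (id_blinfun - R) x" "norm (id_blinfun - D) \<le> 1"
      "\<And>Z. commuting (id_blinfun - R) Z \<Longrightarrow> commuting D Z"
      "symmetric_blinfun (id_blinfun - R) \<Longrightarrow> symmetric_blinfun D"
    using bounded_sqrt_exists[of "id_blinfun - R"] R(2) by (smt (verit, best) diff_diff_eq2 add_diff_cancel_left')
  \<comment> \<open>A further root of \<open>C\<close>: it turns \<open>inner (C x) (D x)\<close>
    into \<open>inner (Q x) (D (Q x))\<close>, which is nonnegative.\<close>
  obtain Q :: "'a \<Rightarrow>\<^sub>L 'a" where Q: "\<And>x. Q (Q x) = C x" "\<And>Z. commuting C Z \<Longrightarrow> commuting Q Z" "symmetric_blinfun Q"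
    using bounded_sqrt_exists[of C] C by (smt (verit, best))
  have Ds: "symmetric_blinfun D"
    by (rule D(4)) (use R(1) in \<open>simp add: symmetric_blinfun_def blinfun.bilinear_simps inner_diff_left inner_diff_right\<close>)
  have DZ: "commuting D Z" if "commuting R Z" for Z
    by (rule D(3)) (use that in \<open>simp add: commuting_def blinfun.bilinear_simps\<close>)
  have RD: "commuting R D" by (rule commuting_sym, rule DZ) (simp add: commuting_def)
  then have CD: "commuting C D" by (rule C(3))
  then have QD: "commuting Q D" by (rule Q(2))
  show ?thesis
  proof (rule that[OF C(4) Ds CD C(1)])
    show "C (C x) + D (D x) = x" for x by (simp add: C(1) D(1) blinfun.bilinear_simps)
    show "0 \<le> inner (C x) (D x)" for x
    proof -
      have "inner (C x) (D x) = inner (Q x) (D (Q x))"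
        unfolding Q(1)[symmetric] using symmetric_blinfunD[OF Q(3)] commutingD[OF QD] by metis
      then show ?thesis using inner_nonneg_of_norm_id_minus[OF D(2)] by simp
    qed
    show "0 \<le> inner x (C x)" for x by (rule inner_nonneg_of_norm_id_minus[OF C(2)])
    show "commuting C Z \<and> commuting D Z" if "commuting R Z" for Z using C(3) DZ that by blast
  qed
qed

text \<open>The block \<open>R\<close> depends only on the square of the operator, so
  \<open>R = R'\<close>. Both \<open>W\<close> and \<open>W'\<close> are then positive roots of
  \<open>R (1 - R)\<close>. They are not known to commute with each other, so each is compared with
  the root \<open>V = C D\<close>, which commutes with everything that commutes with
  \<open>R\<close>.\<close>

lemma real_self_adjoint_sqrt_unique:
  fixes M N :: "('a::{real_inner,banach} \<times> 'a) set"
  assumes M: "real_self_adjoint M" "closure (Domain M) = UNIV" "\<And>f g. (f, g) \<in> M \<Longrightarrow> 0 \<le> inner f g"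
    and N: "real_self_adjoint N" "closure (Domain N) = UNIV" "\<And>f g. (f, g) \<in> N \<Longrightarrow> 0 \<le> inner f g"
    and MN: "M O M = N O N"
  shows "M = N"
proof -
  obtain R W where R: "symmetric_blinfun R" "norm R \<le> 1" "norm (id_blinfun - R) \<le> 1"
    and W: "symmetric_blinfun W" "commuting R W" "\<And>x. W (W x) = R (x - R x)"
    and RW: "\<And>x. (R x, W x) \<in> M" "\<And>x. (W x, x - R x) \<in> M"
    and mem: "\<And>f h. (f, h) \<in> M \<longleftrightarrow> W f = R h"
    using graph_projection[OF M(1,2)] by (smt (verit, best))
  obtain R' W' where W': "symmetric_blinfun W'" "commuting R' W'" "\<And>x. W' (W' x) = R' (x - R' x)"
    and RW': "\<And>x. (R' x, W' x) \<in> N" "\<And>x. (W' x, x - R' x) \<in> N"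
    and uniq': "\<And>f g x. (f, g) \<in> N \<Longrightarrow> (g, x - f) \<in> N \<Longrightarrow> f = R' x \<and> g = W' x"
    and mem': "\<And>f h. (f, h) \<in> N \<longleftrightarrow> W' f = R' h"
    using graph_projection[OF N(1,2)] by (smt (verit, best))
  have RR: "R' x = R x" for x
  proof -
    have "(R x, x - R x) \<in> N O N" using RW MN by blast
    then obtain g where "(R x, g) \<in> N" "(g, x - R x) \<in> N" by blast
    then show ?thesis using uniq' by metis
  qed
  have pos: "0 \<le> inner x (W x)" for x
  proof -
    have "inner x (W x) = inner (R x) (W x) + inner (W x) (x - R x)"
      by (simp add: inner_diff_right inner_diff_left inner_commute)
    then show ?thesis using M(3)[OF RW(1)[of x]] M(3)[OF RW(2)[of x]] by linarith
  qed
  have pos': "0 \<le> inner x (W' x)" for x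
  proof -
    have "inner x (W' x) = inner (R' x) (W' x) + inner (W' x) (x - R' x)"
      by (simp add: inner_diff_right inner_diff_left inner_commute)
    then show ?thesis using N(3)[OF RW'(1)[of x]] N(3)[OF RW'(2)[of x]] by linarith
  qed
  obtain C D where CD: "symmetric_blinfun C" "symmetric_blinfun D" "commuting C D"
    "\<And>x. C (C x) = R x" "\<And>x. C (C x) + D (D x) = x" "\<And>x. 0 \<le> inner (C x) (D x)"
    "\<And>Z. commuting R Z \<Longrightarrow> commuting C Z \<and> commuting D Z" "\<And>x. 0 \<le> inner x (C x)"
    using mult_sqrt_exists[OF R] by blast
  define V where "V = C o\<^sub>L D"
  have Vs: "symmetric_blinfun V"
    using CD(1-3) unfolding symmetric_blinfun_def commuting_def V_def by simp
  have Vp: "0 \<le> inner x (V x)" for x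
    using CD(6)[of x] symmetric_blinfunD[OF CD(1), of x "D x"] by (simp add: V_def)
  have VV: "V (V x) = R (x - R x)" for x
  proof -
    have "V (V x) = C (C (D (D x)))" using commutingD[OF CD(3)] by (simp add: V_def)
    also have "D (D x) = x - R x" using CD(4)[of x] CD(5)[of x] by (simp add: algebra_simps)
    finally show ?thesis by (simp add: CD(4))
  qed
  have VW: "commuting V W" "commuting V W'"
    using CD(7)[OF W(2)] CD(7)[of W'] W'(2) unfolding V_def commuting_def by (simp_all add: RR)
  have "V x = W x" for x
    by (rule positive_sqrt_unique[OF Vs Vp W(1) pos VW(1)]) (simp only: VV W(3))
  moreover have "V x = W' x" for x
    by (rule positive_sqrt_unique[OF Vs Vp W'(1) pos' VW(2)]) (simp only: VV W'(3) RR)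
  ultimately have WW: "W x = W' x" for x by metis
  show ?thesis
    by (rule set_eqI) (metis mem mem' RR WW surj_pair)
qed

lemma nonneg_op_real: "nonneg_op A \<Longrightarrow> (f, g) \<in> A \<Longrightarrow> 0 \<le> inner f g"
  unfolding nonneg_op_def by (metis (mono_tags, lifting) Re_cinner case_prodD nonneg_Reals_cmod_eq_Re norm_ge_zero)

lemma sqrt_op_eq:
  assumes "self_adjoint B" "nonneg_op B" "B O B = A"
  shows "sqrt_op A = B"
  unfolding sqrt_op_def
proof (rule the_equality)
  fix B' assume B': "self_adjoint B' \<and> nonneg_op B' \<and> B' O B' = A"
  show "B' = B"
    by (rule real_self_adjoint_sqrt_unique)
      (use assms B' nonneg_op_real in \<open>auto simp: self_adjoint_iff\<close>)
qed (use assms in blast)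

section \<open>Unbounded operators as quotients of bounded ones\<close>

lemma symmetric_injective_dense_range:
  fixes C :: "'a::{real_inner,banach} \<Rightarrow>\<^sub>L 'a"
  assumes "symmetric_blinfun C" "\<And>x. C x = 0 \<Longrightarrow> x = 0"
  shows "closure (range C) = UNIV"
proof (rule subspace_orthogonal_zero_dense)
  show "subspace (range C)"
    by (intro linear_subspace_image subspace_UNIV bounded_linear.linear blinfun.bounded_linear_right)
  fix y assume *: "\<And>s. s \<in> range C \<Longrightarrow> inner y s = 0"
  have "inner (C y) (C y) = 0" using *[of "C (C y)"] symmetric_blinfunD[OF assms(1), of y "C y"] by simp
  then show "y = 0" using assms(2) by simp
qed

definition op_pair :: "('a::real_normed_vector \<Rightarrow>\<^sub>L 'b::real_normed_vector) \<Rightarrow> ('a \<Rightarrow>\<^sub>L 'c::real_normed_vector) \<Rightarrow> ('b \<times> 'c) set"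
  where "op_pair C D = range (\<lambda>x. (C x, D x))"

lemma linear_operator_op_pair:
  assumes "clinear_blinfun C" "clinear_blinfun D" and inj: "\<And>x. C x = 0 \<Longrightarrow> x = 0"
  shows "linear_operator (op_pair C D)"
  unfolding linear_operator_def
proof (intro conjI allI impI)
  show "single_valued (op_pair C D)"
  proof (rule single_valuedI)
    fix x y z assume "(x, y) \<in> op_pair C D" "(x, z) \<in> op_pair C D"
    then obtain a b where ab: "x = C a" "y = D a" "x = C b" "z = D b" unfolding op_pair_def by blast
    then have "C (a - b) = 0" by (simp add: blinfun.bilinear_simps)
    then show "y = z" using inj ab by force
  qed
  show "(0, 0) \<in> op_pair C D" unfolding op_pair_def by (auto intro!: image_eqI[of _ _ 0] simp: blinfun.zero_right)
  show "(x + x', y + y') \<in> op_pair C D" if "(x, y) \<in> op_pair C D" "(x', y') \<in> op_pair C D" for x y x' y'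
    using that unfolding op_pair_def by (force simp flip: blinfun.add_right)
  show "(a *\<^sub>C x, a *\<^sub>C y) \<in> op_pair C D" if "(x, y) \<in> op_pair C D" for a x y
    using that unfolding op_pair_def
    by (auto simp flip: clinear_blinfunD[OF assms(1)] clinear_blinfunD[OF assms(2)])
qed

text \<open>A pair with \<open>C\<^sup>2 + D\<^sup>2 = 1\<close> parametrizes the graph of \<open>D C\<^sup>-\<^sup>1\<close> isometrically.\<close>

lemma op_pair_mem_iff:
  assumes "commuting C D" and "\<And>x. C (C x) + D (D x) = x"
  shows "(f, g) \<in> op_pair C D \<longleftrightarrow> D f = C g"
proof
  assume "(f, g) \<in> op_pair C D"
  then show "D f = C g" using assms(1) unfolding op_pair_def commuting_def by auto
next
  assume eq: "D f = C g"
  have "C (D g) = D (D f)" "D (C f) = C (C g)" using commutingD[OF assms(1), of f] commutingD[OF assms(1), of g] eq by simp_all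
  then have "C (C f + D g) = f" "D (C f + D g) = g"
    using assms(2)[of f] assms(2)[of g] by (simp_all add: blinfun.add_right)
  then show "(f, g) \<in> op_pair C D"
    \<comment> \<open>The witness is the adjoint of the isometry
      \<open>x \<mapsto> (C x, D x)\<close> applied to \<open>(f, g)\<close>.\<close>
    unfolding op_pair_def by (intro image_eqI[of _ _ "C f + D g"]) auto
qed

text \<open>\<open>mem\<close> supplies maximality: a pair in the adjoint satisfies
  \<open>D k = C h\<close>, as testing against all \<open>(C x, D x)\<close> shows.\<close>

lemma self_adjoint_op_pairI:
  fixes C D :: "'a::chilbert_space \<Rightarrow>\<^sub>L 'a"
  assumes C: "clinear_blinfun C" "symmetric_blinfun C" "\<And>x. C x = 0 \<Longrightarrow> x = 0"
    and D: "clinear_blinfun D" "symmetric_blinfun D" and CD: "commuting C D"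
    and mem: "\<And>f g. D f = C g \<Longrightarrow> (f, g) \<in> op_pair C D"
  shows "self_adjoint (op_pair C D)"
  unfolding self_adjoint_iff
proof (intro conjI)
  show "linear_operator (op_pair C D)" by (rule linear_operator_op_pair[OF C(1) D(1) C(3)])
  have "Domain (op_pair C D) = range C" unfolding op_pair_def by auto
  then show "closure (Domain (op_pair C D)) = UNIV" using symmetric_injective_dense_range[OF C(2,3)] by simp
  show "real_self_adjoint (op_pair C D)"
  proof (rule real_self_adjointI)
    fix k h f g assume "(k, h) \<in> op_pair C D" "(f, g) \<in> op_pair C D"
    then obtain a b where "k = C a" "h = D a" "f = C b" "g = D b" unfolding op_pair_def by blast
    then show "inner g k = inner f h"
      using C(2) D(2) CD unfolding symmetric_blinfun_def commuting_def by metis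
  next
    fix k h assume *: "\<And>f g. (f, g) \<in> op_pair C D \<Longrightarrow> inner g k = inner f h"
    have "inner x (D k) = inner x (C h)" for x
      using *[of "C x" "D x"] C(2) D(2) unfolding symmetric_blinfun_def op_pair_def by auto
    then show "(k, h) \<in> op_pair C D" using mem by (metis vector_eq_ldot)
  qed
qed

lemma nonneg_op_pair:
  fixes C D :: "'a::chilbert_space \<Rightarrow>\<^sub>L 'a"
  assumes C: "clinear_blinfun C" "symmetric_blinfun C" and D: "clinear_blinfun D" "symmetric_blinfun D"
    and CD: "commuting C D" and pos: "\<And>x. 0 \<le> inner (C x) (D x)"
  shows "nonneg_op (op_pair C D)"
proof -
  have "cinner (C x) (D x) \<in> \<real>\<^sub>\<ge>\<^sub>0" for x
  proof -
    have "cinner (C x) (D x) = cinner (D x) (C x)"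
      using symmetric_cinner[OF C] symmetric_cinner[OF D] CD unfolding commuting_def by metis
    then have "cinner (C x) (D x) = cnj (cinner (C x) (D x))" using cinner_commute by metis
    then have "Im (cinner (C x) (D x)) = 0" by (metis cancel_comm_monoid_add_class.diff_cancel complex_cnj_cancel_iff cnj.sel(2) neg_equal_zero)
    then show ?thesis using pos[of x] by (simp add: complex_nonneg_Reals_iff Re_cinner)
  qed
  then show ?thesis unfolding nonneg_op_def op_pair_def by auto
qed

text \<open>With \<open>N = D C\<^sup>-\<^sup>1\<close> this is
  \<open>C\<^sup>2 = (1 + N\<^sup>2)\<^sup>-\<^sup>1\<close>, so an identity for the unbounded
  \<open>N\<^sup>2\<close>, domain included, can be checked through the bounded
  \<open>C\<^sup>2\<close>.\<close>

lemma op_pair_square_iff: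
  assumes "commuting C D" and CD: "\<And>x. C (C x) + D (D x) = x"
  shows "(f, g) \<in> op_pair C D O op_pair C D \<longleftrightarrow> f = C (C (f + g))"
proof
  assume "(f, g) \<in> op_pair C D O op_pair C D"
  then obtain h where h: "D f = C h" "D h = C g" using op_pair_mem_iff[OF assms] by blast
  have "C (C (f + g)) = C (C f) + C (D h)" by (simp add: blinfun.add_right h)
  also have "C (D h) = D (D f)" using assms(1) h unfolding commuting_def by metis
  finally show "f = C (C (f + g))" using CD by simp
next
  assume *: "f = C (C (f + g))"
  define x where "x = f + g"
  have "g = D (D x)" using CD[of x] * unfolding x_def by (metis add_left_cancel)
  moreover have "f = C (C x)" using * unfolding x_def .
  ultimately show "(f, g) \<in> op_pair C D O op_pair C D"
    using assms(1) unfolding op_pair_def commuting_def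
    by (intro relcompI[of _ "D (C x)"]) (auto intro: rev_image_eqI[of "C x"] rev_image_eqI[of "D x"])
qed

section \<open>The form representation of a self-adjoint operator\<close>

text \<open>\<open>V\<^sup>2 = W\<^sup>2\<close> gives \<open>norm (V a) = norm (W a)\<close>, so
  \<open>V a \<mapsto> W a\<close> extends to an isometry on the closure of the range of
  \<open>V\<close>. With \<open>V = |H| (1 + H\<^sup>2)\<^sup>-\<^sup>1\<close> and
  \<open>W = H (1 + H\<^sup>2)\<^sup>-\<^sup>1\<close> the result is the sign of
  \<open>H\<close>.\<close>

lemma partial_isometry_exists:
  fixes V W :: "'a::{real_inner,banach} \<Rightarrow>\<^sub>L 'a"
  assumes V: "symmetric_blinfun V" and W: "symmetric_blinfun W"
    and VW: "commuting V W" and sq: "\<And>x. V (V x) = W (W x)"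
  obtains U :: "'a \<Rightarrow>\<^sub>L 'a" where "symmetric_blinfun U"
    "\<And>x. U (V x) = W x" "\<And>x. V x = 0 \<Longrightarrow> U x = 0"
    "\<And>x. (\<And>y. V y = 0 \<Longrightarrow> inner y x = 0) \<Longrightarrow> norm (U x) = norm x"
    "\<And>Z. commuting V Z \<Longrightarrow> commuting W Z \<Longrightarrow> commuting U Z"
    "\<And>x. \<exists>v n. x = v + n \<and> v \<in> closure (range V) \<and> V n = 0"
proof -
  define L where "L = closure (range (\<lambda>a. (V a, W a)))"
  have lin: "linear (\<lambda>a. (V a, W a))"
    by (rule linearI) (simp_all add: blinfun.bilinear_simps)
  have L: "subspace L" "closed L"
    unfolding L_def by (intro subspace_closure linear_subspace_image lin subspace_UNIV closed_closure)+
  have VaWa: "(V a, W a) \<in> L" for a unfolding L_def by (rule closure_subset[THEN subsetD]) simp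
  have inn: "inner (V a) (V b) = inner (W a) (W b)" for a b
    using symmetric_blinfunD[OF V, of a "V b"] symmetric_blinfunD[OF W, of a "W b"] sq by simp
  have clos: "P p" if "p \<in> L" "closed {p. P p}" "\<And>a. P (V a, W a)" for P p
    using that closure_minimal[of "range (\<lambda>a. (V a, W a))" "{p. P p}"] unfolding L_def by blast
  have Linn: "inner (fst p) (V b) = inner (snd p) (W b)" if "p \<in> L" for p b
    by (rule clos[OF that]) (auto intro!: closed_Collect_eq continuous_intros simp: inn)
  have Lnorm: "norm (fst p) = norm (snd p)" if "p \<in> L" for p
  proof (rule clos[OF that])
    show "closed {p. norm (fst p :: 'a) = norm (snd p :: 'a)}" by (intro closed_Collect_eq continuous_intros)
  qed (use inn in \<open>simp add: norm_eq_sqrt_inner\<close>)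
  have Lfst: "fst p \<in> closure (range V)" if "p \<in> L" for p
  proof (rule clos[OF that])
    show "closed {p :: 'a \<times> 'a. fst p \<in> closure (range V)}"
      using closed_vimage_fst[OF closed_closure[of "range V"]] by (simp add: vimage_def)
  qed (use closure_subset in fastforce)
  have "\<exists>p. p \<in> L \<and> (\<forall>b. inner (x - fst p) (V b) = 0)" for x
  proof -
    obtain q where q: "q \<in> L" "\<And>s. s \<in> L \<Longrightarrow> inner ((x, 0) - q) s = 0"
      using closed_subspace_orthogonal_projection[OF L, of "(x, 0)"] by blast
    \<comment> \<open>\<open>L\<close> will be the graph of \<open>U\<close> on the closure of \<open>range V\<close>; since \<open>U\<close> is isometric there, \<open>(x, 0)\<close>
      projects to \<open>(v, U v) / 2\<close>, where \<open>v\<close> is the projection of \<open>x\<close> onto that closure.\<close>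
    have "2 *\<^sub>R q \<in> L" using L(1) q(1) by (rule subspace_scale)
    moreover have "inner (x - fst (2 *\<^sub>R q)) (V b) = 0" for b
    proof -
      have "inner (x - fst q) (V b) = inner (snd q) (W b)"
        using q(2)[OF VaWa[of b]] by (simp add: inner_prod_def)
      then show ?thesis using Linn[OF q(1), of b] by (simp add: inner_diff_left)
    qed
    ultimately show ?thesis by blast
  qed
  then obtain p where p: "\<And>x. p x \<in> L" "\<And>x b. inner (x - fst (p x)) (V b) = 0" by metis
  have kerV: "V (x - fst (p x)) = 0" for x
  proof -
    have "inner (V (x - fst (p x))) (V (x - fst (p x))) = 0"
      using p(2)[of x "V (x - fst (p x))"] symmetric_blinfunD[OF V] by metis
    then show ?thesis by simp
  qed
  have orth: "inner v n = 0" if "v \<in> closure (range V)" "V n = 0" for v n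
  proof -
    have "closed {v. inner v n = 0}" by (intro closed_Collect_eq continuous_intros)
    moreover have "range V \<subseteq> {v. inner v n = 0}" using symmetric_blinfunD[OF V] that(2) by auto
    ultimately show ?thesis using closure_minimal that(1) by blast
  qed
  have uniq: "q = p x" if "q \<in> L" "V (x - fst q) = 0" for q x
  proof -
    have dL: "q - p x \<in> L" using L(1) that(1) p(1) by (rule subspace_diff)
    have "V (fst (q - p x)) = 0"
      using that(2) kerV[of x] by (simp add: blinfun.bilinear_simps)
    then have "fst (q - p x) = 0" using orth[OF Lfst[OF dL]] by (metis inner_eq_zero_iff)
    moreover from this have "snd (q - p x) = 0" using Lnorm[OF dL] by simp
    ultimately show ?thesis by (simp add: prod_eq_iff)
  qed
  have padd: "p (x + y) = p x + p y" for x y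
    by (rule uniq[symmetric]) (use L(1) p(1) kerV[of x] kerV[of y] in
      \<open>auto simp: subspace_add blinfun.bilinear_simps\<close>)
  have pscale: "p (r *\<^sub>R x) = r *\<^sub>R p x" for r x
    by (rule uniq[symmetric]) (use L(1) p(1) kerV[of x] in
      \<open>auto simp: subspace_scale blinfun.bilinear_simps\<close>)
  have pnorm: "norm (snd (p x)) \<le> norm x" for x
  proof -
    have "inner (fst (p x)) (x - fst (p x)) = 0" using orth[OF Lfst[OF p(1)] kerV] .
    then have "(norm x)\<^sup>2 = (norm (fst (p x)))\<^sup>2 + (norm (x - fst (p x)))\<^sup>2"
      unfolding power2_norm_eq_inner by (simp add: inner_diff_left inner_diff_right inner_commute)
    then have "(norm (fst (p x)))\<^sup>2 \<le> (norm x)\<^sup>2" using zero_le_power2 by (metis le_add_same_cancel1)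
    then have "norm (fst (p x)) \<le> norm x" by (rule power2_le_imp_le) simp
    then show ?thesis using Lnorm[OF p(1)] by simp
  qed
  have bl: "bounded_linear (\<lambda>x. snd (p x))"
    by (rule bounded_linear_intro[where K = 1]) (use pnorm in \<open>simp_all add: padd pscale\<close>)
  define U where "U = Blinfun (\<lambda>x. snd (p x))"
  have U: "U x = snd (p x)" for x by (simp add: U_def bounded_linear_Blinfun_apply[OF bl])
  have UV: "U (V x) = W x" for x
  proof -
    have "(V x, W x) = p (V x)" by (rule uniq[OF VaWa]) (simp add: blinfun.zero_right)
    then show ?thesis by (metis U snd_conv)
  qed
  have Uker: "U x = 0" if "V x = 0" for x
    using uniq[of 0 x] subspace_0[OF L(1)] that by (simp add: U flip: zero_prod_def)
  have dec: "x = fst (p x) + (x - fst (p x))" for x by simp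
  \<comment> \<open>Every vector splits along the closure of the range of \<open>V\<close> and the
    kernel of \<open>V\<close>, so operators are compared on these two pieces only.\<close>
  have ext: "A x = B x" if "\<And>a. A (V a) = B (V a)" "\<And>n. V n = 0 \<Longrightarrow> A n = B n" for A B :: "'a \<Rightarrow>\<^sub>L 'a" and x
  proof -
    have "closed {v. A v = B v}" by (intro closed_Collect_eq continuous_intros)
    then have "closure (range V) \<subseteq> {v. A v = B v}" using that(1) by (intro closure_minimal) auto
    then have "A (fst (p x)) = B (fst (p x))" using Lfst[OF p(1)] by blast
    moreover have "A (x - fst (p x)) = B (x - fst (p x))" using that(2) kerV by blast
    ultimately show ?thesis by (simp add: blinfun.diff_right)
  qed
  have UZ: "commuting U Z" if "commuting V Z" "commuting W Z" for Z
  proof -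
    have "(U o\<^sub>L Z) x = (Z o\<^sub>L U) x" for x
    proof (rule ext)
      show "(U o\<^sub>L Z) (V a) = (Z o\<^sub>L U) (V a)" for a
        using that UV unfolding commuting_def by (metis blinfun_apply_blinfun_compose)
      show "(U o\<^sub>L Z) n = (Z o\<^sub>L U) n" if "V n = 0" for n
      proof -
        have "V (Z n) = 0" using \<open>commuting V Z\<close> that unfolding commuting_def by (metis blinfun.zero_right)
        then show ?thesis using Uker that by (simp add: blinfun.zero_right)
      qed
    qed
    then show ?thesis unfolding commuting_def by simp
  qed
  have UVc: "commuting U V" by (rule UZ) (use VW in \<open>simp_all add: commuting_def\<close>)
  \<comment> \<open>Symmetry of \<open>U\<close> is proved by comparing it with its adjoint on the
    two pieces; on the range of \<open>V\<close> this uses that \<open>U\<close> and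
    \<open>V\<close> commute.\<close>
  obtain U' :: "'a \<Rightarrow>\<^sub>L 'a" where U': "\<And>x y. inner (U' y) x = inner y (U x)"
    by (rule adjoint_blinfun_exists[of U]) (rule that)
  have "U x = U' x" for x
  proof (rule ext)
    show "U (V a) = U' (V a)" for a
    proof -
      have "inner (U' (V a)) y = inner (U (V a)) y" for y
        using U'[of "V a" y] symmetric_blinfunD[OF V, of a "U y"] symmetric_blinfunD[OF W, of a y]
          commutingD[OF UVc, of y] UV by simp
      then show ?thesis by (metis vector_eq_rdot)
    qed
    show "U n = U' n" if "V n = 0" for n
    proof -
      have "W n = 0"
        using inn[of n n] that by simp
      then have "inner n (W y) = 0" for y using symmetric_blinfunD[OF W, of n y] by simp
      moreover have "closed {q :: 'a \<times> 'a. inner n (snd q) = 0}"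
        by (intro closed_Collect_eq continuous_intros)
      ultimately have "inner n (snd q) = 0" if "q \<in> L" for q
        using clos[OF that, of "\<lambda>q. inner n (snd q) = 0"] by simp
      then have "inner (U' n) y = 0" for y using U' p(1) U by simp
      then have "U' n = 0" by (metis inner_eq_zero_iff)
      then show ?thesis using Uker[OF that] by simp
    qed
  qed
  then have Us: "symmetric_blinfun U" unfolding symmetric_blinfun_def using U' by metis
  show ?thesis
  proof (rule that[OF Us UV Uker])
    show "norm (U x) = norm x" if "\<And>y. V y = 0 \<Longrightarrow> inner y x = 0" for x
    proof -
      have "inner (x - fst (p x)) x = 0" using that kerV by blast
      moreover have "inner (fst (p x)) (x - fst (p x)) = 0" using orth[OF Lfst[OF p(1)] kerV] .
      ultimately have "inner (x - fst (p x)) (x - fst (p x)) = 0"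
        by (simp add: inner_diff_left inner_diff_right inner_commute)
      then show ?thesis using Lnorm[OF p(1)[of x]] U by simp
    qed
    show "\<exists>v n. x = v + n \<and> v \<in> closure (range V) \<and> V n = 0" for x
      using dec Lfst[OF p(1)] kerV by blast
  qed (use UZ in auto)
qed


text \<open>Since \<open>1 + D C\<^sup>-\<^sup>1 = P C\<^sup>-\<^sup>1\<close>, the new parameter
  \<open>y = P x\<close> exhibits \<open>C M\<close> as the inverse of one plus the
  operator.\<close>

lemma op_pair_id_eq:
  fixes C D M P :: "'a::chilbert_space \<Rightarrow>\<^sub>L 'a"
  assumes M: "\<And>x. P (M x) = x" "\<And>x. M (P x) = x" and P: "\<And>x. P x = C x + D x"
  shows "op_pair C D = op_pair (C o\<^sub>L M) (D o\<^sub>L M)" "one_plus (op_pair C D) = op_pair (C o\<^sub>L M) id_blinfun"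
proof -
  show "op_pair C D = op_pair (C o\<^sub>L M) (D o\<^sub>L M)"
    unfolding op_pair_def
  proof (intro equalityI subsetI)
    fix p assume "p \<in> range (\<lambda>x. (C x, D x))"
    then obtain x where "p = (C x, D x)" by blast
    then show "p \<in> range (\<lambda>x. ((C o\<^sub>L M) x, (D o\<^sub>L M) x))"
      by (intro image_eqI[of _ _ "P x"]) (simp_all add: M)
  qed auto
  show "one_plus (op_pair C D) = op_pair (C o\<^sub>L M) id_blinfun"
  proof (intro equalityI subsetI)
    fix p assume "p \<in> one_plus (op_pair C D)"
    then obtain x where "p = (C x, P x)" unfolding one_plus_def op_pair_def P by blast
    then show "p \<in> op_pair (C o\<^sub>L M) id_blinfun"
      unfolding op_pair_def by (intro image_eqI[of _ _ "P x"]) (simp_all add: M)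
  next
    fix p assume "p \<in> op_pair (C o\<^sub>L M) id_blinfun"
    then obtain y where "p = (C (M y), y)" unfolding op_pair_def by auto
    then have "p = (C (M y), C (M y) + D (M y))" using P[of "M y"] M(1)[of y] by simp
    then show "p \<in> one_plus (op_pair C D)" unfolding one_plus_def op_pair_def by blast
  qed
qed

text \<open>\<open>C\<^sup>2 = (1 + H\<^sup>2)\<^sup>-\<^sup>1\<close> determines
  \<open>H\<^sup>2\<close>, so uniqueness of the root gives
  \<open>|H| = D C\<^sup>-\<^sup>1\<close>; the sign is the partial isometry of the commuting pair
  \<open>V = C D\<close> and \<open>W\<close>.\<close>

lemma self_adjoint_abs_op:
  fixes H :: "('a::chilbert_space, 'a) op_graph"
  assumes H: "self_adjoint H"
  obtains C D U :: "'a \<Rightarrow>\<^sub>L 'a" where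
    "clinear_blinfun C" "clinear_blinfun D" "symmetric_blinfun C" "symmetric_blinfun D"
    "\<And>x. C x = 0 \<Longrightarrow> x = 0" "commuting C D" "\<And>x. C (C x) + D (D x) = x" "\<And>x. 0 \<le> inner (C x) (D x)"
    "abs_op H = op_pair C D"
    "clinear_blinfun U" "symmetric_blinfun U" "commuting U C" "commuting U D"
    "\<And>x. U (U (D x)) = D x" "sgn_op H = U" "H = {(x, U y) | x y. (x, y) \<in> op_pair C D}"
proof -
  have Hlin: "linear_operator H" and dense: "closure (Domain H) = UNIV" and Hsa: "real_self_adjoint H"
    using H unfolding self_adjoint_iff by auto
  obtain R W where Rs: "symmetric_blinfun R" and Ws: "symmetric_blinfun W"
    and Rn: "norm R \<le> 1" "norm (id_blinfun - R) \<le> 1"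
    and RW: "\<And>x. (R x, W x) \<in> H" "\<And>x. (W x, x - R x) \<in> H"
    and uniq: "\<And>f g x. (f, g) \<in> H \<Longrightarrow> (g, x - f) \<in> H \<Longrightarrow> f = R x \<and> g = W x"
    and mem: "\<And>f h. (f, h) \<in> H \<longleftrightarrow> W f = R h" and Rinj: "\<And>x. R x = 0 \<Longrightarrow> x = 0"
    and RWc: "commuting R W" and WW: "\<And>x. W (W x) = R (x - R x)"
    and inv: "\<And>Z :: 'a \<Rightarrow>\<^sub>L 'a. (\<And>f h. (f, h) \<in> H \<Longrightarrow> (blinfun_apply Z f, blinfun_apply Z h) \<in> H) \<Longrightarrow> commuting R Z \<and> commuting W Z"
  proof (rule graph_projection[OF Hsa dense], goal_cases)
    case (1 R W)
    from 1(2-) show ?case by (rule 1(1))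
  qed
  note R = Rs Rn Rinj and W = Ws RWc WW
  have RWi: "commuting R imag_blinfun" "commuting W imag_blinfun"
    using inv[of imag_blinfun] Hlin unfolding linear_operator_def by auto
  obtain C D where C: "symmetric_blinfun C" and D: "symmetric_blinfun D" and CD: "commuting C D"
    "\<And>x. C (C x) = R x" "\<And>x. C (C x) + D (D x) = x" "\<And>x. 0 \<le> inner (C x) (D x)"
    and CDZ: "\<And>Z. commuting R Z \<Longrightarrow> commuting C Z \<and> commuting D Z" and "\<And>x. 0 \<le> inner x (C x)"
    using mult_sqrt_exists[OF R(1-3)] by blast
  have DD: "D (D x) = x - R x" for x using CD(2)[of x] CD(3)[of x] by (simp add: algebra_simps)
  have Cinj: "x = 0" if "C x = 0" for x using R(4)[of x] CD(2)[of x] that by (simp add: blinfun.zero_right)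
  have clin: "clinear_blinfun C" "clinear_blinfun D"
    using CDZ[OF RWi(1)] by (simp_all add: clinear_blinfun_iff_commuting)
  have absH: "abs_op H = op_pair C D"
    unfolding abs_op_def
  proof (rule sqrt_op_eq)
    show "self_adjoint (op_pair C D)"
      by (rule self_adjoint_op_pairI) (use clin C D CD Cinj op_pair_mem_iff[OF CD(1) CD(3)] in auto)
    show "nonneg_op (op_pair C D)" by (rule nonneg_op_pair) (use clin C D CD in auto)
    have "op_pair C D O op_pair C D = H O H"
    proof (rule set_eqI)
      fix q :: "'a \<times> 'a"
      obtain f g where q: "q = (f, g)" by (cases q)
      have "(f, g) \<in> H O H \<longleftrightarrow> f = R (f + g)"
      proof
        assume "(f, g) \<in> H O H"
        then obtain k where "(f, k) \<in> H" "(k, g) \<in> H" by blast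
        then show "f = R (f + g)" using uniq[of f k "f + g"] by simp
      next
        assume *: "f = R (f + g)"
        then have "(f, W (f + g)) \<in> H" "(W (f + g), g) \<in> H"
          using RW(1)[of "f + g"] RW(2)[of "f + g"] by (metis, metis add_diff_cancel_left')
        then show "(f, g) \<in> H O H" by blast
      qed
      then show "q \<in> op_pair C D O op_pair C D \<longleftrightarrow> q \<in> H O H"
        unfolding q op_pair_square_iff[OF CD(1) CD(3)] CD(2) by simp
    qed
    then show "op_pair C D O op_pair C D = H O adjoint_op H"
      using H unfolding self_adjoint_def by simp
  qed
  define V where "V = C o\<^sub>L D"
  have Vs: "symmetric_blinfun V"
    using C D CD(1) unfolding symmetric_blinfun_def commuting_def V_def by simp
  have VV: "V (V x) = W (W x)" for x
  proof -
    have "V (V x) = C (C (D (D x)))" using commutingD[OF CD(1)] by (simp add: V_def)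
    then show ?thesis by (simp add: DD CD(2) W(3))
  qed
  have CW: "commuting C W" "commuting D W" using CDZ[OF W(2)] by auto
  then have VW: "commuting V W" unfolding V_def commuting_def by simp
  obtain U where U: "symmetric_blinfun U" "\<And>x. U (V x) = W x" "\<And>x. V x = 0 \<Longrightarrow> U x = 0"
    "\<And>x. (\<And>y. V y = 0 \<Longrightarrow> inner y x = 0) \<Longrightarrow> norm (U x) = norm x"
    "\<And>Z. commuting V Z \<Longrightarrow> commuting W Z \<Longrightarrow> commuting U Z"
    and dec: "\<And>x. \<exists>v n. x = v + n \<and> v \<in> closure (range V) \<and> V n = 0"
  proof (rule partial_isometry_exists[OF Vs W(1) VW VV], goal_cases)
    case (1 U)
    from 1(2-) show ?case by (rule 1(1))
  qed
  have VR: "commuting V R" using CDZ[of R] unfolding V_def commuting_def by simp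
  have UR: "commuting U R" by (rule U(5)[OF VR commuting_sym[OF W(2)]])
  have UC: "commuting U C" "commuting U D" using CDZ[OF commuting_sym[OF UR]] commuting_sym by blast+
  have Ui: "clinear_blinfun U"
    unfolding clinear_blinfun_iff_commuting
    by (rule U(5)) (use CDZ[OF RWi(1)] RWi(2) in \<open>simp_all add: V_def commuting_def\<close>)
  have UW: "commuting U W" by (rule U(5)) (use VW in \<open>simp_all add: commuting_def\<close>)
  \<comment> \<open>\<open>X\<close> measures the failure of \<open>U\<^sup>2 = 1\<close>. It kills
    the range of \<open>V\<^sup>2 = R D\<^sup>2\<close>, hence that of \<open>D\<^sup>2\<close>
    because \<open>R\<close> is injective and commutes with \<open>X\<close>, hence that of
    \<open>D\<close>.\<close>
  define X where "X = (U o\<^sub>L U) - id_blinfun"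
  have X: "X x = U (U x) - x" for x by (simp add: X_def blinfun.bilinear_simps)
  have Xs: "symmetric_blinfun X"
    using U(1) unfolding symmetric_blinfun_def X by (simp add: inner_diff_left inner_diff_right)
  have XZ: "commuting X Z" if "commuting U Z" for Z
    using that unfolding commuting_def X by (simp add: blinfun.diff_right)
  have XVV: "X (V (V x)) = 0" for x
    using U(2) commutingD[OF UW] VV unfolding X by (metis eq_iff_diff_eq_0)
  have XDD: "X (D (D x)) = 0" for x
  proof -
    have "R (X (D (D x))) = X (R (D (D x)))" using XZ[OF UR] by (simp add: commuting_def)
    also have "R (D (D x)) = V (V x)" by (simp add: DD VV W(3))
    finally show ?thesis using XVV R(4) by simp
  qed
  have XD: "U (U (D x)) = D x" for x
    using symmetric_mult_square_zero[OF Xs D XZ[OF UC(2)] XDD] X by simp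
  have UUV: "U (U (V x)) = V x" for x
    using XD[of "C x"] commutingD[OF CD(1)] by (simp add: V_def)
  \<comment> \<open>Brings membership in \<open>|H|\<close> to the shape that \<open>mem\<close> has
    for \<open>H\<close>, with \<open>V\<close> in the place of \<open>W\<close>; \<open>U\<close>
    exchanges the two.\<close>
  have absmem: "(f, h) \<in> op_pair C D \<longleftrightarrow> V f = R h" for f h
  proof -
    have "V f = R h \<longleftrightarrow> C (D f - C h) = 0" by (simp add: V_def blinfun.diff_right CD(2))
    also have "\<dots> \<longleftrightarrow> D f = C h" using Cinj by (metis blinfun.zero_right eq_iff_diff_eq_0)
    finally show ?thesis using op_pair_mem_iff[OF CD(1) CD(3)] by simp
  qed
  have Heq: "H = {(x, U y) | x y. (x, y) \<in> op_pair C D}"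
  proof (intro equalityI subsetI)
    fix q assume "q \<in> H"
    then obtain f g where q: "q = (f, g)" "W f = R g" using mem by (metis surj_pair)
    have "V f = R (U g)" using UUV[of f] U(2)[of f] q(2) commutingD[OF UR, of g] by simp
    then have "(f, U g) \<in> op_pair C D" using absmem by blast
    \<comment> \<open>\<open>g\<close> is split into \<open>R g = W f\<close> and
      \<open>g - R g = D (D g)\<close>; on each of them \<open>U\<^sup>2\<close> is the
      identity.\<close>
    moreover have "U (U g) = g"
    proof -
      have "U (U (R g)) = R g" using q(2) U(2)[of f] UUV[of f] by metis
      moreover have "U (U (g - R g)) = g - R g" using XD[of "D g"] DD by simp
      ultimately show ?thesis by (simp add: blinfun.diff_right)
    qed
    ultimately show "q \<in> {(x, U y) | x y. (x, y) \<in> op_pair C D}" using q by force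
  next
    fix q assume "q \<in> {(x, U y) | x y. (x, y) \<in> op_pair C D}"
    then obtain f h where q: "q = (f, U h)" "V f = R h" using absmem by blast
    then have "W f = R (U h)" using U(2)[of f] commutingD[OF UR] by metis
    then show "q \<in> H" using q mem by blast
  qed
  have kerH: "x \<in> ker H \<longleftrightarrow> V x = 0" for x
  proof -
    have "x \<in> ker H \<longleftrightarrow> W x = 0" unfolding ker_def using mem by (simp add: blinfun.zero_right)
    also have "\<dots> \<longleftrightarrow> inner (W x) (W x) = 0" by simp
    also have "\<dots> \<longleftrightarrow> inner (V x) (V x) = 0"
      using symmetric_blinfunD[OF W(1), of x "W x"] symmetric_blinfunD[OF Vs, of x "V x"] VV by simp
    finally show ?thesis by simp
  qed
  have sgnH: "sgn_op H = U"
    unfolding sgn_op_def absH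
  proof (rule the_equality, intro conjI ballI allI impI)
    show "bounded_clinear U"
      using Ui unfolding bounded_clinear_def clinear_blinfun_def by (simp add: blinfun.bounded_linear_right)
    show "U x = 0" if "x \<in> ker H" for x using that U(3) kerH by simp
    show "norm (U x) = norm x" if "\<forall>y\<in>ker H. cinner y x = 0" for x
      by (rule U(4)) (use that kerH in \<open>simp flip: Re_cinner\<close>)
    show "H = {(x, U y) |x y. (x, y) \<in> op_pair C D}" by (rule Heq)
  next
    fix T assume T: "bounded_clinear T \<and> (\<forall>x\<in>ker H. T x = 0) \<and>
      (\<forall>x. (\<forall>y\<in>ker H. cinner y x = 0) \<longrightarrow> norm (T x) = norm x) \<and> H = {(x, T y) |x y. (x, y) \<in> op_pair C D}"
    then have bT: "bounded_linear T" unfolding bounded_clinear_def by blast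
    show "T = blinfun_apply U"
    proof
      fix x
      obtain v n where vn: "x = v + n" "v \<in> closure (range V)" "V n = 0" using dec by blast
      \<comment> \<open>Single-valuedness of \<open>H\<close> forces agreement on the range of
        \<open>V\<close>; continuity extends it to the closure, and both maps vanish on the
        kernel.\<close>
      have "T (V a) = U (V a)" for a
      proof -
        have "(R a, V a) \<in> op_pair C D" using absmem commutingD[OF VR] by simp
        then have "(R a, T (V a)) \<in> H" "(R a, U (V a)) \<in> H" using T Heq by blast+
        then show ?thesis using Hlin unfolding linear_operator_def single_valued_def by blast
      qed
      moreover have "closed {v. T v = U v}"
        by (intro closed_Collect_eq continuous_intros linear_continuous_on bT)
      ultimately have "T v = U v" using vn(2) closure_minimal[of "range V" "{v. T v = U v}"] by blast
      moreover have "T n = 0" "U n = 0" using T U(3) vn(3) kerH by blast+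
      ultimately show "T x = U x"
        using vn(1) linear_add[OF bounded_linear.linear[OF bT]] by (simp add: blinfun.add_right)
    qed
  qed
  show ?thesis
    using that[OF clin C D Cinj CD(1) CD(3) CD(4) absH Ui U(1) UC XD sgnH Heq] by blast
qed

text \<open>\<open>B\<^sup>2 = (1 + |H|)\<^sup>-\<^sup>1\<close> and
  \<open>E\<^sup>2 = 1 - B\<^sup>2\<close>, so \<open>E = |H|\<^sup>1\<^sup>/\<^sup>2 B\<close>, and
  \<open>E U E\<close> is the form of \<open>H\<close> pulled back along \<open>B\<close>. The last
  conclusion is the equation \<open>B H B x = E U E x\<close> for \<open>B x\<close> in the domain
  of \<open>H\<close>.\<close>

theorem form_representation:
  fixes H :: "('a::chilbert_space, 'a) op_graph"
  assumes H: "self_adjoint H"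
  obtains B E U :: "'a \<Rightarrow>\<^sub>L 'a" where
    "clinear_blinfun B" "clinear_blinfun E" "clinear_blinfun U"
    "symmetric_blinfun B" "symmetric_blinfun E" "symmetric_blinfun U"
    "\<And>x. B x = 0 \<Longrightarrow> x = 0" "commuting U E" "\<And>x. B (B x) + E (E x) = x" "\<And>x. U (U (E x)) = E x"
    "sqrt_op (abs_op H) = op_pair B E"
    "sqrt_op (one_plus (abs_op H)) = op_pair B id_blinfun"
    "sgn_op H = U"
    "\<And>f h. (f, h) \<in> H \<Longrightarrow> \<exists>x. f = B x \<and> E (U (E x)) = B h"
proof -
  obtain C D U :: "'a \<Rightarrow>\<^sub>L 'a" where clin: "clinear_blinfun C" "clinear_blinfun D"
    and C: "symmetric_blinfun C" and D: "symmetric_blinfun D"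
    and Cinj: "\<And>x. C x = 0 \<Longrightarrow> x = 0" and CD: "commuting C D" "\<And>x. C (C x) + D (D x) = x" "\<And>x. 0 \<le> inner (C x) (D x)"
    and absH: "abs_op H = op_pair C D"
    and U: "clinear_blinfun U" "symmetric_blinfun U" "commuting U C" "commuting U D"
      "\<And>x. U (U (D x)) = D x" "sgn_op H = U"
    and Heq: "H = {(x, U y) | x y. (x, y) \<in> op_pair C D}"
  proof (rule self_adjoint_abs_op[OF H], goal_cases)
    case (1 C D U)
    from 1(2-) show ?case by (rule 1(1))
  qed
  \<comment> \<open>In the parameter \<open>x\<close> of the graph of \<open>|H|\<close>,
    \<open>1 + |H|\<close> sends \<open>C x\<close> to \<open>P x\<close>. Nonnegativity of
    \<open>inner (C x) (D x)\<close> bounds \<open>P\<close> below by one, so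
    \<open>K = C P\<^sup>-\<^sup>1 = (1 + |H|)\<^sup>-\<^sup>1\<close> is a bounded
    operator.\<close>
  define P where "P = C + D"
  have P: "P x = C x + D x" for x by (simp add: P_def blinfun.bilinear_simps)
  have Ps: "symmetric_blinfun P"
    using C D by (simp add: symmetric_blinfun_def P inner_add_left inner_add_right)
  have sumsq: "(norm x)\<^sup>2 = (norm (C x))\<^sup>2 + (norm (D x))\<^sup>2" for x
  proof -
    have "inner x (C (C x) + D (D x)) = inner (C x) (C x) + inner (D x) (D x)"
      using symmetric_blinfunD[OF C, of x "C x"] symmetric_blinfunD[OF D, of x "D x"] by (simp add: inner_add_right)
    then have "inner x x = inner (C x) (C x) + inner (D x) (D x)" using CD(2)[of x] by metis
    then show ?thesis by (metis power2_norm_eq_inner)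
  qed
  have Pnorm: "(norm (P x))\<^sup>2 = (norm x)\<^sup>2 + 2 * inner (C x) (D x)" for x
    using sumsq[of x] unfolding P power2_norm_eq_inner
    by (simp add: inner_add_left inner_add_right inner_commute)
  have le: "norm x \<le> norm (P x)" "norm (C x) \<le> norm (P x)" "norm (D x) \<le> norm (P x)" for x
    by (rule power2_le_imp_le; use Pnorm[of x] sumsq[of x] CD(3)[of x] in simp)+
  obtain M :: "'a \<Rightarrow>\<^sub>L 'a" where M: "\<And>x. P (M x) = x" "\<And>x. M (P x) = x"
  proof (rule bounded_below_blinfun_inverse[of 1 P])
    fix y assume "\<And>x. inner y (P x) = 0"
    then have "inner (P y) (P y) = 0" using symmetric_blinfunD[OF Ps] by metis
    then show "y = 0" using le(1)[of y] by simp
  qed (use le in auto)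
  have MZ: "commuting M Z" if "commuting C Z" "commuting D Z" for Z
    unfolding commuting_def
  proof
    fix x
    have "P (Z (M x)) = Z x"
      using that M(1)[of x] unfolding P commuting_def by (metis blinfun.add_right)
    then show "M (Z x) = Z (M x)" using M(2) by metis
  qed
  have Ms: "symmetric_blinfun M"
    unfolding symmetric_blinfun_def using M(1) symmetric_blinfunD[OF Ps] by metis
  have MC: "commuting M C" by (rule MZ) (use CD(1) in \<open>simp_all add: commuting_def\<close>)
  define K where "K = C o\<^sub>L M"
  have K1: "x - K x = D (M x)" for x
    using M(1)[of x] unfolding P by (simp add: K_def algebra_simps)
  have Ks: "symmetric_blinfun K"
    using C Ms MC unfolding symmetric_blinfun_def commuting_def K_def by simp
  have nK: "norm K \<le> 1"
    by (rule norm_blinfun_bound) (use le(2) M(1) in \<open>auto simp: K_def\<close>, metis)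
  have nK1: "norm (id_blinfun - K) \<le> 1"
    by (rule norm_blinfun_bound) (use le(3) M(1) in \<open>auto simp: blinfun.bilinear_simps K1\<close>, metis)
  have Kinj: "x = 0" if "K x = 0" for x
    using that Cinj[of "M x"] M(1)[of x] by (simp add: K_def blinfun.zero_right)
  have KZ: "commuting K Z" if "commuting C Z" "commuting D Z" for Z
    using MZ[OF that] that unfolding K_def commuting_def by simp
  obtain B E where B: "symmetric_blinfun B" and E: "symmetric_blinfun E" and BE: "commuting B E"
    "\<And>x. B (B x) = K x" "\<And>x. B (B x) + E (E x) = x" "\<And>x. 0 \<le> inner (B x) (E x)"
    and BEZ: "\<And>Z. commuting K Z \<Longrightarrow> commuting B Z \<and> commuting E Z"
    and Bpos: "\<And>x. 0 \<le> inner x (B x)"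
    using mult_sqrt_exists[OF Ks nK nK1] by blast
  have Binj: "x = 0" if "B x = 0" for x
    using Kinj[of x] BE(2)[of x] that by (simp add: blinfun.zero_right)
  have KU: "commuting K U" by (rule KZ) (use U in \<open>simp_all add: commuting_def\<close>)
  have BU: "commuting B U" "commuting E U" using BEZ[OF KU] by auto
  have EE: "E (E x) = D (M x)" for x using BE(2)[of x] BE(3)[of x] K1[of x] by (metis add_diff_cancel_left')
  have Bi: "clinear_blinfun B" "clinear_blinfun E"
    using BEZ[OF KZ] clin by (auto simp: clinear_blinfun_iff_commuting)
  define X where "X = (U o\<^sub>L U) - id_blinfun"
  have X: "X x = U (U x) - x" for x by (simp add: X_def blinfun.bilinear_simps)
  have Xs: "symmetric_blinfun X"
    using U(2) unfolding symmetric_blinfun_def X by (simp add: inner_diff_left inner_diff_right)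
  have XE: "commuting X E"
    using BU(2) unfolding commuting_def X by (simp add: blinfun.diff_right)
  have UUE: "U (U (E x)) = E x" for x
    using symmetric_mult_square_zero[OF Xs E XE] U(5) by (simp add: X EE)
  have absK: "op_pair C D = op_pair K (D o\<^sub>L M)" and oneK: "one_plus (op_pair C D) = op_pair K id_blinfun"
    unfolding K_def by (rule op_pair_id_eq[OF M P])+
  have absmem: "(f, g) \<in> op_pair C D \<longleftrightarrow> f = K (f + g)" for f g
  proof
    assume "(f, g) \<in> op_pair C D"
    then obtain x where "f = K x" "g = D (M x)" unfolding absK unfolding op_pair_def by auto
    then show "f = K (f + g)" using K1[of x] by (metis add_diff_cancel_left' add_diff_eq)
  next
    assume "f = K (f + g)"
    moreover from this have "g = D (M (f + g))" using K1[of "f + g"] by (metis add_diff_cancel_left')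
    ultimately show "(f, g) \<in> op_pair C D"
      unfolding absK unfolding op_pair_def by (intro image_eqI[of _ _ "f + g"]) simp_all
  qed
  have sqrt1: "sqrt_op (abs_op H) = op_pair B E"
  proof (rule sqrt_op_eq)
    show "self_adjoint (op_pair B E)"
      by (rule self_adjoint_op_pairI) (use Bi B E BE Binj op_pair_mem_iff[OF BE(1) BE(3)] in auto)
    show "nonneg_op (op_pair B E)" by (rule nonneg_op_pair) (use Bi B E BE in auto)
    show "op_pair B E O op_pair B E = abs_op H"
      unfolding absH set_eq_iff split_paired_All op_pair_square_iff[OF BE(1) BE(3)] absmem BE(2) by simp
  qed
  have idc: "clinear_blinfun (id_blinfun :: 'a \<Rightarrow>\<^sub>L 'a)" "symmetric_blinfun (id_blinfun :: 'a \<Rightarrow>\<^sub>L 'a)"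
    by (simp_all add: clinear_blinfun_def symmetric_blinfun_def)
  have sqrt2: "sqrt_op (one_plus (abs_op H)) = op_pair B id_blinfun"
  proof (rule sqrt_op_eq)
    show "self_adjoint (op_pair B id_blinfun)"
      by (rule self_adjoint_op_pairI) (use Bi B idc Binj in \<open>auto simp: commuting_def op_pair_def\<close>)
    show "nonneg_op (op_pair B id_blinfun)"
      by (rule nonneg_op_pair) (use Bi B idc Bpos in \<open>auto simp: commuting_def inner_commute\<close>)
    show "op_pair B id_blinfun O op_pair B id_blinfun = one_plus (abs_op H)"
      unfolding absH oneK unfolding op_pair_def by (auto simp: BE(2)[symmetric])
  qed
  have form: "\<exists>x. f = B x \<and> E (U (E x)) = B h" if "(f, h) \<in> H" for f h
  proof -
    obtain h' where h': "h = U h'" "(f, h') \<in> op_pair C D" using \<open>(f, h) \<in> H\<close> Heq by auto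
    then obtain y where y: "f = K y" "h' = D (M y)" unfolding absK unfolding op_pair_def by auto
    \<comment> \<open>Since \<open>f = K y = B (B y)\<close>, the witness is
      \<open>B y\<close>.\<close>
    have "E (U (E (B y))) = B (U (E (E y)))" using BE(1) BU unfolding commuting_def by metis
    then show ?thesis using y h'(1) EE BE(2) by metis
  qed
  show ?thesis
    using that[OF Bi U(1) B E U(2) Binj commuting_sym[OF BU(2)] BE(3) UUE sqrt1 sqrt2 U(6) form] by blast
qed

section \<open>Boundary behaviour of Herglotz functions\<close>

text \<open>Cauchy's theorem moves the integral from the segment to the half circle. There the
  weight \<open>R\<^sup>2 - z\<^sup>2 = z (cnj z - z)\<close> has modulus
  \<open>2 * R * Im z\<close> and cancels the growth \<open>c / Im z\<close> near the end points, so
  the bound does not depend on \<open>y\<close>.\<close>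

lemma half_disc_integral_bound:
  fixes h :: "complex \<Rightarrow> complex"
  assumes hol: "h holomorphic_on {z. Im z > 0}" and "R > 0" "y > 0"
    and bound: "\<And>z. Im z > 0 \<Longrightarrow> cmod z \<le> R + y \<Longrightarrow> cmod (h z) \<le> c / Im z"
  shows "((\<lambda>x. Re (h (Complex x y)) * (R\<^sup>2 - x\<^sup>2)) has_integral
      Re (contour_integral (linepath (- of_real R) (of_real R)) (\<lambda>z. h (z + \<i> * y) * (of_real (R\<^sup>2) - z\<^sup>2)))) {-R..R}"
    and "cmod (contour_integral (linepath (- of_real R) (of_real R)) (\<lambda>z. h (z + \<i> * y) * (of_real (R\<^sup>2) - z\<^sup>2)))
      \<le> 2 * c * R * R * pi"
proof -
  define g where "g = (\<lambda>z. h (z + \<i> * y) * (of_real (R\<^sup>2) - z\<^sup>2))"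
  define S where "S = {z. Im z > - y}"
  define p where "p = linepath (- complex_of_real R) (of_real R)"
  define q where "q = part_circlepath 0 R 0 pi"
  have c0: "c \<ge> 0"
    using order_trans[OF norm_ge_zero bound[of "\<i> * y"]] \<open>y > 0\<close> \<open>R > 0\<close>
    by (auto simp: norm_mult zero_le_divide_iff)
  have gS: "g holomorphic_on S"
    unfolding g_def S_def
    by (intro holomorphic_intros holomorphic_on_compose_gen[OF _ hol, unfolded o_def]) auto
  have S: "convex S" "open S"
    unfolding S_def by (simp_all add: convex_halfspace_Im_gt open_halfspace_Im_gt)
  have ends: "pathfinish p = pathstart q" "pathfinish q = pathstart p"
    unfolding p_def q_def by (simp_all add: exp_eq_polar)
  have pS: "path_image p \<subseteq> S"
    using \<open>y > 0\<close> S unfolding p_def S_def by (auto simp: closed_segment_def)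
  have qim: "\<exists>t\<in>{0..pi}. z = of_real R * cis t" if "z \<in> path_image q" for z
    using that unfolding q_def by (auto simp: path_image_part_circlepath' closed_segment_eq_real_ivl)
  have qIm: "Im z \<ge> 0" if "z \<in> path_image q" for z
    using qim[OF that] \<open>R > 0\<close> by (auto simp: sin_ge_zero)
  have qS: "path_image q \<subseteq> S" using qIm \<open>y > 0\<close> unfolding S_def by force
  have vp: "valid_path p" "valid_path q" unfolding p_def q_def by auto
  have ci: "g contour_integrable_on p" "g contour_integrable_on q"
    using contour_integrable_holomorphic_simple[OF gS S(2)] vp pS qS by blast+
  have "(g has_contour_integral 0) (p +++ q)"
    by (rule Cauchy_theorem_convex_simple[OF gS S(1)]) (use vp ends pS qS in \<open>auto simp: path_image_join\<close>)
  then have "contour_integral p g + contour_integral q g = 0"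
    using contour_integral_join[OF ci vp] contour_integral_unique by metis
  then have pq: "cmod (contour_integral p g) = cmod (contour_integral q g)"
    by (metis add_eq_0_iff norm_minus_cancel)
  have "cmod (contour_integral q g) \<le> (2 * c * R) * R * \<bar>pi - 0\<bar>"
    unfolding q_def
  proof (rule contour_integral_bound_part_circlepath)
    show "g contour_integrable_on part_circlepath 0 R 0 pi" using ci(2) unfolding q_def .
    show "0 \<le> 2 * c * R" "0 \<le> R" using c0 \<open>R > 0\<close> by auto
    fix z assume "z \<in> path_image (part_circlepath 0 R 0 pi)"
    then have zq: "z \<in> path_image q" unfolding q_def .
    then obtain t where t: "t \<in> {0..pi}" "z = of_real R * cis t" using qim by blast
    have nz: "cmod z = R" using t \<open>R > 0\<close> by (simp add: norm_mult)
    have Imz: "Im z \<ge> 0" by (rule qIm[OF zq])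
    have "(of_real (R\<^sup>2) - z\<^sup>2) = z * (cnj z - z)"
      using nz complex_norm_square[of z] by (simp add: power2_eq_square algebra_simps)
    moreover have "cnj z - z = - (2 * \<i> * Im z)" by (simp add: complex_eq_iff)
    ultimately have w: "cmod (of_real (R\<^sup>2) - z\<^sup>2) = R * (2 * Im z)"
      using nz Imz by (simp add: norm_mult)
    have "cmod (h (z + \<i> * y)) \<le> c / (Im z + y)"
      using bound[of "z + \<i> * y"] Imz \<open>y > 0\<close> nz norm_triangle_ineq[of z "\<i> * y"] by (simp add: norm_mult)
    then have "cmod (g z) \<le> c / (Im z + y) * (R * (2 * Im z))"
      unfolding g_def norm_mult w using Imz \<open>R > 0\<close> by (intro mult_right_mono) auto
    also have "\<dots> = 2 * c * R * (Im z / (Im z + y))" by simp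
    also have "\<dots> \<le> 2 * c * R * 1"
      using c0 \<open>R > 0\<close> \<open>y > 0\<close> Imz by (intro mult_left_mono) auto
    finally show "cmod (g z) \<le> 2 * c * R" by simp
  qed
  then show "cmod (contour_integral (linepath (- of_real R) (of_real R)) (\<lambda>z. h (z + \<i> * y) * (of_real (R\<^sup>2) - z\<^sup>2))) \<le> 2 * c * R * R * pi"
    using pq unfolding p_def g_def by simp
  have "(g has_contour_integral contour_integral p g) p"
    using ci(1) by (rule has_contour_integral_integral)
  then have "((\<lambda>x. g (of_real x)) has_integral contour_integral p g) {-R..R}"
    unfolding p_def using \<open>R > 0\<close> by (subst (asm) has_contour_integral_linepath_Reals_iff) auto
  then have "((\<lambda>x. Re (g (of_real x))) has_integral Re (contour_integral p g)) {-R..R}"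
    using has_integral_linear[OF _ bounded_linear_Re] by (simp add: o_def)
  moreover have "Re (g (of_real x)) = Re (h (Complex x y)) * (R\<^sup>2 - x\<^sup>2)" for x
  proof -
    have "of_real x + \<i> * y = Complex x y" by (simp add: complex_eq_iff)
    then have "g (of_real x) = h (Complex x y) * of_real (R\<^sup>2 - x\<^sup>2)" unfolding g_def by simp
    then show ?thesis by (simp only: times_complex.sel Re_complex_of_real Im_complex_of_real mult_zero_right diff_zero)
  qed
  ultimately have "((\<lambda>x. Re (h (Complex x y)) * (R\<^sup>2 - x\<^sup>2)) has_integral Re (contour_integral p g)) {-R..R}"
    by (simp only:)
  then show "((\<lambda>x. Re (h (Complex x y)) * (R\<^sup>2 - x\<^sup>2)) has_integral
      Re (contour_integral (linepath (- of_real R) (of_real R)) (\<lambda>z. h (z + \<i> * y) * (of_real (R\<^sup>2) - z\<^sup>2)))) {-R..R}"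
    unfolding p_def g_def .
qed

text \<open>By Fatou's lemma the lower limit is integrable, hence finite a.e., and a finite lower
  limit means that infinitely many terms stay below one constant. Both the constant and the indices
  depend on the point.\<close>

lemma AE_liminf_finite:
  fixes g :: "nat \<Rightarrow> 'a \<Rightarrow> ennreal"
  assumes "\<And>k. g k \<in> borel_measurable M" "\<And>k. (\<integral>\<^sup>+x. g k x \<partial>M) \<le> ennreal K"
  shows "AE x in M. \<exists>C::real. \<exists>\<^sub>\<infinity>k. g k x \<le> ennreal C"
proof -
  have "(\<integral>\<^sup>+x. liminf (\<lambda>k. g k x) \<partial>M) \<le> liminf (\<lambda>k. \<integral>\<^sup>+x. g k x \<partial>M)"
    by (rule nn_integral_liminf) (use assms in auto)
  also have "\<dots> \<le> limsup (\<lambda>k. \<integral>\<^sup>+x. g k x \<partial>M)" by (rule Liminf_le_Limsup) simp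
  also have "\<dots> \<le> ennreal K" by (rule Limsup_bounded) (use assms(2) in auto)
  finally have "(\<integral>\<^sup>+x. liminf (\<lambda>k. g k x) \<partial>M) \<noteq> \<infinity>" by (auto simp: top_unique)
  then have "AE x in M. liminf (\<lambda>k. g k x) \<noteq> \<infinity>"
    by (intro nn_integral_noteq_infinite) (use assms in measurable)
  then show ?thesis
  proof (rule AE_mp, intro AE_I2 impI)
    fix x assume "liminf (\<lambda>k. g k x) \<noteq> \<infinity>"
    then obtain C where C: "liminf (\<lambda>k. g k x) < ennreal C"
      by (metis ennreal_Ex_less_of_nat ennreal_of_nat_eq_real_of_nat infinity_ennreal_def less_top)
    have "\<exists>\<^sub>\<infinity>k. g k x \<le> ennreal C"
    proof (rule ccontr)
      assume "\<not> (\<exists>\<^sub>\<infinity>k. g k x \<le> ennreal C)"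
      then have "\<forall>\<^sub>\<infinity>k. ennreal C \<le> g k x"
        unfolding not_INFM by (rule MOST_mono) auto
      then have "ennreal C \<le> liminf (\<lambda>k. g k x)"
        by (intro Liminf_bounded) (simp add: cofinite_eq_sequentially)
      then show False using C by simp
    qed
    then show "\<exists>C::real. \<exists>\<^sub>\<infinity>k. g k x \<le> ennreal C" by blast
  qed
qed

text \<open>The function \<open>ln \<bar>f + \<i>\<bar>\<close> is nonnegative and harmonic when \<open>Im f \<ge> 0\<close>, so its weighted means over
  horizontal segments stay bounded, and Fatou's lemma applies.\<close>

lemma herglotz_bounded_infinitely_often:
  fixes f :: "'i \<Rightarrow> complex \<Rightarrow> complex"
  assumes fin: "finite S"
    and hol: "\<And>j. j \<in> S \<Longrightarrow> f j holomorphic_on {z. Im z > 0}"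
    and pos: "\<And>j z. j \<in> S \<Longrightarrow> Im z > 0 \<Longrightarrow> Im (f j z) \<ge> 0"
    and bound: "\<And>j r. j \<in> S \<Longrightarrow> \<exists>c. \<forall>z. Im z > 0 \<longrightarrow> cmod z \<le> r \<longrightarrow> cmod (f j z) \<le> c / Im z"
    and y: "\<And>k. 0 < y k" "y \<longlonglongrightarrow> 0"
  shows "AE t in lborel. \<exists>C. \<exists>\<^sub>\<infinity>k. \<forall>j\<in>S. cmod (f j (Complex t (y k))) \<le> C"
proof -
  \<comment> \<open>Summing the logarithms over \<open>S\<close> before applying Fatou's lemma
    yields indices \<open>k\<close> that serve all \<open>j\<close> at once.\<close>
  define h where "h = (\<lambda>z. \<Sum>j\<in>S. Ln (f j z + \<i>))"
  have Im1: "Im (f j z + \<i>) \<ge> 1" if "j \<in> S" "Im z > 0" for j z using pos[OF that] by simp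
  have n1: "1 \<le> cmod (f j z + \<i>)" if "j \<in> S" "Im z > 0" for j z
    using Im1[OF that] abs_Im_le_cmod[of "f j z + \<i>"] by linarith
  have hol_h: "h holomorphic_on {z. Im z > 0}"
    unfolding h_def
  proof (intro holomorphic_intros hol)
    fix j z assume "j \<in> S" "z \<in> {z. 0 < Im z}"
    then show "f j z + \<i> \<notin> \<real>\<^sub>\<le>\<^sub>0" using Im1[of j z] by (auto simp: complex_nonpos_Reals_iff)
  qed
  have Reh: "Re (h z) = (\<Sum>j\<in>S. ln (cmod (f j z + \<i>)))" if "Im z > 0" for z
    unfolding h_def Re_sum
  proof (rule sum.cong)
    fix j assume "j \<in> S"
    then have "f j z + \<i> \<noteq> 0" using n1[of j z] that by auto
    then show "Re (Ln (f j z + \<i>)) = ln (cmod (f j z + \<i>))" by simp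
  qed simp
  have term0: "0 \<le> ln (cmod (f j z + \<i>))" if "j \<in> S" "Im z > 0" for j z
    using n1[OF that] by (rule ln_ge_zero)
  have Reh0: "0 \<le> Re (h z)" if "Im z > 0" for z
    unfolding Reh[OF that] by (intro sum_nonneg term0 that)
  have hbound: "\<exists>c. \<forall>z. Im z > 0 \<longrightarrow> cmod z \<le> r \<longrightarrow> cmod (h z) \<le> c / Im z" for r
  proof -
    obtain c where c: "\<And>j z. j \<in> S \<Longrightarrow> Im z > 0 \<Longrightarrow> cmod z \<le> r \<Longrightarrow> cmod (f j z) \<le> c j / Im z"
      using bound[of _ r] by metis
    have "cmod (h z) \<le> (\<Sum>j\<in>S. c j + (1 + pi) * r) / Im z" if z: "Im z > 0" "cmod z \<le> r" for z
    proof -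
      have "cmod (Ln (f j z + \<i>)) \<le> (c j + (1 + pi) * r) / Im z" if j: "j \<in> S" for j
      proof -
        have nz: "f j z + \<i> \<noteq> 0" using n1[OF j z(1)] by auto
        have "cmod (Ln (f j z + \<i>)) \<le> \<bar>Re (Ln (f j z + \<i>))\<bar> + \<bar>Im (Ln (f j z + \<i>))\<bar>" by (rule cmod_le)
        also have "\<dots> \<le> cmod (f j z + \<i>) + pi"
          using nz term0[OF j z(1)] ln_le_minus_one[of "cmod (f j z + \<i>)"] mpi_less_Im_Ln[OF nz] Im_Ln_le_pi[OF nz]
          by (simp add: abs_le_iff)
        also have "\<dots> \<le> c j / Im z + (1 + pi)"
          using c[OF j z] norm_triangle_ineq[of "f j z" \<i>] by simp
        \<comment> \<open>Absorbs the constant into a bound of order \<open>1 / Im z\<close>, as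
          \<open>Im z \<le> cmod z \<le> r\<close>.\<close>
        also have "1 + pi \<le> (1 + pi) * r / Im z"
        proof -
          have "Im z \<le> r" using z abs_Im_le_cmod[of z] by linarith
          then have "(1 + pi) * Im z \<le> (1 + pi) * r" by (intro mult_left_mono) auto
          then show ?thesis using z(1) by (simp add: pos_le_divide_eq)
        qed
        finally show ?thesis by (simp add: add_divide_distrib)
      qed
      then have "cmod (h z) \<le> (\<Sum>j\<in>S. (c j + (1 + pi) * r) / Im z)"
        unfolding h_def by (rule sum_norm_le)
      then show ?thesis by (simp add: sum_divide_distrib)
    qed
    then show ?thesis by blast
  qed
  \<comment> \<open>Bounds all heights, so that one constant \<open>c\<close> works for every
    \<open>k\<close>.\<close>
  obtain Y where Y: "\<And>k. y k \<le> Y"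
    using convergent_imp_Bseq[of y] y(2) unfolding convergent_def Bseq_def by (metis abs_le_D1 real_norm_def)
  have R: "AE t in lborel. t \<in> {-R<..<R} \<longrightarrow> (\<exists>C. \<exists>\<^sub>\<infinity>k. \<forall>j\<in>S. cmod (f j (Complex t (y k))) \<le> C)" if R: "R > 0" for R
  proof -
    obtain c where c: "\<And>z. Im z > 0 \<Longrightarrow> cmod z \<le> R + Y \<Longrightarrow> cmod (h z) \<le> c / Im z"
      using hbound by metis
    define u where "u = (\<lambda>k x. Re (h (Complex x (y k))) * (R\<^sup>2 - x\<^sup>2))"
    define g where "g = (\<lambda>k x. ennreal (u k x) * indicator {-R..R} x)"
    have sq: "0 \<le> R\<^sup>2 - x\<^sup>2" if "x \<in> {-R..R}" for x
      using that R by (simp add: abs_le_square_iff[symmetric] abs_le_iff)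
    have u0: "0 \<le> u k x" if "x \<in> {-R..R}" for k x
      unfolding u_def using sq[OF that] Reh0[of "Complex x (y k)"] y(1) by simp
    have Iu: "(u k has_integral Re (contour_integral (linepath (- of_real R) (of_real R)) (\<lambda>z. h (z + \<i> * y k) * (of_real (R\<^sup>2) - z\<^sup>2)))) {-R..R}"
      "cmod (contour_integral (linepath (- of_real R) (of_real R)) (\<lambda>z. h (z + \<i> * y k) * (of_real (R\<^sup>2) - z\<^sup>2))) \<le> 2 * c * R * R * pi" for k
      unfolding u_def by (rule half_disc_integral_bound[OF hol_h R y(1)]; use c Y[of k] in force)+
    have int: "(\<integral>\<^sup>+x. g k x \<partial>lborel) \<le> ennreal (2 * c * R * R * pi)" for k
    proof -
      have "(\<integral>\<^sup>+x. g k x \<partial>lborel) = ennreal (Re (contour_integral (linepath (- of_real R) (of_real R))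
          (\<lambda>z. h (z + \<i> * y k) * (of_real (R\<^sup>2) - z\<^sup>2))))"
        unfolding g_def by (rule nn_integral_has_integral_lebesgue'[OF u0 Iu(1)])
      also have "\<dots> \<le> ennreal (2 * c * R * R * pi)"
        by (rule ennreal_leI[OF order_trans[OF complex_Re_le_cmod Iu(2)]])
      finally show ?thesis .
    qed
    have meas: "g k \<in> borel_measurable lborel" for k
    proof -
      have "continuous_on UNIV (u k)"
        unfolding u_def
        by (intro continuous_intros continuous_on_compose2[OF holomorphic_on_imp_continuous_on[OF hol_h]])
          (use y(1) in \<open>auto simp: Complex_eq intro!: continuous_intros\<close>)
      then have "u k \<in> borel_measurable borel" by (rule borel_measurable_continuous_onI)
      then show ?thesis unfolding g_def by measurable
    qed
    have "AE t in lborel. \<exists>C::real. \<exists>\<^sub>\<infinity>k. g k t \<le> ennreal C"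
      by (rule AE_liminf_finite[OF meas int])
    then show ?thesis
    proof (rule AE_mp, intro AE_I2 impI)
      fix t assume "\<exists>C::real. \<exists>\<^sub>\<infinity>k. g k t \<le> ennreal C" and t: "t \<in> {-R<..<R}"
      then obtain C where C: "\<exists>\<^sub>\<infinity>k. g k t \<le> ennreal C" by blast
      \<comment> \<open>Since \<open>t\<close> lies strictly inside the interval, the weight is
        positive and can be divided out.\<close>
      have "0 < (R - t) * (R + t)" using t by simp
      then have w: "0 < R\<^sup>2 - t\<^sup>2" by (simp add: power2_eq_square algebra_simps)
      have "\<forall>j\<in>S. cmod (f j (Complex t (y k))) \<le> exp (max C 0 / (R\<^sup>2 - t\<^sup>2)) + 1" if k: "g k t \<le> ennreal C" for k
      proof
        fix j assume j: "j \<in> S"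
        \<comment> \<open>\<open>ennreal\<close> truncates a negative \<open>C\<close> to zero,
          hence the maximum.\<close>
        have "u k t \<le> max C 0"
          using k t unfolding g_def by (auto simp: ennreal_le_iff2 le_max_iff_disj)
        then have "Re (h (Complex t (y k))) \<le> max C 0 / (R\<^sup>2 - t\<^sup>2)"
          unfolding u_def using w by (simp add: pos_le_divide_eq)
        moreover have "ln (cmod (f j (Complex t (y k)) + \<i>)) \<le> Re (h (Complex t (y k)))"
          unfolding Reh[of "Complex t (y k)", simplified, OF y(1)]
          by (rule member_le_sum[OF j _ fin]) (use term0 y(1) in auto)
        ultimately have "exp (ln (cmod (f j (Complex t (y k)) + \<i>))) \<le> exp (max C 0 / (R\<^sup>2 - t\<^sup>2))" by simp
        then have "cmod (f j (Complex t (y k)) + \<i>) \<le> exp (max C 0 / (R\<^sup>2 - t\<^sup>2))"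
          using n1[OF j, of "Complex t (y k)"] y(1)[of k] by (subst (asm) exp_ln) auto
        moreover have "cmod (f j (Complex t (y k))) \<le> cmod (f j (Complex t (y k)) + \<i>) + 1"
          using norm_triangle_ineq4[of "f j (Complex t (y k)) + \<i>" \<i>] by simp
        ultimately show "cmod (f j (Complex t (y k))) \<le> exp (max C 0 / (R\<^sup>2 - t\<^sup>2)) + 1" by linarith
      qed
      then have "\<exists>\<^sub>\<infinity>k. \<forall>j\<in>S. cmod (f j (Complex t (y k))) \<le> exp (max C 0 / (R\<^sup>2 - t\<^sup>2)) + 1"
        by (rule INFM_mono[OF C])
      then show "\<exists>C. \<exists>\<^sub>\<infinity>k. \<forall>j\<in>S. cmod (f j (Complex t (y k))) \<le> C" by blast
    qed
  qed
  have "AE t in lborel. \<forall>n::nat. t \<in> {-real (Suc n)<..<real (Suc n)} \<longrightarrow> (\<exists>C. \<exists>\<^sub>\<infinity>k. \<forall>j\<in>S. cmod (f j (Complex t (y k))) \<le> C)"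
    unfolding AE_all_countable by (intro allI R) simp
  then show ?thesis
  proof (rule AE_mp, intro AE_I2 impI)
    fix t :: real
    assume *: "\<forall>n::nat. t \<in> {-real (Suc n)<..<real (Suc n)} \<longrightarrow> (\<exists>C. \<exists>\<^sub>\<infinity>k. \<forall>j\<in>S. cmod (f j (Complex t (y k))) \<le> C)"
    obtain n where "\<bar>t\<bar> < real n" using reals_Archimedean2 by blast
    then have "t \<in> {-real (Suc n)<..<real (Suc n)}" by auto
    then show "\<exists>C. \<exists>\<^sub>\<infinity>k. \<forall>j\<in>S. cmod (f j (Complex t (y k))) \<le> C" using * by blast
  qed
qed

lemma bounded_linear_cinner_right: "bounded_linear (cinner x)"
proof (rule bounded_linear_intro[where K = "norm x"])
  show "cinner x (r *\<^sub>R y) = r *\<^sub>R cinner x y" for r y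
    using cinner_scaleC_right[of x "complex_of_real r" y] by (simp add: scaleC_of_real scaleR_conv_of_real)
  show "norm (cinner x y) \<le> norm y * norm x" for y
    using norm_cinner_le[of x y] by (simp add: mult.commute)
qed (rule cinner_add_right)

section \<open>Resolvents of quadratic pencils\<close>

text \<open>With \<open>B = (1 + \<bar>H\<bar>)\<^sup>-\<^sup>1\<^sup>/\<^sup>2\<close> and \<open>A\<close> the bounded operator of the form of \<open>H\<close> pulled back along \<open>B\<close>,
  the pencil \<open>A - z B\<^sup>2\<close> stands for \<open>B (H - z) B\<close>.\<close>

locale pencil =
  fixes A B :: "'h::chilbert_space \<Rightarrow>\<^sub>L 'h"
  assumes A: "clinear_blinfun A" "symmetric_blinfun A"
    and B: "clinear_blinfun B" "symmetric_blinfun B"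
    and B_inj: "\<And>x. B x = 0 \<Longrightarrow> x = 0"
    and elliptic: "\<exists>a b. 0 \<le> a \<and> 0 \<le> b \<and> (\<forall>x. norm x \<le> a * norm (B x) + b * norm (A x))"
begin

definition pen :: "complex \<Rightarrow> 'h \<Rightarrow> 'h"
  where "pen z x = A x - z *\<^sub>C B (B x)"

lemma bounded_linear_pen: "bounded_linear (pen z)"
  unfolding pen_def
  by (intro bounded_linear_sub blinfun.bounded_linear_right
      bounded_linear_compose[OF bounded_linear_scaleC]
      bounded_linear_compose[OF blinfun.bounded_linear_right[of B]])

lemma pen_scaleC: "pen z (a *\<^sub>C x) = a *\<^sub>C pen z x"
  by (simp add: pen_def clinear_blinfunD[OF A(1)] clinear_blinfunD[OF B(1)] scaleC_diff_right scaleC_scaleC mult.commute)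

lemma cinner_pen_left: "cinner (pen z x) y = cinner x (pen (cnj z) y)"
  by (simp add: pen_def cinner_diff_left cinner_diff_right cinner_scaleC_left cinner_scaleC_right
      symmetric_cinner[OF A] symmetric_cinner[OF B])

lemma Im_cinner_pen: "Im (cinner x (pen z x)) = - Im z * (norm (B x))\<^sup>2"
proof -
  have "cinner x (A x) = cnj (cinner x (A x))"
    using symmetric_cinner[OF A, of x x] cinner_commute[of x "A x"] by simp
  then have "Im (cinner x (A x)) = 0" by (metis Im_complex_div_lemma Reals_cnj_iff complex_is_Real_iff)
  moreover have "cinner x (B (B x)) = complex_of_real ((norm (B x))\<^sup>2)"
    using symmetric_cinner[OF B, of x "B x"] cinner_self[of "B x"] by simp
  ultimately show ?thesis
    unfolding pen_def cinner_diff_right cinner_scaleC_right by simp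
qed

lemma pen_lower_bound:
  "\<exists>c\<ge>0. \<forall>z x. Im z \<noteq> 0 \<longrightarrow> cmod z \<le> r \<longrightarrow> norm x \<le> c / \<bar>Im z\<bar> * norm (pen z x)"
proof -
  obtain a b where ab: "0 \<le> a" "0 \<le> b" "\<And>x. norm x \<le> a * norm (B x) + b * norm (A x)"
    using elliptic by blast
  define \<alpha> where "\<alpha> = a + b * \<bar>r\<bar> * norm B"
  have \<alpha>: "\<alpha> \<ge> 0" unfolding \<alpha>_def using ab by simp
  have "norm x \<le> (\<alpha>\<^sup>2 + 2 * b * \<bar>r\<bar>) / \<bar>Im z\<bar> * norm (pen z x)" if z: "Im z \<noteq> 0" "cmod z \<le> r" for z x
  proof -
    define w where "w = norm (pen z x)"
    have "\<bar>Im (cinner x (pen z x))\<bar> \<le> norm x * w"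
      unfolding w_def using abs_Im_le_cmod norm_cinner_le order_trans by blast
    then have Bx: "(norm (B x))\<^sup>2 \<le> norm x * w / \<bar>Im z\<bar>"
      using z(1) unfolding Im_cinner_pen by (simp add: abs_mult pos_le_divide_eq mult.commute)
    have "norm (A x) = norm (pen z x + z *\<^sub>C B (B x))" by (simp add: pen_def)
    also have "\<dots> \<le> w + cmod z * norm (B (B x))"
      using norm_triangle_ineq[of "pen z x" "z *\<^sub>C B (B x)"] by (simp add: w_def norm_scaleC)
    also have "\<dots> \<le> w + \<bar>r\<bar> * (norm B * norm (B x))"
      using z(2) by (intro add_left_mono mult_mono norm_blinfun) auto
    finally have "b * norm (A x) \<le> b * (w + \<bar>r\<bar> * (norm B * norm (B x)))"
      using ab(2) by (rule mult_left_mono)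
    then have 1: "norm x \<le> \<alpha> * norm (B x) + b * w"
      using ab(3)[of x] unfolding \<alpha>_def by (simp add: algebra_simps)
    have amgm: "p * q \<le> ((p + q) / 2)\<^sup>2" for p q :: real
      using zero_le_power2[of "p - q"] by (simp add: power2_eq_square field_simps)
    \<comment> \<open>The inequality of arithmetic and geometric means leaves half of
      \<open>norm x\<close>, which moves to the left-hand side.\<close>
    have 2: "\<alpha> * norm (B x) \<le> (norm x + \<alpha>\<^sup>2 * w / \<bar>Im z\<bar>) / 2"
    proof (rule power2_le_imp_le)
      have "(\<alpha> * norm (B x))\<^sup>2 \<le> norm x * (\<alpha>\<^sup>2 * w / \<bar>Im z\<bar>)"
        using mult_left_mono[OF Bx, of "\<alpha>\<^sup>2"] by (simp add: power_mult_distrib mult_ac)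
      also have "\<dots> \<le> ((norm x + \<alpha>\<^sup>2 * w / \<bar>Im z\<bar>) / 2)\<^sup>2"
        by (rule amgm)
      finally show "(\<alpha> * norm (B x))\<^sup>2 \<le> ((norm x + \<alpha>\<^sup>2 * w / \<bar>Im z\<bar>) / 2)\<^sup>2" .
    qed (simp add: w_def)
    have "norm x \<le> \<alpha>\<^sup>2 * w / \<bar>Im z\<bar> + 2 * b * w" using 1 2 by (simp add: field_simps)
    also have "2 * b * w \<le> 2 * b * w * (\<bar>r\<bar> / \<bar>Im z\<bar>)"
    proof -
      have "\<bar>Im z\<bar> \<le> \<bar>r\<bar>" using z(2) abs_Im_le_cmod[of z] by linarith
      then have "1 \<le> \<bar>r\<bar> / \<bar>Im z\<bar>" using z(1) by (simp add: pos_le_divide_eq)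
      then have "2 * b * w * 1 \<le> 2 * b * w * (\<bar>r\<bar> / \<bar>Im z\<bar>)"
        using ab(2) by (intro mult_left_mono) (simp_all add: w_def)
      then show ?thesis by simp
    qed
    finally show ?thesis by (simp add: w_def add_divide_distrib algebra_simps)
  qed
  then show ?thesis using ab \<alpha> by (intro exI[of _ "\<alpha>\<^sup>2 + 2 * b * \<bar>r\<bar>"]) auto
qed

lemma pen_inj: "Im z \<noteq> 0 \<Longrightarrow> pen z x = 0 \<Longrightarrow> x = 0"
  using Im_cinner_pen[of x z] B_inj by simp

text \<open>The adjoint of the pencil at \<open>z\<close> is the pencil at \<open>cnj z\<close>,
  whose injectivity makes the range at \<open>z\<close> dense.\<close>

lemma inverse_exists:
  assumes "Im z \<noteq> 0"
  shows "\<exists>M :: 'h \<Rightarrow>\<^sub>L 'h. \<forall>x. pen z (M x) = x \<and> M (pen z x) = x"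
proof -
  obtain c where c: "\<And>x. norm x \<le> c / \<bar>Im z\<bar> * norm (pen z x)"
    using pen_lower_bound[of "cmod z"] assms by blast
  define P where "P = Blinfun (pen z)"
  have P: "P x = pen z x" for x by (simp add: P_def bounded_linear_Blinfun_apply bounded_linear_pen)
  obtain M :: "'h \<Rightarrow>\<^sub>L 'h" where "\<And>x. P (M x) = x" "\<And>x. M (P x) = x"
  proof (rule bounded_below_blinfun_inverse[of "c / \<bar>Im z\<bar>" P])
    fix y assume *: "\<And>x. inner y (P x) = 0"
    have "inner (pen (cnj z) y) x = 0" for x
      using *[of x] cinner_pen_left[of "cnj z" y x] by (simp add: P flip: Re_cinner)
    then have "pen (cnj z) y = 0" by (metis inner_eq_zero_iff)
    then show "y = 0" using pen_inj[of "cnj z"] assms by simp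
  qed (use c in \<open>auto simp: P\<close>)
  then show ?thesis by (auto simp: P)
qed

text \<open>Plays the role of
  \<open>B\<^sup>-\<^sup>1 (H - z)\<^sup>-\<^sup>1 B\<^sup>-\<^sup>1\<close>. For non-real
  \<open>z\<close> the inverse is unique; at real \<open>z\<close> the choice carries no
  information.\<close>

definition res :: "complex \<Rightarrow> 'h \<Rightarrow>\<^sub>L 'h"
  where "res z = (SOME M. \<forall>x. pen z (blinfun_apply M x) = x \<and> M (pen z x) = x)"

lemma pen_res: "Im z \<noteq> 0 \<Longrightarrow> pen z (res z x) = x"
  and res_pen: "Im z \<noteq> 0 \<Longrightarrow> res z (pen z x) = x"
  unfolding res_def using someI_ex[OF inverse_exists] by blast+

lemma res_eqI: "Im z \<noteq> 0 \<Longrightarrow> pen z x = y \<Longrightarrow> res z y = x"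
  using res_pen by blast

lemma norm_res_le:
  "\<exists>c\<ge>0. \<forall>z x. Im z \<noteq> 0 \<longrightarrow> cmod z \<le> r \<longrightarrow> norm (res z x) \<le> c / \<bar>Im z\<bar> * norm x"
  using pen_lower_bound[of r] by (metis pen_res)

lemma res_scaleC: "Im z \<noteq> 0 \<Longrightarrow> res z (a *\<^sub>C x) = a *\<^sub>C res z x"
  by (rule res_eqI) (simp_all add: pen_scaleC pen_res)

lemma res_diff:
  assumes "Im z \<noteq> 0" "Im w \<noteq> 0"
  shows "res z x - res w x = (z - w) *\<^sub>C res z (B (B (res w x)))"
proof -
  have "pen z (res w x) = x - (z - w) *\<^sub>C B (B (res w x))"
    using pen_res[OF assms(2), of x] unfolding pen_def by (simp add: scaleC_diff_left algebra_simps)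
  then have "res w x = res z (x - (z - w) *\<^sub>C B (B (res w x)))"
    using res_pen[OF assms(1)] by metis
  then show ?thesis by (simp add: blinfun.diff_right res_scaleC[OF assms(1)] algebra_simps)
qed

lemma res_tendsto:
  assumes w: "Im w > 0"
  shows "((\<lambda>z. res z x) \<longlongrightarrow> res w x) (at w)"
proof -
  obtain c where c: "0 \<le> c" "\<And>z x. Im z \<noteq> 0 \<Longrightarrow> cmod z \<le> cmod w + 1 \<Longrightarrow> norm (res z x) \<le> c / \<bar>Im z\<bar> * norm x"
    using norm_res_le[of "cmod w + 1"] by blast
  define K where "K = c / (Im w / 2) * norm (B (B (res w x)))"
  have near: "\<forall>\<^sub>F z in at w. dist z w < min 1 (Im w / 2)"
    unfolding eventually_at using w by (intro exI[of _ "min 1 (Im w / 2)"]) auto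
  have "((\<lambda>z. res z x - res w x) \<longlongrightarrow> 0) (at w)"
  proof (rule Lim_null_comparison)
    show "\<forall>\<^sub>F z in at w. norm (res z x - res w x) \<le> cmod (z - w) * K"
      using near
    proof eventually_elim
      case (elim z)
      have "\<bar>Im z - Im w\<bar> < Im w / 2" using elim abs_Im_le_cmod[of "z - w"] by (simp add: dist_norm)
      then have Imz: "Im z > Im w / 2" by arith
      have "cmod z \<le> cmod w + 1" using elim norm_triangle_sub[of z w] by (simp add: dist_norm)
      then have "norm (res z (B (B (res w x)))) \<le> c / \<bar>Im z\<bar> * norm (B (B (res w x)))"
        using c(2)[of z] Imz w by simp
      also have "\<dots> \<le> K"
        unfolding K_def using Imz w c(1) by (intro mult_right_mono divide_left_mono) auto
      finally show ?case
        using Imz w by (subst res_diff) (auto simp: norm_scaleC intro: mult_left_mono)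
    qed
    have "((\<lambda>z. cmod (z - w) * K) \<longlongrightarrow> cmod (w - w) * K) (at w)" by (intro tendsto_intros)
    then show "((\<lambda>z. cmod (z - w) * K) \<longlongrightarrow> 0) (at w)" by simp
  qed
  then show ?thesis using Lim_null by blast
qed

text \<open>The resolvent identity turns the difference quotient into
  \<open>cinner x (res z v)\<close>, which converges as \<open>z\<close> tends to
  \<open>w\<close>.\<close>

lemma holomorphic_cinner_res: "(\<lambda>z. cinner x (res z x)) holomorphic_on {z. Im z > 0}"
proof (subst holomorphic_on_open)
  show "open {z. Im z > 0}" by (rule open_halfspace_Im_gt)
  show "\<forall>w\<in>{z. Im z > 0}. \<exists>f'. ((\<lambda>z. cinner x (res z x)) has_field_derivative f') (at w)"
  proof
    fix w assume "w \<in> {z. Im z > 0}"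
    then have w: "Im w > 0" by simp
    define v where "v = B (B (res w x))"
    have "((\<lambda>z. cinner x (res z v)) \<longlongrightarrow> cinner x (res w v)) (at w)"
      by (rule bounded_linear.tendsto[OF bounded_linear_cinner_right res_tendsto[OF w]])
    moreover have "\<forall>\<^sub>F z in at w. cinner x (res z v) = (cinner x (res z x) - cinner x (res w x)) / (z - w)"
    proof -
      have "\<forall>\<^sub>F z in at w. z \<in> {z. Im z > 0}"
        using w by (intro eventually_at_in_open'[OF open_halfspace_Im_gt]) simp
      moreover have "\<forall>\<^sub>F z in at w. z \<noteq> w" by (rule eventually_neq_at_within)
      ultimately show ?thesis
      proof eventually_elim
        case (elim z)
        then have "cinner x (res z x) - cinner x (res w x) = (z - w) * cinner x (res z v)"
          using res_diff[of z w x] w by (simp add: v_def cinner_scaleC_right flip: cinner_diff_right)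
        then show ?case using elim by simp
      qed
    qed
    ultimately have "((\<lambda>z. (cinner x (res z x) - cinner x (res w x)) / (z - w)) \<longlongrightarrow> cinner x (res w v)) (at w)"
      by (rule Lim_transform_eventually)
    then show "\<exists>f'. ((\<lambda>z. cinner x (res z x)) has_field_derivative f') (at w)"
      unfolding has_field_derivative_iff by blast
  qed
qed

lemma Im_cinner_res:
  assumes "Im z > 0"
  shows "Im (cinner x (res z x)) \<ge> 0"
proof -
  have "cinner x (res z x) = cnj (cinner (res z x) (pen z (res z x)))"
    using assms cinner_commute[of x "res z x"] by (simp add: pen_res)
  then have "Im (cinner x (res z x)) = Im z * (norm (B (res z x)))\<^sup>2"
    using Im_cinner_pen[of "res z x" z] by simp
  then show ?thesis using assms by simp
qed

lemma AE_res_bounded: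
  assumes fin: "finite S" and y: "\<And>k. 0 < y k" "y \<longlonglongrightarrow> 0"
  shows "AE t in lborel. \<exists>C. \<exists>\<^sub>\<infinity>k. \<forall>x\<in>S. cmod (cinner x (res (Complex t (y k)) x)) \<le> C"
proof (rule herglotz_bounded_infinitely_often[OF fin holomorphic_cinner_res Im_cinner_res _ y])
  fix x r
  obtain c where c: "0 \<le> c" "\<And>z x. Im z \<noteq> 0 \<Longrightarrow> cmod z \<le> r \<Longrightarrow> norm (res z x) \<le> c / \<bar>Im z\<bar> * norm x"
    using norm_res_le[of r] by blast
  have "cmod (cinner x (res z x)) \<le> norm x * (c * norm x) / Im z" if "Im z > 0" "cmod z \<le> r" for z
  proof -
    have "cmod (cinner x (res z x)) \<le> norm x * norm (res z x)" by (rule norm_cinner_le)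
    also have "\<dots> \<le> norm x * (c / \<bar>Im z\<bar> * norm x)" using c(2)[of z x] that by (intro mult_left_mono) auto
    finally show ?thesis using that by simp
  qed
  then show "\<exists>c. \<forall>z. Im z > 0 \<longrightarrow> cmod z \<le> r \<longrightarrow> cmod (cinner x (res z x)) \<le> c / Im z" by blast
qed

text \<open>Only diagonal elements of \<open>res\<close> are known to be Herglotz functions; this
  reduces the off-diagonal ones to four of them.\<close>

lemma cinner_res_polarization:
  assumes "Im z \<noteq> 0"
  shows "4 * cmod (cinner x (res z v)) \<le> cmod (cinner (x + v) (res z (x + v))) + cmod (cinner (x - v) (res z (x - v)))
    + cmod (cinner (x + \<i> *\<^sub>C v) (res z (x + \<i> *\<^sub>C v))) + cmod (cinner (x - \<i> *\<^sub>C v) (res z (x - \<i> *\<^sub>C v)))"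
proof -
  define q where "q = (\<lambda>u. cinner u (res z u))"
  have "4 * cinner x (res z v) = q (x + v) - q (x - v) - \<i> * q (x + \<i> *\<^sub>C v) + \<i> * q (x - \<i> *\<^sub>C v)"
    unfolding q_def
    by (simp add: blinfun.add_right blinfun.diff_right res_scaleC[OF assms] cinner_add_left cinner_add_right
        cinner_diff_left cinner_diff_right cinner_scaleC_left cinner_scaleC_right algebra_simps)
  then have "4 * cmod (cinner x (res z v)) = cmod (q (x + v) - q (x - v) - \<i> * q (x + \<i> *\<^sub>C v) + \<i> * q (x - \<i> *\<^sub>C v))"
    by (metis norm_mult norm_numeral)
  also have "\<dots> \<le> cmod (q (x + v)) + cmod (q (x - v)) + cmod (\<i> * q (x + \<i> *\<^sub>C v)) + cmod (\<i> * q (x - \<i> *\<^sub>C v))"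
    by (intro order_trans[OF norm_triangle_ineq] order_trans[OF norm_triangle_ineq4] add_mono order_refl)
  finally show ?thesis unfolding q_def by (simp add: norm_mult)
qed

end

section \<open>Compact operators\<close>

text \<open>Ehrling's inequality: on a bounded sequence with \<open>B x\<^sub>n \<rightarrow> 0\<close>, which tends weakly to \<open>0\<close>, the
  compact operator \<open>G\<close> tends to \<open>0\<close> in norm.\<close>

lemma ehrling:
  fixes G :: "'a::{real_inner,banach} \<Rightarrow>\<^sub>L 'b::{real_inner,banach}" and B :: "'a \<Rightarrow>\<^sub>L 'a"
  assumes G: "compact (closure (G ` cball 0 1))"
    and B: "symmetric_blinfun B" "\<And>x. B x = 0 \<Longrightarrow> x = 0" and e: "e > 0"
  obtains C where "0 \<le> C" "\<And>x. norm (G x) \<le> e * norm x + C * norm (B x)"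
proof (rule ccontr)
  assume "\<not> thesis"
  then have "\<exists>x. norm (G x) > e * norm x + real n * norm (B x)" for n
    using that[of "real n"] by (meson not_le of_nat_0_le_iff)
  then obtain u where u: "\<And>n. norm (G (u n)) > e * norm (u n) + real n * norm (B (u n))" by metis
  have u0: "u n \<noteq> 0" for n using u[of n] by (auto simp: blinfun.zero_right)
  define x where "x = (\<lambda>n. u n /\<^sub>R norm (u n))"
  have nx: "norm (x n) = 1" for n using u0 by (simp add: x_def)
  have x: "norm (G (x n)) > e + real n * norm (B (x n))" for n
  proof -
    have "(e * norm (u n) + real n * norm (B (u n))) / norm (u n) < norm (G (u n)) / norm (u n)"
      using u[of n] u0[of n] by (intro divide_strict_right_mono) auto
    then show ?thesis using u0[of n] by (simp add: x_def blinfun.scaleR_right field_simps)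
  qed
  have "G (x n) \<in> closure (G ` cball 0 1)" for n
    using nx closure_subset[of "G ` cball 0 1"] by (auto simp: subset_iff)
  then have "\<forall>n. ((\<lambda>n. G (x n)) n) \<in> closure (G ` cball 0 1)" by simp
  then obtain g r where r: "strict_mono r" "(\<lambda>n. G (x (r n))) \<longlonglongrightarrow> g"
    using G[unfolded compact_def, rule_format, of "\<lambda>n. G (x n)"] unfolding o_def by blast
  obtain Gs :: "'b \<Rightarrow>\<^sub>L 'a" where Gs: "\<And>x y. inner (Gs y) x = inner y (G x)"
    by (rule adjoint_blinfun_exists[of G]) (rule that)
  have Bx: "(\<lambda>n. B (x n)) \<longlonglongrightarrow> 0"
  proof (rule Lim_null_comparison)
    show "\<forall>\<^sub>F n in sequentially. norm (B (x n)) \<le> norm G / real n"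
    proof (rule eventually_sequentiallyI)
      fix n :: nat assume n: "n \<ge> 1"
      have "real n * norm (B (x n)) \<le> norm G" using x[of n] norm_blinfun[of G "x n"] nx[of n] e by simp
      then show "norm (B (x n)) \<le> norm G / real n" using n by (simp add: pos_le_divide_eq mult.commute)
    qed
    show "(\<lambda>n. norm G / real n) \<longlonglongrightarrow> 0" by (rule lim_const_over_n)
  qed
  \<comment> \<open>It is enough to approximate \<open>w\<close> from the dense range of
    \<open>B\<close>, because \<open>B\<close> can be moved onto \<open>x n\<close>.\<close>
  have weak: "(\<lambda>n. inner (x n) w) \<longlonglongrightarrow> 0" for w
  proof (rule LIMSEQ_I)
    fix d :: real assume d: "d > 0"
    have "w \<in> closure (range B)" using symmetric_injective_dense_range[OF B] by simp
    then obtain v where v: "norm (w - B v) < d / 2"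
      using d unfolding closure_approachable by (auto simp: dist_norm norm_minus_commute dest!: spec[of _ "d / 2"])
    have "(\<lambda>n. inner (B (x n)) v) \<longlonglongrightarrow> inner 0 v" by (intro tendsto_intros Bx)
    then obtain N where N: "\<And>n. n \<ge> N \<Longrightarrow> norm (inner (B (x n)) v) < d / 2"
      using LIMSEQ_D[of _ "inner 0 v" "d / 2"] d by auto
    show "\<exists>N. \<forall>n\<ge>N. norm (inner (x n) w - 0) < d"
    proof (intro exI allI impI)
      fix n assume "n \<ge> N"
      have "inner (x n) w = inner (x n) (w - B v) + inner (B (x n)) v"
        using symmetric_blinfunD[OF B(1), of "x n" v] by (simp add: inner_diff_right)
      moreover have "\<bar>inner (x n) (w - B v)\<bar> < d / 2"
        using Cauchy_Schwarz_ineq2[of "x n" "w - B v"] nx[of n] v by simp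
      ultimately show "norm (inner (x n) w - 0) < d" using N[OF \<open>n \<ge> N\<close>] by simp
    qed
  qed
  \<comment> \<open>The norm limit \<open>g\<close> of the images must agree with their weak limit
    zero.\<close>
  have "(\<lambda>n. inner g (G (x (r n)))) \<longlonglongrightarrow> inner g g" by (intro tendsto_intros r)
  moreover have "(\<lambda>n. inner g (G (x (r n)))) \<longlonglongrightarrow> 0"
    using LIMSEQ_subseq_LIMSEQ[OF weak[of "Gs g"] r(1)] by (simp add: o_def inner_commute[of _ "Gs g"] Gs)
  ultimately have "g = 0" using LIMSEQ_unique by (metis inner_eq_zero_iff)
  then have "(\<lambda>n. norm (G (x (r n)))) \<longlonglongrightarrow> 0" using tendsto_norm[OF r(2)] by simp
  moreover have "e \<le> norm (G (x (r n)))" for n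
    using x[of "r n"] by (smt (verit) mult_nonneg_nonneg norm_ge_zero of_nat_0_le_iff)
  ultimately have "e \<le> 0" by (intro LIMSEQ_le_const) auto
  then show False using e by simp
qed

text \<open>For finite pairwise orthogonal \<open>S\<close> this is the orthogonal projection onto
  the real span, so that matrix elements are real. The vectors are not normalized, and a zero vector
  contributes nothing.\<close>

definition span_projection :: "'a::real_inner set \<Rightarrow> 'a \<Rightarrow> 'a"
  where "span_projection S x = (\<Sum>c\<in>S. (inner c x / inner c c) *\<^sub>R c)"

lemma bounded_linear_span_projection: "bounded_linear (span_projection S)"
  unfolding span_projection_def
  by (intro bounded_linear_sum bounded_linear_compose[OF bounded_linear_scaleR_left]
      bounded_linear_divide bounded_linear_compose[OF bounded_linear_divide] bounded_linear_inner_right)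

lemma span_projection_in_span: "span_projection S x \<in> span S"
  unfolding span_projection_def by (intro span_sum span_scale span_base)

lemma span_projection_orthogonal:
  assumes S: "finite S" "pairwise orthogonal S" and s: "s \<in> span S"
  shows "inner (x - span_projection S x) s = 0"
  using s
proof (induction rule: span_induct)
  case base
  show ?case unfolding subspace_def by (auto simp: inner_add_right)
next
  case (step s)
  have "inner (span_projection S x) s = (\<Sum>c\<in>S. inner c x / inner c c * inner c s)"
    unfolding span_projection_def by (simp add: inner_sum_left)
  also have "\<dots> = (\<Sum>c\<in>S. if c = s then inner s x else 0)"
    by (rule sum.cong) (use S(2) step in \<open>auto simp: pairwise_def orthogonal_def\<close>)
  also have "\<dots> = inner s x" using S(1) step by simp
  finally show ?case by (simp add: inner_diff_left inner_diff_right inner_commute)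
qed

lemma norm_diff_span_projection_le:
  assumes S: "finite S" "pairwise orthogonal S" and s: "s \<in> span S"
  shows "norm (x - span_projection S x) \<le> norm (x - s)"
proof -
  have "span_projection S x - s \<in> span S" by (intro span_diff span_projection_in_span s)
  then have "inner (x - span_projection S x) (span_projection S x - s) = 0"
    by (rule span_projection_orthogonal[OF S])
  then have "(norm (x - s))\<^sup>2 = (norm (x - span_projection S x))\<^sup>2 + (norm (span_projection S x - s))\<^sup>2"
    unfolding power2_norm_eq_inner by (simp add: inner_diff_left inner_diff_right inner_commute)
  then have "(norm (x - span_projection S x))\<^sup>2 \<le> (norm (x - s))\<^sup>2" using zero_le_power2 by (metis le_add_same_cancel1)
  then show ?thesis by (rule power2_le_imp_le) simp
qed

lemma span_projection_id:
  assumes "finite S" "pairwise orthogonal S" "s \<in> span S"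
  shows "span_projection S s = s"
  using norm_diff_span_projection_le[OF assms, of s] by simp

lemma norm_span_projection_le:
  assumes S: "finite S" "pairwise orthogonal S"
  shows "norm (span_projection S x) \<le> norm x"
proof -
  have "inner (x - span_projection S x) (span_projection S x) = 0"
    by (rule span_projection_orthogonal[OF S span_projection_in_span])
  then have "(norm x)\<^sup>2 = (norm (x - span_projection S x))\<^sup>2 + (norm (span_projection S x))\<^sup>2"
    unfolding power2_norm_eq_inner by (simp add: inner_diff_left inner_diff_right inner_commute)
  then have "(norm (span_projection S x))\<^sup>2 \<le> (norm x)\<^sup>2" using zero_le_power2 by (metis le_add_same_cancel2)
  then show ?thesis by (rule power2_le_imp_le) simp
qed

text \<open>Take a finite \<open>e\<close>-net of the image of the unit ball and orthogonalize it:
  the projection onto its span is at least as close to \<open>G x\<close> as the nearest point of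
  the net.\<close>

lemma compact_finite_rank_approximation:
  fixes G :: "'a::real_normed_vector \<Rightarrow>\<^sub>L 'b::real_inner"
  assumes G: "compact (closure (G ` cball 0 1))" and e: "e > 0"
  obtains S where "finite S" "pairwise orthogonal S" "\<And>x. norm (G x - span_projection S (G x)) \<le> e * norm x"
proof -
  obtain N where N: "finite N" "closure (G ` cball 0 1) \<subseteq> (\<Union>s\<in>N. ball s e)"
    using G e unfolding compact_eq_totally_bounded by blast
  obtain S where S: "finite S" "span S = span N" "pairwise orthogonal S"
    using basis_orthogonal[OF N(1)] by blast
  have 1: "norm (G x - span_projection S (G x)) \<le> e" if "norm x \<le> 1" for x
  proof -
    have "G x \<in> closure (G ` cball 0 1)" using that closure_subset[of "G ` cball 0 1"] by (auto simp: subset_iff)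
    then obtain s where s: "s \<in> N" "dist s (G x) < e" using N(2) by auto
    then have "norm (G x - span_projection S (G x)) \<le> norm (G x - s)"
      by (intro norm_diff_span_projection_le S) (simp add: S(2) span_base)
    then show ?thesis using s(2) by (simp add: dist_norm norm_minus_commute)
  qed
  interpret P: bounded_linear "span_projection S" by (rule bounded_linear_span_projection)
  show ?thesis
  proof (rule that[OF S(1,3)])
    fix x
    show "norm (G x - span_projection S (G x)) \<le> e * norm x"
    proof (cases "x = 0")
      case False
      have "norm (G (x /\<^sub>R norm x) - span_projection S (G (x /\<^sub>R norm x))) \<le> e"
        using False by (intro 1) simp
      also have "G (x /\<^sub>R norm x) - span_projection S (G (x /\<^sub>R norm x)) = (G x - span_projection S (G x)) /\<^sub>R norm x"
        by (simp add: blinfun.scaleR_right P.scaleR scaleR_right_diff_distrib)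
      finally have "norm (G x - span_projection S (G x)) / norm x \<le> e"
        unfolding norm_scaleR by (simp add: divide_inverse mult.commute)
      then show ?thesis using False by (simp add: pos_divide_le_eq)
    qed (simp add: blinfun.zero_right P.zero)
  qed
qed

section \<open>Norm limits of sandwiched resolvents\<close>

lemma neumann_solution:
  fixes K :: "'a::banach \<Rightarrow>\<^sub>L 'a"
  assumes K: "norm K \<le> 1/2"
  obtains g where "g + K g = v" "norm g \<le> 2 * norm v"
proof -
  have "\<exists>!g. v - K g = g"
  proof (rule banach_fix_type[of "1/2"])
    show "\<forall>x y. dist (v - K x) (v - K y) \<le> 1/2 * dist x y"
    proof (intro allI)
      fix x y
      have "dist (v - K x) (v - K y) = norm (K (y - x))"
        by (simp add: dist_norm blinfun.diff_right norm_minus_commute)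
      also have "\<dots> \<le> norm K * norm (y - x)" by (rule norm_blinfun)
      also have "\<dots> \<le> 1/2 * norm (y - x)" using K by (intro mult_right_mono) auto
      finally show "dist (v - K x) (v - K y) \<le> 1/2 * dist x y" by (simp add: dist_norm norm_minus_commute)
    qed
  qed auto
  then obtain g where g: "v - K g = g" by blast
  then have "norm g \<le> norm v + norm (K g)" using norm_triangle_ineq4[of v "K g"] by simp
  also have "norm (K g) \<le> 1/2 * norm g"
    using norm_blinfun[of K g] mult_right_mono[OF K norm_ge_zero[of g]] by linarith
  finally have "norm g \<le> 2 * norm v" by simp
  moreover have "g + K g = v" using g by (simp add: algebra_simps)
  ultimately show ?thesis using that by blast
qed

text \<open>On the range of \<open>P\<close> the inverse of the finite-dimensional Schur complement of \<open>1 + T J\<close> is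
  \<open>P (1 - T\<^sub>1 J) P\<close>, so finitely many matrix elements of \<open>T\<^sub>1\<close> control \<open>(1 + T J)\<^sup>-\<^sup>1\<close>.\<close>

lemma one_plus_lower_bound:
  fixes T T1 J :: "'k::{real_inner,banach} \<Rightarrow>\<^sub>L 'k"
  assumes T: "\<And>x. T x = T1 x + T1 (J (T x))"
    and S: "finite S" "pairwise orthogonal S"
    and Q: "\<And>x. norm (T (J x) - span_projection S (T (J x))) \<le> 1/2 * norm x"
    and \<tau>: "\<And>x. norm (T (J x)) \<le> \<tau> * norm x" "0 \<le> \<tau>"
    and C: "\<And>a b. a \<in> S \<Longrightarrow> b \<in> S \<Longrightarrow> \<bar>inner a (T1 (J b))\<bar> \<le> C" "0 \<le> C"
  defines "D \<equiv> \<Sum>a\<in>S. \<Sum>b\<in>S. norm b / inner b b * (norm a / inner a a)"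
  shows "norm x \<le> (2 + 4 * (1 + C * D) * \<tau>) * norm (x + T (J x))"
proof -
  interpret P: bounded_linear "span_projection S" by (rule bounded_linear_span_projection)
  define v where "v = x + T (J x)"
  \<comment> \<open>\<open>K\<close> is the small part \<open>(1 - P) T J\<close>, with
    \<open>P\<close> the projection, so \<open>1 + K\<close> is inverted by contraction.\<close>
  define K where "K = Blinfun (\<lambda>x. T (J x) - span_projection S (T (J x)))"
  have "bounded_linear (\<lambda>x. T (J x) - span_projection S (T (J x)))"
    by (intro bounded_linear_sub bounded_linear_compose[OF P.bounded_linear_axioms]
        bounded_linear_compose[OF blinfun.bounded_linear_right[of T]] blinfun.bounded_linear_right)
  then have K: "K x = T (J x) - span_projection S (T (J x))" for x
    unfolding K_def by (simp add: bounded_linear_Blinfun_apply)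
  have "norm K \<le> 1/2" by (rule norm_blinfun_bound) (use Q in \<open>simp_all add: K\<close>)
  then obtain g where g: "g + K g = v" "norm g \<le> 2 * norm v" by (rule neumann_solution)
  \<comment> \<open>After subtracting \<open>g\<close>, the remaining defect
    \<open>(1 + T J) x' = - P T J g\<close> lies in the finite-dimensional range of the
    projection.\<close>
  define x' where "x' = x - g"
  define p where "p = - span_projection S (T (J g))"
  have x'p: "x' + T (J x') = p"
    using g(1) unfolding x'_def p_def v_def K by (simp add: blinfun.diff_right algebra_simps)
  have pS: "p \<in> span S" unfolding p_def by (intro span_neg span_projection_in_span)
  have Pp: "span_projection S p = p" by (rule span_projection_id[OF S pS])
  have np: "norm p \<le> \<tau> * (2 * norm v)"
  proof -
    have "norm p \<le> norm (T (J g))" unfolding p_def using norm_span_projection_le[OF S] by simp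
    also have "\<dots> \<le> \<tau> * norm g" by (rule \<tau>(1))
    also have "\<dots> \<le> \<tau> * (2 * norm v)" using g(2) \<tau>(2) by (rule mult_left_mono)
    finally show ?thesis .
  qed
  \<comment> \<open>This is \<open>(1 - T1 J) (1 + T J) = 1\<close>, a consequence of the resolvent
    identity \<open>T\<close>.\<close>
  have x'eq: "x' = p - T1 (J p)"
  proof -
    have "T1 (J p) = T1 (J x') + T1 (J (T (J x')))" unfolding x'p[symmetric] by (simp add: blinfun.add_right)
    also have "\<dots> = T (J x')" using T[of "J x'"] by simp
    finally show ?thesis using x'p by (simp add: algebra_simps)
  qed
  have PT: "norm (span_projection S (T1 (J p))) \<le> C * D * norm p"
  proof -
    have "inner a (T1 (J p)) = (\<Sum>b\<in>S. inner b p / inner b b * inner a (T1 (J b)))" for a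
    proof -
      have "inner a (T1 (J p)) = inner a (T1 (J (span_projection S p)))" by (simp add: Pp)
      also have "\<dots> = (\<Sum>b\<in>S. inner b p / inner b b * inner a (T1 (J b)))"
        unfolding span_projection_def by (simp add: blinfun.sum_right blinfun.scaleR_right inner_sum_right)
      finally show ?thesis .
    qed
    moreover have "\<bar>\<Sum>b\<in>S. inner b p / inner b b * inner a (T1 (J b))\<bar> \<le> (\<Sum>b\<in>S. norm b * norm p / inner b b * C)"
      if "a \<in> S" for a
    proof (rule order_trans[OF sum_abs sum_mono])
      fix b assume b: "b \<in> S"
      have "\<bar>inner b p / inner b b * inner a (T1 (J b))\<bar> = \<bar>inner b p\<bar> / inner b b * \<bar>inner a (T1 (J b))\<bar>"
        by (simp add: abs_mult)
      also have "\<dots> \<le> norm b * norm p / inner b b * C"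
        using C that b by (intro mult_mono divide_right_mono Cauchy_Schwarz_ineq2) auto
      finally show "\<bar>inner b p / inner b b * inner a (T1 (J b))\<bar> \<le> norm b * norm p / inner b b * C" .
    qed
    ultimately have *: "\<bar>inner a (T1 (J p))\<bar> \<le> (\<Sum>b\<in>S. norm b * norm p / inner b b * C)" if "a \<in> S" for a
      using that by simp
    have "norm (span_projection S (T1 (J p))) \<le> (\<Sum>a\<in>S. norm ((inner a (T1 (J p)) / inner a a) *\<^sub>R a))"
      unfolding span_projection_def by (rule norm_sum)
    also have "\<dots> \<le> (\<Sum>a\<in>S. (\<Sum>b\<in>S. norm b * norm p / inner b b * C) * (norm a / inner a a))"
    proof (rule sum_mono)
      fix a assume a: "a \<in> S"
      have "norm ((inner a (T1 (J p)) / inner a a) *\<^sub>R a) = \<bar>inner a (T1 (J p))\<bar> * (norm a / inner a a)" by simp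
      also have "\<dots> \<le> (\<Sum>b\<in>S. norm b * norm p / inner b b * C) * (norm a / inner a a)"
        using *[OF a] by (intro mult_right_mono) auto
      finally show "norm ((inner a (T1 (J p)) / inner a a) *\<^sub>R a) \<le> (\<Sum>b\<in>S. norm b * norm p / inner b b * C) * (norm a / inner a a)" .
    qed
    also have "\<dots> = C * D * norm p"
      unfolding D_def by (simp add: sum_distrib_left sum_distrib_right mult_ac)
    finally show ?thesis .
  qed
  have Px': "norm (span_projection S x') \<le> (1 + C * D) * norm p"
  proof -
    have "span_projection S x' = p - span_projection S (T1 (J p))" unfolding x'eq by (simp add: P.diff Pp)
    then have "norm (span_projection S x') \<le> norm p + norm (span_projection S (T1 (J p)))"
      using norm_triangle_ineq4 by metis
    then show ?thesis using PT by (simp add: algebra_simps)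
  qed
  \<comment> \<open>As \<open>p\<close> is fixed by the projection, the complementary part of
    \<open>x'\<close> is that of \<open>- T (J x')\<close>, at most half of \<open>x'\<close>; hence
    \<open>norm x'\<close> is at most twice the norm of its projection.\<close>
  have Qx': "norm (x' - span_projection S x') \<le> 1/2 * norm x'"
  proof -
    have x'T: "x' = p - T (J x')" using x'p by (simp add: algebra_simps)
    have "span_projection S x' = p - span_projection S (T (J x'))"
      using P.diff[of p "T (J x')"] Pp x'T by simp
    then have "x' - span_projection S x' = - (T (J x') - span_projection S (T (J x')))"
      using x'T by (simp add: algebra_simps)
    then show ?thesis using Q[of x'] by (metis norm_minus_cancel)
  qed
  have "norm x' \<le> norm (span_projection S x') + norm (x' - span_projection S x')"
    using norm_triangle_ineq[of "span_projection S x'" "x' - span_projection S x'"] by simp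
  then have "norm x' \<le> 2 * ((1 + C * D) * norm p)" using Px' Qx' by linarith
  also have "\<dots> \<le> 2 * ((1 + C * D) * (\<tau> * (2 * norm v)))"
  proof -
    have "0 \<le> D" unfolding D_def by (intro sum_nonneg mult_nonneg_nonneg) auto
    then show ?thesis using np C(2) by (intro mult_left_mono) auto
  qed
  finally have "norm x' \<le> 4 * (1 + C * D) * \<tau> * norm v" by (simp add: algebra_simps)
  moreover have "norm x \<le> norm g + norm x'" using norm_triangle_ineq[of g x'] by (simp add: x'_def)
  ultimately show ?thesis using g(2) unfolding v_def by (simp add: algebra_simps)
qed

text \<open>The projection is chosen for one \<open>T y0\<close> near \<open>L\<close>. At one
  \<open>\<eta> k\<close> with bounded matrix elements and \<open>T (\<eta> k)\<close> close to
  \<open>L\<close> this gives a lower bound for \<open>1 + T J\<close>, which persists for all small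
  \<open>y\<close>. It makes \<open>T1\<close> bounded and Lipschitz in \<open>T\<close>, so that
  \<open>T1\<close> converges along with \<open>T\<close>.\<close>

lemma perturbed_limit:
  fixes T T1 :: "real \<Rightarrow> 'k::{real_inner,banach} \<Rightarrow>\<^sub>L 'k" and J :: "'k \<Rightarrow>\<^sub>L 'k"
  assumes lim: "(T \<longlongrightarrow> L) (at_right 0)"
    and T: "\<And>y x. 0 < y \<Longrightarrow> T y x = T1 y x + T y (J (T1 y x))" "\<And>y x. 0 < y \<Longrightarrow> T y x = T1 y x + T1 y (J (T y x))"
    and S: "\<And>n::nat. finite (S n)" "\<And>n. pairwise orthogonal (S n)"
    and approx: "\<And>y e. 0 < y \<Longrightarrow> 0 < e \<Longrightarrow> \<exists>n. \<forall>x. norm (T y x - span_projection (S n) (T y x)) \<le> e * norm x"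
    and bdd: "\<And>n. \<exists>C. \<exists>\<^sub>\<infinity>k. \<forall>a\<in>S n. \<forall>b\<in>S n. \<bar>inner a (T1 (\<eta> k) (J b))\<bar> \<le> C"
    and \<eta>: "\<And>k. 0 < \<eta> k" "\<eta> \<longlonglongrightarrow> 0"
  shows "\<exists>L1. (T1 \<longlongrightarrow> L1) (at_right 0)"
proof -
  \<comment> \<open>The summand one keeps \<open>j\<close> positive for \<open>J = 0\<close>, since
    \<open>j\<close> is divided by.\<close>
  define j where "j = norm J + 1"
  have j: "j > 0" "norm (J x) \<le> j * norm x" for x
  proof -
    show "j > 0" unfolding j_def using norm_ge_zero[of J] by linarith
    show "norm (J x) \<le> j * norm x"
      using norm_blinfun[of J x] norm_ge_zero[of x] unfolding j_def distrib_right by linarith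
  qed
  have close: "\<forall>\<^sub>F y in at_right 0. 0 < y \<and> norm (T y - L) < e" if "e > 0" for e
    using tendstoD[OF lim that] eventually_at_right_less[of 0] by eventually_elim (simp add: dist_norm)
  have TJ: "norm (T y (J x) - T y' (J x)) \<le> norm (T y - T y') * j * norm x" for y y' x
  proof -
    have "norm (T y (J x) - T y' (J x)) \<le> norm (T y - T y') * norm (J x)"
      using norm_blinfun[of "T y - T y'" "J x"] by (simp add: blinfun.diff_left)
    also have "\<dots> \<le> norm (T y - T y') * (j * norm x)" using j by (intro mult_left_mono) auto
    finally show ?thesis by simp
  qed
  \<comment> \<open>\<open>T y\<close> differs from \<open>T y0\<close> by at most
    \<open>2 * e1\<close>, so the complement of the projection contributes at most
    \<open>3 * e1 * j = 3/16\<close>, within the required \<open>1/2\<close>.\<close>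
  define e1 where "e1 = 1 / (16 * j)"
  have e1: "e1 > 0" using j by (simp add: e1_def)
  obtain y0 where y0: "0 < y0" "norm (T y0 - L) < e1"
    using eventually_happens'[OF _ close[OF e1]] by auto
  obtain n where n: "\<And>x. norm (T y0 x - span_projection (S n) (T y0 x)) \<le> e1 * norm x"
    using approx[OF y0(1) e1] by blast
  obtain C0 where C0: "\<exists>\<^sub>\<infinity>k. \<forall>a\<in>S n. \<forall>b\<in>S n. \<bar>inner a (T1 (\<eta> k) (J b))\<bar> \<le> C0" using bdd by blast
  \<comment> \<open>\<open>C0\<close> can be negative when \<open>S n\<close> is empty.\<close>
  define C where "C = max C0 0"
  interpret P: bounded_linear "span_projection (S n)" by (rule bounded_linear_span_projection)
  define \<tau> where "\<tau> = (norm L + e1) * j"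
  define D where "D = (\<Sum>a\<in>S n. \<Sum>b\<in>S n. norm b / inner b b * (norm a / inner a a))"
  define c where "c = 2 + 4 * (1 + C * D) * \<tau>"
  have \<tau>0: "0 \<le> \<tau>" unfolding \<tau>_def using e1 j by simp
  have "0 \<le> D" unfolding D_def by (intro sum_nonneg mult_nonneg_nonneg) auto
  then have c: "c > 0" unfolding c_def C_def using \<tau>0 by (intro add_pos_nonneg mult_nonneg_nonneg) auto
  have lower: "norm x \<le> c * norm (x + T y (J x))"
    if y: "0 < y" "norm (T y - L) < e1" and Cy: "\<forall>a\<in>S n. \<forall>b\<in>S n. \<bar>inner a (T1 y (J b))\<bar> \<le> C0" for y x
    unfolding c_def D_def
  proof (rule one_plus_lower_bound[OF T(2)[OF y(1)] S, where C = C and \<tau> = \<tau>])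
    have d: "norm (T y - T y0) \<le> 2 * e1" using norm_triangle_ineq4[of "T y - L" "T y0 - L"] y(2) y0(2) by simp
    show "norm (T y (J x) - span_projection (S n) (T y (J x))) \<le> 1/2 * norm x" for x
    proof -
      have *: "norm (u - span_projection (S n) u) \<le> norm u" for u
        using norm_diff_span_projection_le[OF S(1)[of n] S(2)[of n] span_zero, of u] by simp
      define u where "u = T y (J x) - T y0 (J x)"
      have nu: "norm u \<le> 2 * e1 * j * norm x"
        unfolding u_def using j by (intro order_trans[OF TJ] mult_right_mono d) auto
      have "T y (J x) - span_projection (S n) (T y (J x))
        = (u - span_projection (S n) u) + (T y0 (J x) - span_projection (S n) (T y0 (J x)))"
        by (simp add: u_def P.diff)
      then have "norm (T y (J x) - span_projection (S n) (T y (J x)))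
        \<le> norm (u - span_projection (S n) u) + norm (T y0 (J x) - span_projection (S n) (T y0 (J x)))"
        using norm_triangle_ineq by metis
      also have "\<dots> \<le> 2 * e1 * j * norm x + e1 * (j * norm x)"
        using order_trans[OF * nu] order_trans[OF n[of "J x"] mult_left_mono[OF j(2)[of x] less_imp_le[OF e1]]]
        by (rule add_mono)
      also have "\<dots> = 3 * (e1 * j) * norm x" by (simp add: algebra_simps)
      also have "e1 * j = 1/16" using j(1) by (simp add: e1_def)
      finally show ?thesis using norm_ge_zero[of x] by linarith
    qed
    show "norm (T y (J x)) \<le> \<tau> * norm x" for x
    proof -
      have "norm (T y) \<le> norm L + e1" using norm_triangle_ineq[of L "T y - L"] y(2) by simp
      then have "norm (T y (J x)) \<le> (norm L + e1) * (j * norm x)"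
        by (rule order_trans[OF norm_blinfun mult_mono]) (use j e1 in auto)
      then show ?thesis by (simp add: \<tau>_def)
    qed
    show "\<bar>inner a (T1 y (J b))\<bar> \<le> C" if "a \<in> S n" "b \<in> S n" for a b
      using Cy that unfolding C_def by fastforce
  qed (use \<tau>0 in \<open>simp_all add: C_def\<close>)
  \<comment> \<open>Replacing \<open>T (\<eta> k)\<close> by \<open>T y\<close> then costs at most
    \<open>norm x / (2 * c)\<close>, so half of the estimate survives; the bound by
    \<open>e1\<close> keeps \<open>lower\<close> applicable. The constant \<open>c\<close> was fixed
    before \<open>k\<close>.\<close>
  define e2 where "e2 = min e1 (1 / (4 * c * j))"
  have e2: "e2 > 0" unfolding e2_def using e1 c j by simp
  have "\<forall>\<^sub>F k in sequentially. 0 < \<eta> k \<and> norm (T (\<eta> k) - L) < e2"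
  proof -
    have "filterlim \<eta> (at_right 0) sequentially"
      using \<eta> by (intro tendsto_imp_filterlim_at_right) auto
    then show ?thesis using close[OF e2] by (auto simp: filterlim_iff)
  qed
  then have "\<exists>\<^sub>\<infinity>k. (\<forall>a\<in>S n. \<forall>b\<in>S n. \<bar>inner a (T1 (\<eta> k) (J b))\<bar> \<le> C0) \<and> 0 < \<eta> k \<and> norm (T (\<eta> k) - L) < e2"
    using C0 by (intro INFM_conjI) (auto simp: cofinite_eq_sequentially)
  then obtain k where k: "\<forall>a\<in>S n. \<forall>b\<in>S n. \<bar>inner a (T1 (\<eta> k) (J b))\<bar> \<le> C0" "0 < \<eta> k" "norm (T (\<eta> k) - L) < e2"
    using INFM_EX by blast
  have low2: "norm x \<le> 2 * c * norm (x + T y (J x))" if y: "0 < y" "norm (T y - L) < e2" for x y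
  proof -
    have d: "norm (T (\<eta> k) - T y) \<le> 2 * e2" using norm_triangle_ineq4[of "T (\<eta> k) - L" "T y - L"] y(2) k(3) by simp
    have "norm x \<le> c * norm (x + T (\<eta> k) (J x))"
      using k by (intro lower) (auto simp: e2_def)
    also have "norm (x + T (\<eta> k) (J x)) \<le> norm (x + T y (J x)) + norm (T (\<eta> k) (J x) - T y (J x))"
      using norm_triangle_ineq[of "x + T y (J x)" "T (\<eta> k) (J x) - T y (J x)"] by simp
    also have "norm (T (\<eta> k) (J x) - T y (J x)) \<le> 2 * e2 * j * norm x"
      using j by (intro order_trans[OF TJ] mult_right_mono d) auto
    also have "2 * e2 * j * norm x \<le> 2 * (1 / (4 * c * j)) * j * norm x"
      using j by (intro mult_right_mono mult_left_mono) (auto simp: e2_def)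
    also have "2 * (1 / (4 * c * j)) * j * norm x = norm x / (2 * c)" using j(1) c by (simp add: field_simps)
    finally have "norm x \<le> c * (norm (x + T y (J x)) + norm x / (2 * c))" using c by simp
    also have "\<dots> = c * norm (x + T y (J x)) + norm x / 2" using c by (simp add: field_simps)
    finally show ?thesis by simp
  qed
  define t where "t = 2 * c * (norm L + e2)"
  have T1n: "norm (T1 y) \<le> t" if y: "0 < y" "norm (T y - L) < e2" for y
  proof (rule norm_blinfun_bound)
    show "0 \<le> t" unfolding t_def using c e2 by simp
    fix x
    have "norm (T1 y x) \<le> 2 * c * norm (T1 y x + T y (J (T1 y x)))" by (rule low2[OF y])
    also have "\<dots> = 2 * c * norm (T y x)" by (simp only: T(1)[OF y(1), of x])
    also have "\<dots> \<le> 2 * c * ((norm L + e2) * norm x)"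
    proof -
      have "norm (T y) \<le> norm L + e2" using norm_triangle_ineq[of L "T y - L"] y(2) by simp
      then show ?thesis
        using c by (intro mult_left_mono[OF order_trans[OF norm_blinfun mult_right_mono]]) auto
    qed
    finally show "norm (T1 y x) \<le> t * norm x" by (simp add: t_def)
  qed
  define m where "m = 2 * c * (1 + j * t)"
  have t0: "0 \<le> t" unfolding t_def using c e2 by simp
  have lip: "norm (T1 y - T1 y') \<le> m * norm (T y - T y')"
    if y: "0 < y" "norm (T y - L) < e2" and y': "0 < y'" "norm (T y' - L) < e2" for y y'
  proof (rule norm_blinfun_bound)
    show "0 \<le> m * norm (T y - T y')" unfolding m_def using c t0 j by simp
    fix x
    define d where "d = T1 y x - T1 y' x"
    \<comment> \<open>The difference solves
      \<open>(1 + T y J) d = (T y - T y') (x - J (T1 y' x))\<close>, to which the lower bound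
      applies.\<close>
    have "d + T y (J d) = (T1 y x + T y (J (T1 y x))) - (T1 y' x + T y' (J (T1 y' x))) + (T y' (J (T1 y' x)) - T y (J (T1 y' x)))"
      by (simp add: d_def blinfun.diff_right)
    also have "\<dots> = (T y - T y') x + (T y' (J (T1 y' x)) - T y (J (T1 y' x)))"
      by (simp only: T(1)[OF y(1), of x, symmetric] T(1)[OF y'(1), of x, symmetric] blinfun.diff_left)
    finally have "norm (d + T y (J d)) \<le> norm ((T y - T y') x) + norm (T y' (J (T1 y' x)) - T y (J (T1 y' x)))"
      using norm_triangle_ineq by metis
    also have "\<dots> \<le> norm (T y - T y') * norm x + norm (T y - T y') * j * (t * norm x)"
    proof (rule add_mono[OF norm_blinfun])
      have "norm (T1 y' x) \<le> t * norm x"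
        using norm_blinfun[of "T1 y'" x] mult_right_mono[OF T1n[OF y'] norm_ge_zero[of x]] by linarith
      then show "norm (T y' (J (T1 y' x)) - T y (J (T1 y' x))) \<le> norm (T y - T y') * j * (t * norm x)"
        using j TJ[of y "T1 y' x" y'] by (subst norm_minus_commute) (auto intro!: order_trans[OF TJ] mult_left_mono)
    qed
    finally have "2 * c * norm (d + T y (J d)) \<le> 2 * c * (norm (T y - T y') * norm x + norm (T y - T y') * j * (t * norm x))"
      using c by (intro mult_left_mono) auto
    then have "norm d \<le> 2 * c * (norm (T y - T y') * norm x + norm (T y - T y') * j * (t * norm x))"
      using low2[OF y, of d] by linarith
    then show "norm ((T1 y - T1 y') x) \<le> m * norm (T y - T y') * norm x"
      by (simp add: d_def m_def blinfun.diff_left algebra_simps)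
  qed
  have m: "m > 0" unfolding m_def using c t0 j by (simp add: add_pos_nonneg)
  obtain b where b: "b > 0" "\<And>y. 0 < y \<Longrightarrow> y < b \<Longrightarrow> norm (T y - L) < e2"
    using close[OF e2] unfolding eventually_at_right_field by auto
  \<comment> \<open>\<open>Suc (Suc k)\<close> keeps every term strictly below \<open>b\<close>.
    Completeness gives a limit along this sequence, and the Lipschitz bound extends it to all
    \<open>y\<close>.\<close>
  define s where "s = (\<lambda>k::nat. b / real (Suc (Suc k)))"
  have s: "0 < s k" "s k < b" for k using b(1) by (simp_all add: s_def divide_less_eq)
  have "s \<longlonglongrightarrow> 0"
    unfolding s_def using LIMSEQ_Suc[OF LIMSEQ_Suc[OF lim_const_over_n[of b]]] by simp
  then have "filterlim s (at_right 0) sequentially"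
    using s by (intro tendsto_imp_filterlim_at_right) auto
  then have Ts: "(\<lambda>k. T (s k)) \<longlonglongrightarrow> L" by (rule filterlim_compose[OF lim])
  have "Cauchy (\<lambda>k. T1 (s k))"
  proof (rule metric_CauchyI)
    fix e :: real assume "e > 0"
    then obtain M where M: "\<And>p q. p \<ge> M \<Longrightarrow> q \<ge> M \<Longrightarrow> dist (T (s p)) (T (s q)) < e / m"
      using LIMSEQ_imp_Cauchy[OF Ts] m unfolding Cauchy_def by (meson divide_pos_pos)
    have "dist (T1 (s p)) (T1 (s q)) < e" if "p \<ge> M" "q \<ge> M" for p q
    proof -
      have "norm (T1 (s p) - T1 (s q)) \<le> m * norm (T (s p) - T (s q))"
        using s b(2) by (intro lip) auto
      also have "\<dots> < m * (e / m)" using M[OF that] m by (intro mult_strict_left_mono) (auto simp: dist_norm)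
      finally show ?thesis using m by (simp add: dist_norm)
    qed
    then show "\<exists>M. \<forall>p\<ge>M. \<forall>q\<ge>M. dist (T1 (s p)) (T1 (s q)) < e" by blast
  qed
  then obtain L1 where L1: "(\<lambda>k. T1 (s k)) \<longlonglongrightarrow> L1" using Cauchy_convergent convergent_def by blast
  have "norm (T1 y - L1) \<le> m * norm (T y - L)" if y: "0 < y" "y < b" for y
  proof (rule LIMSEQ_le)
    show "(\<lambda>k. norm (T1 y - T1 (s k))) \<longlonglongrightarrow> norm (T1 y - L1)" by (intro tendsto_intros L1)
    show "(\<lambda>k. m * norm (T y - T (s k))) \<longlonglongrightarrow> m * norm (T y - L)" by (intro tendsto_intros Ts)
    show "\<exists>N. \<forall>k\<ge>N. norm (T1 y - T1 (s k)) \<le> m * norm (T y - T (s k))"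
      using s b(2) y by (intro exI[of _ 0] allI impI lip) auto
  qed
  then have ev: "\<forall>\<^sub>F y in at_right 0. norm (T1 y - L1) \<le> m * norm (T y - L)"
    using b(1) unfolding eventually_at_right_field by auto
  have "((\<lambda>y. T1 y - L1) \<longlongrightarrow> 0) (at_right 0)"
  proof (rule Lim_null_comparison[OF ev])
    have "((\<lambda>y. m * norm (T y - L)) \<longlongrightarrow> m * norm (L - L)) (at_right 0)" by (intro tendsto_intros lim)
    then show "((\<lambda>y. m * norm (T y - L)) \<longlongrightarrow> 0) (at_right 0)" by simp
  qed
  then have "(T1 \<longlongrightarrow> L1) (at_right 0)" by (simp add: Lim_null[symmetric])
  then show ?thesis by blast
qed


section \<open>Sandwiched resolvents in the form representation\<close>

text \<open>Projecting \<open>(0, y)\<close> onto the closed graph to \<open>(f, g)\<close> puts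
  \<open>(y - g, f)\<close> into the adjoint. If \<open>y\<close> is orthogonal to its domain, then
  \<open>f = 0\<close> and \<open>g = y\<close>, so \<open>(0, y)\<close> lies in \<open>F\<close>
  and \<open>y = 0\<close>.\<close>

lemma closure_Domain_adjoint_op:
  fixes F :: "('h::chilbert_space, 'k::chilbert_space) op_graph"
  assumes F: "linear_operator F" "closed F"
  shows "closure (Domain (adjoint_op F)) = UNIV"
proof (rule subspace_orthogonal_zero_dense)
  have Fsub: "subspace F"
    unfolding subspace_def
  proof (intro conjI ballI allI)
    show "0 \<in> F" using F(1) unfolding linear_operator_def zero_prod_def by blast
    show "x + y \<in> F" if "x \<in> F" "y \<in> F" for x y
      using F(1) that unfolding linear_operator_def by (cases x; cases y) auto
    show "c *\<^sub>R x \<in> F" if "x \<in> F" for c x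
    proof (cases x)
      case (Pair f g)
      then have "(complex_of_real c *\<^sub>C f, complex_of_real c *\<^sub>C g) \<in> F"
        using F(1) that unfolding linear_operator_def by blast
      then show ?thesis using Pair by (simp add: scaleC_of_real)
    qed
  qed
  note adj = adjoint_op_real[OF F(1)]
  show "subspace (Domain (adjoint_op F))"
    unfolding subspace_def
  proof (intro conjI ballI allI)
    have "(0, 0) \<in> adjoint_op F" unfolding adj by simp
    then show "0 \<in> Domain (adjoint_op F)" by blast
    show "x + y \<in> Domain (adjoint_op F)" if xy: "x \<in> Domain (adjoint_op F)" "y \<in> Domain (adjoint_op F)" for x y
    proof -
      obtain u v where "(x, u) \<in> adjoint_op F" "(y, v) \<in> adjoint_op F" using xy by blast
      then have "(x + y, u + v) \<in> adjoint_op F" unfolding adj by (simp add: inner_add_right)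
      then show ?thesis by blast
    qed
    show "c *\<^sub>R x \<in> Domain (adjoint_op F)" if x: "x \<in> Domain (adjoint_op F)" for c x
    proof -
      obtain u where "(x, u) \<in> adjoint_op F" using x by blast
      then have "(c *\<^sub>R x, c *\<^sub>R u) \<in> adjoint_op F" unfolding adj by simp
      then show ?thesis by blast
    qed
  qed
  fix y assume y: "\<And>s. s \<in> Domain (adjoint_op F) \<Longrightarrow> inner y s = 0"
  obtain p where p: "p \<in> F" "\<And>s. s \<in> F \<Longrightarrow> inner ((0, y) - p) s = 0"
    using closed_subspace_orthogonal_projection[OF Fsub F(2), of "(0, y)"] by blast
  obtain f g where fg: "p = (f, g)" by (cases p)
  have "(y - g, f) \<in> adjoint_op F"
    unfolding adj
  proof (intro allI impI)
    fix u v assume "(u, v) \<in> F"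
    from p(2)[OF this] show "inner v (y - g) = inner u f" by (simp add: fg inner_prod_def inner_commute)
  qed
  then have "inner y (y - g) = 0" using y by blast
  moreover have "inner (y - g) g = inner f f" using p(2)[OF p(1)] by (simp add: fg inner_prod_def)
  ultimately have "inner (y - g) (y - g) + inner f f = 0"
    by (simp add: inner_diff_left inner_diff_right inner_commute)
  then have "y - g = 0" "f = 0" by (metis add_nonneg_eq_0_iff inner_eq_zero_iff inner_ge_zero)+
  then have "(0, y) \<in> F" using p(1) fg by simp
  then show "y = 0" using F(1) unfolding linear_operator_def single_valued_def by blast
qed

lemma compact_factorization:
  fixes F :: "('h::chilbert_space, 'k::chilbert_space) op_graph" and B :: "'h \<Rightarrow>\<^sub>L 'h"
  assumes c: "compact_operator (converse (op_pair B id_blinfun) O F)"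
  obtains G :: "'h \<Rightarrow>\<^sub>L 'k" where "clinear_blinfun G" "\<And>x l. (B x, l) \<in> F \<longleftrightarrow> l = G x"
    "compact (closure (G ` cball 0 1))"
proof -
  define A where "A = converse (op_pair B id_blinfun) O F"
  have A: "(x, l) \<in> A \<longleftrightarrow> (B x, l) \<in> F" for x l unfolding A_def op_pair_def by force
  have lin: "linear_operator A" and dom: "Domain A = UNIV" and comp: "compact (closure (A `` cball 0 1))"
    using c unfolding compact_operator_def A_def by auto
  have "\<exists>l. (x, l) \<in> A" for x using dom by blast
  then obtain g where g: "\<And>x. (x, g x) \<in> A" by metis
  have sv: "single_valued A" and add: "\<And>x y x' y'. (x, y) \<in> A \<Longrightarrow> (x', y') \<in> A \<Longrightarrow> (x + x', y + y') \<in> A"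
    and scale: "\<And>a x y. (x, y) \<in> A \<Longrightarrow> (a *\<^sub>C x, a *\<^sub>C y) \<in> A"
    using lin unfolding linear_operator_def by simp_all
  have iff: "(x, l) \<in> A \<longleftrightarrow> l = g x" for x l
    using g[of x] single_valuedD[OF sv] by metis
  have im: "A `` cball 0 1 = g ` cball 0 1" using iff by auto
  have gC: "g (a *\<^sub>C x) = a *\<^sub>C g x" for a x
    using scale[OF g[of x], of a] by (simp add: iff)
  have "bounded (g ` cball 0 1)"
    using bounded_subset[OF compact_imp_bounded[OF comp] closure_subset] unfolding im .
  then obtain K where "\<forall>y\<in>g ` cball 0 1. norm y \<le> K" unfolding bounded_iff by blast
  then have K: "norm (g x) \<le> K" if "norm x \<le> 1" for x using that by simp
  have gR: "g (r *\<^sub>R x) = r *\<^sub>R g x" for r x using gC[of "complex_of_real r" x] by (simp add: scaleC_of_real)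
  have bl: "bounded_linear g"
  proof (rule bounded_linear_intro[where K = K])
    show "g (x + y) = g x + g y" for x y
      using add[OF g[of x] g[of y]] by (simp add: iff)
    show "norm (g x) \<le> norm x * K" for x
    proof (cases "x = 0")
      case True
      then show ?thesis using gR[of 0 x] by simp
    next
      case False
      then have "norm (g (x /\<^sub>R norm x)) \<le> K" by (intro K) simp
      then show ?thesis using False by (simp add: gR field_simps)
    qed
  qed (rule gR)
  show ?thesis
    by (rule that[of "Blinfun g"])
      (use comp gC iff A im in \<open>auto simp: bounded_linear_Blinfun_apply[OF bl] clinear_blinfun_def\<close>)
qed

text \<open>Writing \<open>f = B x\<close> and applying \<open>B\<close> to
  \<open>(H - z) f = h\<close> gives \<open>pen z x = B h\<close>, and \<open>B h\<close> is
  \<open>Gs k\<close> because \<open>h\<close> is the value of the adjoint at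
  \<open>k\<close>.\<close>

lemma (in pencil) sandwiched_resolvent_value:
  assumes F: "\<And>x l. (B x, l) \<in> F \<Longrightarrow> l = G x" and adj: "\<And>k h. (k, h) \<in> adjoint_op F \<Longrightarrow> Gs k = B h"
    and H: "\<And>f h. (f, h) \<in> H \<Longrightarrow> \<exists>x. f = B x \<and> A x = B h"
    and z: "Im z \<noteq> 0" and kl: "(k, l) \<in> adjoint_op F O resolvent_op H z O F"
  shows "l = G (res z (Gs k))"
proof -
  obtain h f where hf: "(k, h) \<in> adjoint_op F" "(h, f) \<in> resolvent_op H z" "(f, l) \<in> F" using kl by blast
  then obtain h' where h': "h = h' - z *\<^sub>C f" "(f, h') \<in> H" unfolding resolvent_op_def by blast
  then obtain x where x: "f = B x" "A x = B h'" using H by blast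
  have "pen z x = Gs k"
    using adj[OF hf(1)] by (simp add: pen_def x h' blinfun.diff_right clinear_blinfunD[OF B(1)])
  then show ?thesis using F[of x l] hf(3) x(1) res_pen[OF z, of x] by simp
qed

text \<open>Solvability of the pencil produces \<open>(H - z)\<^sup>-\<^sup>1\<close> on the range
  of the adjoint of \<open>F\<close>; this is how the resolvent of the form perturbation is
  obtained.\<close>

lemma (in pencil) is_sandwiched_resolvent_res:
  fixes G :: "'h \<Rightarrow>\<^sub>L 'k::chilbert_space" and Gs :: "'k \<Rightarrow>\<^sub>L 'h"
  assumes F: "\<And>x l. (B x, l) \<in> F \<longleftrightarrow> l = G x" and adj: "\<And>k h. (k, h) \<in> adjoint_op F \<Longrightarrow> Gs k = B h"
    and H: "\<And>f h. (f, h) \<in> H \<longleftrightarrow> (\<exists>x. f = B x \<and> A x = B h)" and z: "Im z \<noteq> 0"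
  shows "is_sandwiched_resolvent H F z (G o\<^sub>L res z o\<^sub>L Gs)"
  unfolding is_sandwiched_resolvent_def
proof (intro conjI equalityI subsetI)
  fix k assume "k \<in> Domain (adjoint_op F)"
  then obtain h where h: "(k, h) \<in> adjoint_op F" by blast
  define x where "x = res z (Gs k)"
  have "pen z x = B h" using pen_res[OF z] adj[OF h] by (simp add: x_def)
  then have "A x = B (h + z *\<^sub>C B x)"
    by (simp add: pen_def blinfun.add_right clinear_blinfunD[OF B(1)] algebra_simps)
  then have "(B x, h + z *\<^sub>C B x) \<in> H" using H by blast
  then have "(h, B x) \<in> resolvent_op H z" unfolding resolvent_op_def by force
  moreover have "(B x, G x) \<in> F" using F by blast
  ultimately show "k \<in> Domain (adjoint_op F O resolvent_op H z O F)" using h by blast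
next
  show "\<forall>(k, l)\<in>adjoint_op F O resolvent_op H z O F. (G o\<^sub>L res z o\<^sub>L Gs) k = l"
  proof
    fix p assume p: "p \<in> adjoint_op F O resolvent_op H z O F"
    obtain k l where kl: "p = (k, l)" by (cases p)
    have "l = G (res z (Gs k))"
      by (rule sandwiched_resolvent_value[OF _ adj _ z p[unfolded kl]]) (use F H in auto)
    then show "case p of (k, l) \<Rightarrow> (G o\<^sub>L res z o\<^sub>L Gs) k = l" by (simp add: kl)
  qed
qed auto

lemma (in pencil) sandwiched_resolvent_unique:
  fixes G :: "'h \<Rightarrow>\<^sub>L 'k::chilbert_space" and Gs :: "'k \<Rightarrow>\<^sub>L 'h"
  assumes F: "\<And>x l. (B x, l) \<in> F \<longleftrightarrow> l = G x" and adj: "\<And>k h. (k, h) \<in> adjoint_op F \<Longrightarrow> Gs k = B h"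
    and H: "\<And>f h. (f, h) \<in> H \<Longrightarrow> \<exists>x. f = B x \<and> A x = B h" and z: "Im z \<noteq> 0"
    and dense: "closure (Domain (adjoint_op F)) = UNIV" and T: "is_sandwiched_resolvent H F z T"
  shows "T = G o\<^sub>L res z o\<^sub>L Gs"
proof (rule blinfun_eqI)
  fix k
  have "closed {k. T k = (G o\<^sub>L res z o\<^sub>L Gs) k}" by (intro closed_Collect_eq continuous_intros)
  moreover have "Domain (adjoint_op F) \<subseteq> {k. T k = (G o\<^sub>L res z o\<^sub>L Gs) k}"
  proof
    fix k assume "k \<in> Domain (adjoint_op F)"
    then obtain l where l: "(k, l) \<in> adjoint_op F O resolvent_op H z O F"
      using T unfolding is_sandwiched_resolvent_def by blast
    then have "T k = l"
      using conjunct2[OF T[unfolded is_sandwiched_resolvent_def], THEN bspec, of "(k, l)"] by simp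
    moreover have "l = G (res z (Gs k))"
      by (rule sandwiched_resolvent_value[OF _ adj H z l]) (use F in auto)
    ultimately show "k \<in> {k. T k = (G o\<^sub>L res z o\<^sub>L Gs) k}" by simp
  qed
  ultimately show "T k = (G o\<^sub>L res z o\<^sub>L Gs) k" using dense closure_minimal by blast
qed

text \<open>The form domain is the range of \<open>B\<close>. With \<open>f = B x\<close> and
  \<open>g = B y\<close> the form becomes \<open>cinner y (A x)\<close> and the right-hand side
  \<open>cinner y (B h)\<close>.\<close>

lemma form_perturbation_mem_iff:
  fixes F :: "('h::chilbert_space, 'k::chilbert_space) op_graph" and B E U A :: "'h \<Rightarrow>\<^sub>L 'h"
    and G :: "'h \<Rightarrow>\<^sub>L 'k"
  assumes S: "sqrt_op (abs_op H) = op_pair B E" and sgn: "sgn_op H = U"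
    and B: "clinear_blinfun B" "symmetric_blinfun B" "\<And>x. B x = 0 \<Longrightarrow> x = 0"
    and E: "clinear_blinfun E" "symmetric_blinfun E"
    and F: "\<And>x l. (B x, l) \<in> F \<longleftrightarrow> l = G x"
    and Gs: "\<And>k x. cinner (Gs k) x = cinner k (G x)"
    and A: "\<And>x. A x = E (U (E x)) + Gs (J (G x))"
  shows "(f, h) \<in> form_perturbation H F J \<longleftrightarrow> (\<exists>x. f = B x \<and> A x = B h)"
proof -
  have dom: "Domain (op_pair B E) = range B" unfolding op_pair_def by auto
  have inj: "x = y" if "B x = B y" for x y
    using B(3)[of "x - y"] that by (simp add: blinfun.diff_right)
  have appS: "app (op_pair B E) (B x) = E x" for x
    unfolding app_def op_pair_def by (rule the_equality) (auto dest: inj)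
  have appF: "app F (B x) = G x" for x unfolding app_def by (rule the_equality) (auto simp: F)
  have Gs': "cinner (G y) k = cinner y (Gs k)" for y k using Gs[of k y] cinner_commute by metis
  have "(\<forall>g\<in>range B. cinner (app (op_pair B E) g) (U (app (op_pair B E) (B x))) + cinner (app F g) (J (app F (B x))) = cinner g h)
    \<longleftrightarrow> A x = B h" for x
  proof -
    have "cinner (E y) (U (E x)) + cinner (G y) (J (G x)) = cinner y (A x)" for y
      unfolding A cinner_add_right Gs' using symmetric_cinner[OF E] by simp
    moreover have "cinner (B y) h = cinner y (B h)" for y by (rule symmetric_cinner[OF B(1,2)])
    moreover have "(\<forall>y. cinner y (A x) = cinner y (B h)) \<longleftrightarrow> A x = B h"
      by (metis Re_cinner vector_eq_ldot)
    ultimately show ?thesis by (simp add: appS appF)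
  qed
  then show ?thesis unfolding form_perturbation_def S sgn Let_def dom by auto
qed


theorem theorem1p1:
  fixes H\<^sub>0 :: "('h::chilbert_space, 'h) op_graph"
    and F :: "('h, 'k::chilbert_space) op_graph"
    and J :: "'k \<Rightarrow> 'k"
  assumes "separable_space (euclidean :: 'h topology)"
    and "separable_space (euclidean :: 'k topology)"
    and "self_adjoint H\<^sub>0"
    and "linear_operator F" and "closed F"
    and "sqrt_abs_compact H\<^sub>0 F"
    and "ker F = {0}" and "ker (adjoint_op F) = {0}"
    and "limiting_absorption H\<^sub>0 F"
    and "bounded_self_adjoint J"
  shows "limiting_absorption (form_perturbation H\<^sub>0 F J) F"
proof -
  obtain B E U :: "'h \<Rightarrow>\<^sub>L 'h" where
    clin: "clinear_blinfun B" "clinear_blinfun E" "clinear_blinfun U" and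
    sym: "symmetric_blinfun B" "symmetric_blinfun E" "symmetric_blinfun U" and
    Binj: "\<And>x. B x = 0 \<Longrightarrow> x = 0" and UE: "commuting U E" and
    BE: "\<And>x. B (B x) + E (E x) = x" and UUE: "\<And>x. U (U (E x)) = E x" and
    sqrt1: "sqrt_op (abs_op H\<^sub>0) = op_pair B E" and
    sqrt2: "sqrt_op (one_plus (abs_op H\<^sub>0)) = op_pair B id_blinfun" and
    sgn: "sgn_op H\<^sub>0 = U" and
    form: "\<And>f h. (f, h) \<in> H\<^sub>0 \<Longrightarrow> \<exists>x. f = B x \<and> E (U (E x)) = B h"
  proof (rule form_representation[OF \<open>self_adjoint H\<^sub>0\<close>], goal_cases)
    case (1 B E U)
    from 1(2-) show ?case by (rule 1(1))
  qed
  obtain G :: "'h \<Rightarrow>\<^sub>L 'k" where Gc: "clinear_blinfun G" and FG: "\<And>x l. (B x, l) \<in> F \<longleftrightarrow> l = G x"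
    and Gcomp: "compact (closure (G ` cball 0 1))"
    using compact_factorization[of B F] \<open>sqrt_abs_compact H\<^sub>0 F\<close>
    unfolding sqrt_abs_compact_def sqrt2 by blast
  obtain Gs :: "'k \<Rightarrow>\<^sub>L 'h" where Gs: "\<And>x y. inner (Gs y) x = inner y (G x)"
    by (rule adjoint_blinfun_exists[of G]) (rule that)
  have GsC: "cinner (Gs k) x = cinner k (G x)" for k x
  proof (rule cinner_eqI[OF Gs])
    have skew: "inner (\<i> *\<^sub>C u) v = - inner u (\<i> *\<^sub>C v)" for u v :: "'c::chilbert_space"
      using cinner_scaleC_left[of \<i> u v] cinner_scaleC_right[of u \<i> v] by (simp flip: Re_cinner)
    show "inner (\<i> *\<^sub>C Gs k) x = inner (\<i> *\<^sub>C k) (G x)"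
      unfolding skew Gs by (simp add: clinear_blinfunD[OF Gc])
  qed
  have adj: "Gs k = B h" if "(k, h) \<in> adjoint_op F" for k h
  proof -
    have "inner x (Gs k) = inner x (B h)" for x
    proof -
      have "inner (G x) k = inner (B x) h"
        using that FG[of x "G x"] adjoint_op_real[OF \<open>linear_operator F\<close>] by blast
      then show ?thesis using Gs[of k x] symmetric_blinfunD[OF sym(1), of x h] by (simp add: inner_commute)
    qed
    then show ?thesis by (metis vector_eq_ldot)
  qed
  note dense = closure_Domain_adjoint_op[OF \<open>linear_operator F\<close> \<open>closed F\<close>]
  define j where "j = Blinfun J"
  have bJ: "bounded_linear J" and JC: "\<And>a x. J (a *\<^sub>C x) = a *\<^sub>C J x" and Jsym: "\<And>x y. cinner (J x) y = cinner x (J y)"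
    using \<open>bounded_self_adjoint J\<close> unfolding bounded_self_adjoint_def bounded_clinear_def by auto
  have j: "blinfun_apply j = J" unfolding j_def by (rule bounded_linear_Blinfun_apply[OF bJ])
  have Jsym': "inner (J x) y = inner x (J y)" for x y using Jsym[of x y] by (simp flip: Re_cinner)
  define A0 where "A0 = E o\<^sub>L (U o\<^sub>L E)"
  define A1 where "A1 = A0 + (Gs o\<^sub>L (j o\<^sub>L G))"
  have A0: "A0 x = E (U (E x))" for x by (simp add: A0_def)
  have A1: "A1 x = A0 x + Gs (J (G x))" for x by (simp add: A1_def blinfun.add_left j)
  have GsCl: "Gs (a *\<^sub>C k) = a *\<^sub>C Gs k" for a k
  proof -
    have "cinner (Gs (a *\<^sub>C k)) x = cinner (a *\<^sub>C Gs k) x" for x by (simp add: GsC cinner_scaleC_left)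
    then show ?thesis by (metis Re_cinner vector_eq_rdot)
  qed
  have A0c: "clinear_blinfun A0" "symmetric_blinfun A0"
    using clin sym unfolding clinear_blinfun_def symmetric_blinfun_def A0 by simp_all
  have A1c: "clinear_blinfun A1"
    using A0c(1) Gc unfolding clinear_blinfun_def A1 by (simp add: GsCl JC scaleC_add_right)
  have A1s: "symmetric_blinfun A1"
    unfolding symmetric_blinfun_def A1
  proof (intro allI)
    fix x y
    have "inner (Gs (J (G x))) y = inner x (Gs (J (G y)))"
      using Gs[of "J (G x)" y] Gs[of "J (G y)" x] Jsym'[of "G x" "G y"] by (simp add: inner_commute)
    then show "inner (A0 x + Gs (J (G x))) y = inner x (A0 y + Gs (J (G y)))"
      using symmetric_blinfunD[OF A0c(2), of x y] by (simp add: inner_add_left inner_add_right)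
  qed
  \<comment> \<open>\<open>U\<close> is isometric on the range of \<open>E\<close>, so
    \<open>norm (A0 x)\<close> is the norm of \<open>E (E x) = x - B (B x)\<close>.\<close>
  have ell0: "norm x \<le> norm B * norm (B x) + 1 * norm (A0 x)" for x
  proof -
    have "A0 x = U (E (E x))" using commutingD[OF UE] by (simp add: A0)
    moreover have "inner (U (E (E x))) (U (E (E x))) = inner (E (E x)) (E (E x))"
      using symmetric_blinfunD[OF sym(3), of "E (E x)" "U (E (E x))"] UUE[of "E x"] by simp
    ultimately have "norm (A0 x) = norm (E (E x))" by (simp add: norm_eq_sqrt_inner)
    moreover have "norm x \<le> norm (B (B x)) + norm (E (E x))" using norm_triangle_ineq[of "B (B x)" "E (E x)"] BE by simp
    ultimately show ?thesis using norm_blinfun[of B "B x"] by linarith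
  qed
  have "\<exists>a b. 0 \<le> a \<and> 0 \<le> b \<and> (\<forall>x. norm x \<le> a * norm (B x) + b * norm (A0 x))"
    using ell0 norm_ge_zero[of B] zero_le_one by blast
  then interpret P0: pencil A0 B
    by unfold_locales (use A0c clin sym Binj in auto)
  define n where "n = norm (Gs o\<^sub>L j)"
  \<comment> \<open>With this constant the perturbation costs at most half of \<open>norm x\<close>,
    which is absorbed in \<open>ell1\<close>; \<open>n + 1\<close> keeps the denominator
    positive.\<close>
  obtain c where c: "0 \<le> c" "\<And>x. norm (G x) \<le> 1 / (2 * (n + 1)) * norm x + c * norm (B x)"
    using ehrling[OF Gcomp sym(1) Binj, of "1 / (2 * (n + 1))"] by (auto simp: n_def add_nonneg_pos)
  have ell1: "norm x \<le> (2 * norm B + 2 * n * c) * norm (B x) + 2 * norm (A1 x)" for x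
  proof -
    have n0: "n \<ge> 0" by (simp add: n_def)
    have "norm (A0 x) = norm (A1 x - Gs (J (G x)))" by (simp add: A1)
    also have "\<dots> \<le> norm (A1 x) + norm (Gs (J (G x)))" by (rule norm_triangle_ineq4)
    also have "norm (Gs (J (G x))) \<le> n * norm (G x)"
      using norm_blinfun[of "Gs o\<^sub>L j" "G x"] by (simp add: n_def j)
    also have "n * norm (G x) \<le> n * (1 / (2 * (n + 1)) * norm x + c * norm (B x))"
      using c(2) n0 by (rule mult_left_mono)
    also have "\<dots> = n / (n + 1) * (norm x / 2) + n * c * norm (B x)" by (simp add: algebra_simps)
    also have "n / (n + 1) * (norm x / 2) \<le> 1 * (norm x / 2)" using n0 by (intro mult_right_mono) auto
    finally have "norm (A0 x) \<le> norm (A1 x) + (norm x / 2 + n * c * norm (B x))" by simp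
    then have "norm x \<le> 2 * (norm B * norm (B x)) + 2 * (norm (A1 x) + n * c * norm (B x))"
      using ell0[of x] by simp
    then show ?thesis by (simp add: algebra_simps)
  qed
  have "0 \<le> 2 * norm B + 2 * n * c" using c(1) by (simp add: n_def)
  then have "\<exists>a b. 0 \<le> a \<and> 0 \<le> b \<and> (\<forall>x. norm x \<le> a * norm (B x) + b * norm (A1 x))"
    using ell1 zero_le_numeral by blast
  then interpret P1: pencil A1 B
    by unfold_locales (use A1c A1s clin sym Binj in auto)
  have H1: "(f, h) \<in> form_perturbation H\<^sub>0 F J \<longleftrightarrow> (\<exists>x. f = B x \<and> A1 x = B h)" for f h
    by (rule form_perturbation_mem_iff[OF sqrt1 sgn clin(1) sym(1) Binj clin(2) sym(2) FG GsC])
      (simp_all add: A1 A0)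
  define T0 where "T0 = (\<lambda>z. G o\<^sub>L P0.res z o\<^sub>L Gs)"
  define T1 where "T1 = (\<lambda>z. G o\<^sub>L P1.res z o\<^sub>L Gs)"
  have sand1: "is_sandwiched_resolvent (form_perturbation H\<^sub>0 F J) F z (T1 z)" if "Im z \<noteq> 0" for z
    unfolding T1_def by (rule P1.is_sandwiched_resolvent_res[OF FG adj H1 that])
  have sand0: "T = T0 z" if "Im z \<noteq> 0" "is_sandwiched_resolvent H\<^sub>0 F z T" for z T
    unfolding T0_def
    by (rule P0.sandwiched_resolvent_unique[OF FG adj _ that(1) dense that(2)]) (use form A0 in auto)
  \<comment> \<open>The pencils differ by a term independent of \<open>z\<close>, whose
    factorization through \<open>G\<close> and \<open>Gs\<close> closes both resolvent identities on
    the sandwiched operators.\<close>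
  have pens: "P1.pen z x = P0.pen z x + Gs (J (G x))" for z x
    unfolding P1.pen_def P0.pen_def by (simp add: A1)
  have id1: "T0 z x = T1 z x + T0 z (j (T1 z x))" if z: "Im z \<noteq> 0" for z x
  proof -
    define u where "u = P1.res z (Gs x)"
    have "P0.pen z u = Gs (x - J (G u))"
      using P1.pen_res[OF z, of "Gs x"] pens[of z u] by (simp add: u_def blinfun.diff_right algebra_simps)
    then have "u = P0.res z (Gs (x - J (G u)))" using P0.res_pen[OF z] by metis
    then have "G u = T0 z (x - J (G u))" by (metis T0_def blinfun_apply_blinfun_compose)
    then show ?thesis by (simp add: T1_def u_def j blinfun.diff_right eq_diff_eq)
  qed
  have id2: "T0 z x = T1 z x + T1 z (j (T0 z x))" if z: "Im z \<noteq> 0" for z x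
  proof -
    define u where "u = P0.res z (Gs x)"
    have "P1.pen z u = Gs (x + J (G u))"
      using P0.pen_res[OF z, of "Gs x"] pens[of z u] by (simp add: u_def blinfun.add_right)
    then have "u = P1.res z (Gs (x + J (G u)))" using P1.res_pen[OF z] by metis
    then have "G u = T1 z (x + J (G u))" by (metis T1_def blinfun_apply_blinfun_compose)
    then show ?thesis by (simp add: T0_def u_def j blinfun.add_right)
  qed
  \<comment> \<open>The projections are fixed before \<open>t\<close>, so the Herglotz estimate
    excludes only a countable union of null sets.\<close>
  have "\<exists>S. finite S \<and> pairwise orthogonal S \<and> (\<forall>x. norm (G x - span_projection S (G x)) \<le> 1 / real (Suc m) * norm x)" for m
    using compact_finite_rank_approximation[OF Gcomp, of "1 / real (Suc m)"] by (metis of_nat_0_less_iff zero_less_Suc zero_less_divide_1_iff)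
  then obtain S where S: "\<And>m. finite (S m)" "\<And>m. pairwise orthogonal (S m)"
    "\<And>m x. norm (G x - span_projection (S m) (G x)) \<le> 1 / real (Suc m) * norm x" by metis
  define \<eta> where "\<eta> = (\<lambda>k::nat. 1 / real (Suc k))"
  have \<eta>: "0 < \<eta> k" "\<eta> \<longlonglongrightarrow> 0" for k
    unfolding \<eta>_def using LIMSEQ_inverse_real_of_nat by (simp_all add: inverse_eq_divide)
  \<comment> \<open>The polarization vectors for the matrix elements between \<open>Gs a\<close> and
    \<open>Gs (J b)\<close>.\<close>
  define \<Phi> where "\<Phi> = (\<lambda>m. (\<Union>a\<in>S m. \<Union>b\<in>S m. {Gs a + Gs (J b), Gs a - Gs (J b), Gs a + \<i> *\<^sub>C Gs (J b), Gs a - \<i> *\<^sub>C Gs (J b)}))"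
  have fin: "finite (\<Phi> m)" for m unfolding \<Phi>_def using S(1) by auto
  have "AE t in lborel. \<forall>m. \<exists>C. \<exists>\<^sub>\<infinity>k. \<forall>x\<in>\<Phi> m. cmod (cinner x (P1.res (Complex t (\<eta> k)) x)) \<le> C"
    unfolding AE_all_countable by (intro allI P1.AE_res_bounded fin \<eta>)
  then have bdd: "AE t in lebesgue. \<forall>m. \<exists>C. \<exists>\<^sub>\<infinity>k. \<forall>x\<in>\<Phi> m. cmod (cinner x (P1.res (Complex t (\<eta> k)) x)) \<le> C"
    by (rule AE_completion)
  have "AE t in lebesgue. \<exists>(T :: real \<Rightarrow> 'k \<Rightarrow>\<^sub>L 'k) L.
      (\<forall>y>0. is_sandwiched_resolvent H\<^sub>0 F (Complex t y) (T y)) \<and> (T \<longlongrightarrow> L) (at_right 0)"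
    using \<open>limiting_absorption H\<^sub>0 F\<close> unfolding limiting_absorption_def .
  then show ?thesis
    unfolding limiting_absorption_def using bdd
  proof eventually_elim
    case (elim t)
    then obtain T L where T: "\<And>y. y > 0 \<Longrightarrow> is_sandwiched_resolvent H\<^sub>0 F (Complex t y) (T y)" "(T \<longlongrightarrow> L) (at_right 0)"
      by blast
    have "\<forall>\<^sub>F y in at_right 0. T y = T0 (Complex t y)"
      using eventually_at_right_less[of 0] by eventually_elim (use sand0 T(1) in simp)
    then have lim: "((\<lambda>y. T0 (Complex t y)) \<longlongrightarrow> L) (at_right 0)"
      by (rule Lim_transform_eventually[OF T(2)])
    have ex: "\<exists>L1. ((\<lambda>y. T1 (Complex t y)) \<longlongrightarrow> L1) (at_right 0)"
    proof (rule perturbed_limit[OF lim, where J = j and S = S and \<eta> = \<eta>])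
      show "T0 (Complex t y) x = T1 (Complex t y) x + T0 (Complex t y) (j (T1 (Complex t y) x))" if "0 < y" for y x
        by (rule id1) (use that in simp)
      show "T0 (Complex t y) x = T1 (Complex t y) x + T1 (Complex t y) (j (T0 (Complex t y) x))" if "0 < y" for y x
        by (rule id2) (use that in simp)
      show "\<exists>m. \<forall>x. norm (T0 (Complex t y) x - span_projection (S m) (T0 (Complex t y) x)) \<le> e * norm x"
        if "0 < y" "0 < e" for y e
      proof -
        \<comment> \<open>The error of approximating \<open>G\<close> is multiplied by the norm of
          the remaining factor, which may be large for small \<open>y\<close>; \<open>m\<close> is
          chosen accordingly.\<close>
        define K where "K = norm (P0.res (Complex t y) o\<^sub>L Gs)"
        obtain m where m: "K / e < real m" using reals_Archimedean2 by blast
        have "norm (T0 (Complex t y) x - span_projection (S m) (T0 (Complex t y) x)) \<le> e * norm x" for x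
        proof -
          have "norm (T0 (Complex t y) x - span_projection (S m) (T0 (Complex t y) x)) \<le> 1 / real (Suc m) * norm (P0.res (Complex t y) (Gs x))"
            using S(3)[of "P0.res (Complex t y) (Gs x)" m] by (simp add: T0_def)
          also have "\<dots> \<le> 1 / real (Suc m) * (K * norm x)"
            using norm_blinfun[of "P0.res (Complex t y) o\<^sub>L Gs" x] by (intro mult_left_mono) (simp_all add: K_def)
          also have "\<dots> = K / real (Suc m) * norm x" by simp
          also have "\<dots> \<le> e * norm x"
          proof (rule mult_right_mono)
            have "K \<le> e * real m" using m \<open>0 < e\<close> by (simp add: pos_divide_less_eq mult.commute)
            also have "\<dots> \<le> e * real (Suc m)" using \<open>0 < e\<close> by (intro mult_left_mono) auto
            finally show "K / real (Suc m) \<le> e" by (simp add: pos_divide_le_eq)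
          qed simp
          finally show ?thesis .
        qed
        then show ?thesis by blast
      qed
      show "\<exists>C. \<exists>\<^sub>\<infinity>k. \<forall>a\<in>S m. \<forall>b\<in>S m. \<bar>inner a (T1 (Complex t (\<eta> k)) (j b))\<bar> \<le> C" for m
      proof -
        obtain C where C: "\<exists>\<^sub>\<infinity>k. \<forall>x\<in>\<Phi> m. cmod (cinner x (P1.res (Complex t (\<eta> k)) x)) \<le> C" using elim by blast
        have "\<forall>a\<in>S m. \<forall>b\<in>S m. \<bar>inner a (T1 (Complex t (\<eta> k)) (j b))\<bar> \<le> C"
          if k: "\<forall>x\<in>\<Phi> m. cmod (cinner x (P1.res (Complex t (\<eta> k)) x)) \<le> C" for k
        proof (intro ballI)
          fix a b assume ab: "a \<in> S m" "b \<in> S m"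
          define x v z where "x = Gs a" and "v = Gs (J b)" and "z = Complex t (\<eta> k)"
          have z: "Im z \<noteq> 0" using \<eta>(1)[of k] by (simp add: z_def)
          have "x + v \<in> \<Phi> m" "x - v \<in> \<Phi> m" "x + \<i> *\<^sub>C v \<in> \<Phi> m" "x - \<i> *\<^sub>C v \<in> \<Phi> m"
            unfolding \<Phi>_def x_def v_def using ab by blast+
          then have "4 * cmod (cinner x (P1.res z v)) \<le> C + C + C + C"
            using k by (intro order_trans[OF P1.cinner_res_polarization[OF z]] add_mono) (auto simp: z_def)
          moreover have "inner a (T1 z (j b)) = Re (cinner x (P1.res z v))"
            using GsC[of a "P1.res z v"] by (simp add: T1_def j x_def v_def Re_cinner)
          ultimately show "\<bar>inner a (T1 (Complex t (\<eta> k)) (j b))\<bar> \<le> C"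
            using abs_Re_le_cmod[of "cinner x (P1.res z v)"] unfolding z_def by linarith
        qed
        then have "\<exists>\<^sub>\<infinity>k. \<forall>a\<in>S m. \<forall>b\<in>S m. \<bar>inner a (T1 (Complex t (\<eta> k)) (j b))\<bar> \<le> C"
          by (rule INFM_mono[OF C])
        then show ?thesis by blast
      qed
    qed (rule S(1) S(2) \<eta>(1) \<eta>(2))+
    have "\<forall>y>0. is_sandwiched_resolvent (form_perturbation H\<^sub>0 F J) F (Complex t y) (T1 (Complex t y))"
      using sand1 by simp
    with ex show ?case by (intro exI[of _ "\<lambda>y. T1 (Complex t y)"]) simp
  qed
qed

end
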